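(* Let $k\geq 1$ be an integer and let $\mu$ be the surface measure on the graph of the $(k,1)$-additive Brownian sheet. Then, almost surely, for all $\theta\in[0,1]$, $$\dim^{\theta}_{\mathrm{F}}\mu=\min\big\{k+\tfrac{\theta}{2},\,2+k\theta\big\}.$$ In particular, the function $\theta\mapsto\dim^{\theta}_{\mathrm{F}}\mu$ has a phase transition at $\theta=\frac{k-2}{k-1/2}$ whenever $k>2$, and for $k=1,2$ it is affine on $[0,1]$.
   Context: The $(k,1)$-additive Brownian sheet is the random map $W:[0,1]^k\to\mathbb{R}$ given by $W(t)=\sum_{i=1}^k W^i(t_i)$ for $t=(t_1,\dots,t_k)\in[0,1]^k$, where $W^1,\dots,W^k:[0,1]\to\mathbb{R}$ are independent standard one-parameter Brownian motions (almost surely continuous, $W^i(0)=0$). Its graph is $G(W)=\{(t,W(t)):t\in[0,1]^k\}\subset\mathbb{R}^{k+1}$ (the additive Brownian surface), and the surface measure $\mu$ on it is the Borel measure on $\mathbb{R}^{k+1}$ given by $\mu(E)=\mathcal{L}^k\{t\in[0,1]^k:(t,W(t))\in E\}$ for Borel $E\subset\mathbb{R}^{k+1}$, where $\mathcal{L}^k$ is $k$-dimensional Lebesgue measure. For a finite Borel measure $\mu$ on $\mathbb{R}^d$ (here $d=k+1$), let $\widehat{\mu}(\xi)=\int e^{-2\pi i\xi\cdot x}\,d\mu(x)$. For $\theta\in(0,1]$ and $s>0$ define the $(s,\theta)$-energy $$\mathcal{J}_{s,\theta}(\mu)=\bigg(\int_{\mathbb{R}^d}|\widehat{\mu}(\xi)|^{\frac{2}{\theta}}|\xi|^{\frac{s}{\theta}-d}\,d\xi\bigg)^{\theta},$$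 and for $\theta=0$ define $\mathcal{J}_{s,0}(\mu)=\sup_{\xi\in\mathbb{R}^d}|\widehat{\mu}(\xi)|^2|\xi|^s$. The Fourier spectrum of $\mu$ at $\theta\in[0,1]$ is $\dim^{\theta}_{\mathrm{F}}\mu=\sup\{s>0:\mathcal{J}_{s,\theta}(\mu)<\infty\}$. "Phase transition" at a value of $\theta$ means that the piecewise affine function $\theta\mapsto\dim^\theta_{\mathrm F}\mu$ changes slope there. *)

theory Defs
  imports "HOL-Probability.Probability"
begin

text \<open>The time interval is \<open>[0, 1]\<close>; the values \<open>X t\<close> for other \<open>t\<close> are never used.\<close>

definition standard_brownian_motion :: "'w measure \<Rightarrow> (real \<Rightarrow> 'w \<Rightarrow> real) \<Rightarrow> bool" where
  "standard_brownian_motion M X \<longleftrightarrow>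
     prob_space M \<and>
     (\<forall>t\<in>{0..1}. X t \<in> borel_measurable M) \<and>
     (AE \<omega> in M. X 0 \<omega> = 0) \<and>
     (\<forall>(n::nat) (t::nat \<Rightarrow> real).
        strict_mono_on {0..n} t \<and> t ` {0..n} \<subseteq> {0..1} \<longrightarrow>
        prob_space.indep_vars M (\<lambda>_. borel)
          (\<lambda>j \<omega>. X (t (Suc j)) \<omega> - X (t j) \<omega>) {0..<n}) \<and>
     (\<forall>s t. 0 \<le> s \<and> s < t \<and> t \<le> 1 \<longrightarrow>
        distributed M lborel (\<lambda>\<omega>. X t \<omega> - X s \<omega>) (normal_density 0 (sqrt (t - s)))) \<and>
     (AE \<omega> in M. continuous_on {0..1} (\<lambda>t. X t \<omega>))"

text \<open>Processes indexed by \<open>[0, 1]\<close> are independent when their paths are independent as random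
  elements of the product space \<open>\<real>\<^bsup>[0,1]\<^esup>\<close>.\<close>

definition indep_processes ::
    "'w measure \<Rightarrow> ('i \<Rightarrow> real \<Rightarrow> 'w \<Rightarrow> real) \<Rightarrow> 'i set \<Rightarrow> bool" where
  "indep_processes M X I \<longleftrightarrow>
     prob_space.indep_vars M (\<lambda>_. Pi\<^sub>M {0..1} (\<lambda>_. borel)) (\<lambda>i \<omega>. \<lambda>t\<in>{0..1}. X i t \<omega>) I"

definition additive_sheet ::
    "('k::finite \<Rightarrow> real \<Rightarrow> 'w \<Rightarrow> real) \<Rightarrow> 'w \<Rightarrow> real ^ 'k \<Rightarrow> real" where
  "additive_sheet X \<omega> t = (\<Sum>i\<in>UNIV. X i (t $ i) \<omega>)"

text \<open>\<open>\<real>\<^bsup>k+1\<^esup>\<close> is represented by \<open>\<real>\<^sup>k \<times> \<real>\<close>, whose norm, inner product and Lebesgue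
  measure are the Euclidean ones.\<close>

definition surface_measure :: "(real ^ 'k::finite \<Rightarrow> real) \<Rightarrow> ((real ^ 'k) \<times> real) measure" where
  "surface_measure W = distr (restrict_space lborel (cbox 0 1)) borel (\<lambda>t. (t, W t))"

lemma emeasure_surface_measure:
  fixes W :: "real ^ 'k::finite \<Rightarrow> real"
  assumes "W \<in> borel_measurable (restrict_space lborel (cbox 0 1))" and "E \<in> sets borel"
  shows "emeasure (surface_measure W) E = emeasure lborel {t \<in> cbox 0 1. (t, W t) \<in> E}"
proof -
  let ?R = "restrict_space lborel (cbox 0 1) :: (real ^ 'k) measure"
  have id: "(\<lambda>t. t) \<in> borel_measurable ?R"
    by (rule measurable_restrict_space1) simp
  have m: "(\<lambda>t. (t, W t)) \<in> borel_measurable ?R"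
    using borel_measurable_Pair[OF id assms(1)] by simp
  have s: "space ?R = cbox 0 1"
    by (simp add: space_restrict_space)
  have eq: "(\<lambda>t. (t, W t)) -` E \<inter> space ?R = {t \<in> cbox 0 1. (t, W t) \<in> E}"
    unfolding s by blast
  show ?thesis
    unfolding surface_measure_def
    using assms(2) m by (simp only: emeasure_distr eq, subst emeasure_restrict_space) auto
qed

definition fourier_transform :: "'a::euclidean_space measure \<Rightarrow> 'a \<Rightarrow> complex" where
  "fourier_transform \<mu> \<xi> = (LINT x|\<mu>. exp (- 2 * of_real pi * \<i> * of_real (\<xi> \<bullet> x)))"

text \<open>Real powers on \<open>[0, \<infinity>]\<close> with positive exponent.\<close>

definition ennreal_pow :: "ennreal \<Rightarrow> real \<Rightarrow> ennreal" where
  "ennreal_pow x p = (if x = \<infinity> then \<infinity> else ennreal (enn2real x powr p))"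

definition fourier_energy :: "real \<Rightarrow> real \<Rightarrow> 'a::euclidean_space measure \<Rightarrow> ennreal" where
  "fourier_energy s \<theta> \<mu> =
     (if \<theta> = 0
      then (SUP \<xi>. ennreal ((norm (fourier_transform \<mu> \<xi>))\<^sup>2 * norm \<xi> powr s))
      else ennreal_pow
             (\<integral>\<^sup>+ \<xi>. ennreal (norm (fourier_transform \<mu> \<xi>) powr (2 / \<theta>)
                         * norm \<xi> powr (s / \<theta> - DIM('a))) \<partial>lborel) \<theta>)"

text \<open>The supremum is taken in \<open>[0, \<infinity>]\<close>, so it is \<open>0\<close> for the empty set and \<open>\<infinity>\<close> for an
  unbounded one.\<close>

definition fourier_spectrum :: "'a::euclidean_space measure \<Rightarrow> real \<Rightarrow> ennreal" where
  "fourier_spectrum \<mu> \<theta> = (SUP s \<in> {s. s > 0 \<and> fourier_energy s \<theta> \<mu> < \<infinity>}. ennreal s)"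

definition affine_with_slope_on :: "real set \<Rightarrow> real \<Rightarrow> (real \<Rightarrow> real) \<Rightarrow> bool" where
  "affine_with_slope_on S a f \<longleftrightarrow> (\<exists>c. \<forall>x\<in>S. f x = a * x + c)"

text \<open>The function is affine on either side of \<open>\<theta>\<close>, near \<open>\<theta>\<close> and within \<open>[0, 1]\<close>,
  with two different slopes.\<close>

definition phase_transition_at :: "(real \<Rightarrow> real) \<Rightarrow> real \<Rightarrow> bool" where
  "phase_transition_at f \<theta> \<longleftrightarrow>
     (\<exists>\<epsilon>>0. \<exists>a b. {\<theta> - \<epsilon>..\<theta> + \<epsilon>} \<subseteq> {0..1} \<and> a \<noteq> b \<and>
        affine_with_slope_on {\<theta> - \<epsilon>..\<theta>} a f \<and> affine_with_slope_on {\<theta>..\<theta> + \<epsilon>} b f)"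

end

(*
  The transform of the surface measure at (xi, y) is the product of the transforms F_i(xi_i, y) of
  the paths t |-> (t, W_i t), so everything reduces to estimates for a single Brownian path.

  Almost surely |F(x, y)|^2 is, up to factors (1 + |x| + |y|)^eps, at most B / max(|x|, B)^2 with
  B = 1 + y^2.  To see this, let q be the conditional mean of the factor exp(-2 pi i y W) over a time
  step tau comparable to 1 / max(|x|, B).  Comparing F with its shift by tau expresses
  (1 - q exp(-2 pi i x tau)) F by martingale differences, whose moments of all orders are
  controlled, while the prefactor stays away from 0; a grid argument makes the bound uniform.
  Integrating it gives the lower bound for the spectrum.

  The upper bound 2 + k theta uses only continuity: for fixed y the function exp(-2 pi i y W) on
  [0, 1], extended by 0, jumps at 0, so its transform cannot be integrable, and Hoelder's inequality
  turns this into a divergent energy in the region where xi_1 is large and all other frequencies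
  are bounded.  The upper bound k + theta / 2 uses that paths are nearly Hoelder-1/2 in quadratic
  mean: at frequencies |xi_i| <= R and |y| <= R^(1/2 - eps) the average of |F|^2 is at least c / R.
*)

theory Submission
  imports Defs
begin

section \<open>Moments of martingale sums\<close>

text \<open>The exceptional null set must not depend on theta, so chance is eliminated before any
  energy appears: \<open>brownian_like_path\<close> collects deterministic properties of a single
  path, and the estimates of the energies hold for every family of such paths. The size B / max(|x|,
  B)^2 reflects two time scales: the phase x t turns over in time 1 / |x|, while exp(-2 pi i y W)
  forgets its past in time about 1 / y^2. With tau comparable to the smaller one, the 1 / tau
  martingale differences have variance of order y^2 tau each, so their sum is of order sqrt B and F
  of order tau sqrt B. High moments serve uniformity: a union over polynomially many frequencies
  costs a fixed power of the frequency, which becomes an arbitrarily small power once the n-th root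
  of a 2n-th moment bound is taken. Mean values of |F|^2 use Gaussian weights because these
  factorise over the coordinates and their transform is a positive kernel concentrated at time
  differences of order 1 / R. At theta = 0 the energy is a supremum; the upper bound there comes
  from letting theta tend to 0.\<close>

lemma even_power_add_le:
  fixes x y :: real
  assumes "n \<ge> 1"
  shows "(x + y) ^ (2*n) \<le> x ^ (2*n) + 2 * real n * x ^ (2*n-1) * y
           + 4 ^ n * (x ^ (2*n-2) * y\<^sup>2 + y ^ (2*n))"
proof -
  let ?m = "2*n"
  let ?Q = "x ^ (2*n-2) * y\<^sup>2 + y ^ (2*n)"
  have m2: "2 \<le> ?m" using assms by simp
  have ev: "0 \<le> x ^ (2*n-2)" "0 \<le> y ^ (2*n)"
    by (auto simp: zero_le_even_power)
  have Q0: "0 \<le> ?Q" using ev by simp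
  \<comment> \<open>Each term of order at least two in \<open>y\<close> lies below one of two
    extremes: powers of the smaller of |x| and |y| may be exchanged for powers of the larger. The
    linear term stays apart because it will have mean zero for a martingale difference.\<close>
  have term_le: "y ^ k * x ^ (?m - k) \<le> ?Q" if k: "k \<in> {2..?m}" for k
  proof -
    have "y ^ k * x ^ (?m - k) \<le> \<bar>y\<bar> ^ k * \<bar>x\<bar> ^ (?m - k)"
      by (metis abs_ge_self abs_mult power_abs)
    also have "\<dots> \<le> ?Q"
    proof (cases "\<bar>y\<bar> \<le> \<bar>x\<bar>")
      case True
      have "\<bar>y\<bar> ^ k * \<bar>x\<bar> ^ (?m - k) = \<bar>y\<bar>\<^sup>2 * (\<bar>y\<bar> ^ (k - 2) * \<bar>x\<bar> ^ (?m - k))"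
        using k by (metis atLeastAtMost_iff le_add_diff_inverse mult.assoc power_add)
      also have "\<dots> \<le> \<bar>y\<bar>\<^sup>2 * (\<bar>x\<bar> ^ (k - 2) * \<bar>x\<bar> ^ (?m - k))"
        using True by (intro mult_left_mono mult_right_mono power_mono) auto
      also have "\<dots> = \<bar>y\<bar>\<^sup>2 * \<bar>x\<bar> ^ (?m - 2)"
      proof -
        have "(k - 2) + (?m - k) = ?m - 2" using k by auto
        then show ?thesis by (metis power_add)
      qed
      also have "\<dots> = x ^ (?m - 2) * y\<^sup>2"
      proof -
        have "even (?m - 2)" by simp
        then show ?thesis by (simp add: power_even_abs)
      qed
      finally show ?thesis using ev by linarith
    next
      case False
      have "\<bar>y\<bar> ^ k * \<bar>x\<bar> ^ (?m - k) \<le> \<bar>y\<bar> ^ k * \<bar>y\<bar> ^ (?m - k)"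
        using False by (intro mult_left_mono power_mono) auto
      also have "\<dots> = \<bar>y\<bar> ^ ?m" using k by (simp flip: power_add)
      also have "\<dots> = y ^ ?m" by (simp add: power_even_abs)
      finally show ?thesis using ev by (simp add: add_increasing)
    qed
    finally show ?thesis .
  qed
  have "(x + y) ^ ?m = (\<Sum>k\<le>?m. of_nat (?m choose k) * y ^ k * x ^ (?m - k))"
    by (subst add.commute) (simp add: binomial_ring)
  also have "{..?m} = insert 0 (insert 1 {2..?m})" using m2 by auto
  also have "(\<Sum>k\<in>\<dots>. of_nat (?m choose k) * y ^ k * x ^ (?m - k))
      = x ^ ?m + 2 * real n * x ^ (2*n-1) * y + (\<Sum>k\<in>{2..?m}. real (?m choose k) * (y ^ k * x ^ (?m - k)))"
    by (simp add: mult_ac)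
  also have "(\<Sum>k\<in>{2..?m}. real (?m choose k) * (y ^ k * x ^ (?m - k))) \<le> (\<Sum>k\<in>{2..?m}. real (?m choose k) * ?Q)"
    by (intro sum_mono mult_left_mono term_le) auto
  also have "\<dots> \<le> (\<Sum>k\<le>?m. real (?m choose k) * ?Q)"
    using Q0 by (intro sum_mono2) auto
  also have "\<dots> = 4 ^ n * ?Q"
  proof -
    have "(\<Sum>k\<le>?m. real (?m choose k)) = real (2 ^ ?m)"
      by (metis choose_row_sum of_nat_sum)
    then show ?thesis by (simp add: sum_distrib_right[symmetric] power_mult)
  qed
  finally show ?thesis by simp
qed

text \<open>\<open>B n\<close> is the constant of the 2n-th moment of a single step. The recursion
  collects the two error terms of \<open>even_power_add_le\<close>: a lower moment of the sum times
  the variance of a step, and the top moment of a step.\<close>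

fun moment_const :: "(nat \<Rightarrow> real) \<Rightarrow> nat \<Rightarrow> real" where
  "moment_const B 0 = 1"
| "moment_const B (Suc n) = 4 ^ Suc n * (moment_const B n * B 1 + B (Suc n))"

lemma moment_const_nonneg: "(\<And>n. 0 \<le> B n) \<Longrightarrow> 0 \<le> moment_const B n"
  by (induction n) auto

text \<open>A Burkholder-type inequality, by induction on \<open>n\<close> and, inside it, on
  \<open>J\<close>. When a step is added, the linear term of \<open>even_power_add_le\<close> has
  mean zero and the mixed term factorises into a lower moment of the sum and the variance of the
  step. Instead of a filtration, predictability is encoded by letting \<open>\<phi> j\<close> depend
  on the first \<open>j\<close> coordinates only. Real parts are taken because the expansion is one
  for real numbers.\<close>

lemma (in prob_space) martingale_moment_le:
  fixes \<Delta> :: "nat \<Rightarrow> 'a \<Rightarrow> real" and d :: "real \<Rightarrow> complex" and \<phi> :: "nat \<Rightarrow> (nat \<Rightarrow> real) \<Rightarrow> complex"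
  assumes ind: "indep_vars (\<lambda>_. borel) \<Delta> {0..<N}"
    and d_meas[measurable]: "d \<in> borel_measurable borel"
    and d_bound: "\<And>v. norm (d v) \<le> 2"
    and \<phi>_meas: "\<And>j. j < N \<Longrightarrow> \<phi> j \<in> borel_measurable (PiM {0..<j} (\<lambda>_. borel))"
    and \<phi>_restrict: "\<And>j \<delta>. j < N \<Longrightarrow> \<phi> j (restrict \<delta> {0..<j}) = \<phi> j \<delta>"
    and \<phi>_bound: "\<And>j \<delta>. norm (\<phi> j \<delta>) \<le> 1"
    and mean: "\<And>j. j < N \<Longrightarrow> expectation (\<lambda>\<omega>. d (\<Delta> j \<omega>)) = 0"
    and moment: "\<And>j n. j < N \<Longrightarrow> expectation (\<lambda>\<omega>. norm (d (\<Delta> j \<omega>)) ^ (2*n)) \<le> B n * s ^ n"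
    and B0: "\<And>n. 0 \<le> B n" and s0: "0 \<le> s"
    and J: "J \<le> N"
  shows "expectation (\<lambda>\<omega>. (\<Sum>j<J. Re (\<phi> j (\<lambda>i. \<Delta> i \<omega>) * d (\<Delta> j \<omega>))) ^ (2*n))
           \<le> moment_const B n * (real J * s) ^ n"
proof -
  define S :: "nat \<Rightarrow> (nat \<Rightarrow> real) \<Rightarrow> real" where "S J \<delta> = (\<Sum>j<J. Re (\<phi> j \<delta> * d (\<delta> j)))" for J \<delta>
  define D where "D \<omega> = (\<lambda>i. \<Delta> i \<omega>)" for \<omega>
  have S_restrict: "S J (restrict \<delta> {0..<J}) = S J \<delta>" if "J \<le> N" for J \<delta>
    unfolding S_def
  proof (intro sum.cong refl)
    fix j assume j: "j \<in> {..<J}"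
    have "\<phi> j (restrict \<delta> {0..<J}) = \<phi> j (restrict (restrict \<delta> {0..<J}) {0..<j})"
      using j that by (intro \<phi>_restrict[symmetric]) auto
    also have "restrict (restrict \<delta> {0..<J}) {0..<j} = restrict \<delta> {0..<j}"
      using j by (auto simp: restrict_def fun_eq_iff)
    also have "\<phi> j (restrict \<delta> {0..<j}) = \<phi> j \<delta>" using j that by (intro \<phi>_restrict) auto
    finally have e: "\<phi> j (restrict \<delta> {0..<J}) = \<phi> j \<delta>" .
    show "Re (\<phi> j (restrict \<delta> {0..<J}) * d (restrict \<delta> {0..<J} j)) = Re (\<phi> j \<delta> * d (\<delta> j))"
      unfolding e using j by simp
  qed
  have \<phi>_meas': "\<phi> j \<in> borel_measurable (PiM {0..<J} (\<lambda>_. borel))" if "j \<le> J" "j < N" for j J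
  proof -
    have "(\<lambda>\<delta>. \<phi> j (restrict \<delta> {0..<j})) \<in> borel_measurable (PiM {0..<J} (\<lambda>_. borel))"
      using that by (intro measurable_compose[OF measurable_restrict_subset \<phi>_meas]) auto
    then show ?thesis using \<phi>_restrict[OF that(2)] by simp
  qed
  have S_meas: "S J \<in> borel_measurable (PiM {0..<J} (\<lambda>_. borel))" if "J \<le> N" for J
  proof -
    have "(\<lambda>\<delta>. \<Sum>j<J. Re (\<phi> j \<delta> * d (\<delta> j))) \<in> borel_measurable (PiM {0..<J} (\<lambda>_. borel))"
    proof (intro borel_measurable_sum)
      fix j assume j: "j \<in> {..<J}"
      have [measurable]: "\<phi> j \<in> borel_measurable (PiM {0..<J} (\<lambda>_. borel))" using j that by (intro \<phi>_meas') auto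
      have [measurable]: "(\<lambda>\<delta>. \<delta> j) \<in> borel_measurable (PiM {0..<J} (\<lambda>_. borel :: real measure))"
        using j by (intro measurable_component_singleton) auto
      show "(\<lambda>\<delta>. Re (\<phi> j \<delta> * d (\<delta> j))) \<in> borel_measurable (PiM {0..<J} (\<lambda>_. borel))"
        by measurable
    qed
    then show ?thesis unfolding S_def .
  qed
  have \<Delta>_rv[measurable]: "random_variable borel (\<Delta> j)" if "j < N" for j
    using ind that unfolding indep_vars_def by auto
  have D_rv: "random_variable (PiM {0..<J} (\<lambda>_. borel)) (\<lambda>\<omega>. restrict (D \<omega>) {0..<J})" if "J \<le> N" for J
    unfolding D_def using that by (intro measurable_restrict) auto
  have SD_rv: "random_variable borel (\<lambda>\<omega>. S J (D \<omega>))" if "J \<le> N" for J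
    using measurable_compose[OF D_rv S_meas, OF that that] S_restrict[OF that] by simp
  have \<phi>D_rv: "random_variable borel (\<lambda>\<omega>. \<phi> j (D \<omega>))" if "j < N" for j
    using measurable_compose[OF D_rv[of j] \<phi>_meas[OF that]] \<phi>_restrict[OF that] that by simp
  have S_bd: "\<bar>S J \<delta>\<bar> \<le> 2 * real J" for J \<delta>
  proof -
    have "\<bar>S J \<delta>\<bar> \<le> (\<Sum>j<J. \<bar>Re (\<phi> j \<delta> * d (\<delta> j))\<bar>)" unfolding S_def by (rule sum_abs)
    also have "\<dots> \<le> (\<Sum>j<J. 1 * 2)"
    proof (intro sum_mono)
      fix j
      have "\<bar>Re (\<phi> j \<delta> * d (\<delta> j))\<bar> \<le> norm (\<phi> j \<delta>) * norm (d (\<delta> j))"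
        by (metis abs_Re_le_cmod norm_mult)
      also have "\<dots> \<le> 1 * 2" by (intro mult_mono \<phi>_bound d_bound) auto
      finally show "\<bar>Re (\<phi> j \<delta> * d (\<delta> j))\<bar> \<le> 1 * 2" .
    qed
    finally show ?thesis by simp
  qed
  have S_pow: "\<bar>S J \<delta> ^ k\<bar> \<le> (2 * real J) ^ k" for J \<delta> k
    unfolding power_abs by (rule power_mono[OF S_bd]) simp
  \<comment> \<open>\<open>f\<close> sees only the coordinates below \<open>J\<close>, so it is a
    function of a restriction that is independent of \<open>\<Delta> J\<close>; boundedness supplies
    integrability.\<close>
  have indep_E: "expectation (\<lambda>\<omega>. f (D \<omega>) * g (\<Delta> J \<omega>)) = expectation (\<lambda>\<omega>. f (D \<omega>)) * expectation (\<lambda>\<omega>. g (\<Delta> J \<omega>))"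
    if J: "J < N" and f: "f \<in> borel_measurable (PiM {0..<J} (\<lambda>_. borel))"
      and fr: "\<And>\<delta>. f (restrict \<delta> {0..<J}) = f \<delta>" and g: "g \<in> borel_measurable borel"
      and fb: "\<And>\<delta>. \<bar>f \<delta>\<bar> \<le> b" and gb: "\<And>v. \<bar>g v\<bar> \<le> c" for f g J and b c :: real
  proof -
    have iv: "indep_var (PiM {0..<J} (\<lambda>_. borel)) (\<lambda>\<omega>. restrict (\<lambda>i. \<Delta> i \<omega>) {0..<J})
                 (PiM {J} (\<lambda>_. borel)) (\<lambda>\<omega>. restrict (\<lambda>i. \<Delta> i \<omega>) {J})"
      using J by (intro indep_var_restrict[OF ind]) auto
    have gm: "(\<lambda>\<delta>. g (\<delta> J)) \<in> borel_measurable (PiM {J} (\<lambda>_. borel))"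
    proof -
      have "(\<lambda>\<delta>. \<delta> J) \<in> borel_measurable (PiM {J} (\<lambda>_. borel :: real measure))"
        by (intro measurable_component_singleton) auto
      from measurable_compose[OF this g] show ?thesis .
    qed
    have "indep_var borel (f \<circ> (\<lambda>\<omega>. restrict (\<lambda>i. \<Delta> i \<omega>) {0..<J})) borel ((\<lambda>\<delta>. g (\<delta> J)) \<circ> (\<lambda>\<omega>. restrict (\<lambda>i. \<Delta> i \<omega>) {J}))"
      by (rule indep_var_compose[OF iv f gm])
    then have iv': "indep_var borel (\<lambda>\<omega>. f (D \<omega>)) borel (\<lambda>\<omega>. g (\<Delta> J \<omega>))"
      by (simp add: o_def fr D_def)
    have "integrable M (\<lambda>\<omega>. f (D \<omega>))" "integrable M (\<lambda>\<omega>. g (\<Delta> J \<omega>))"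
      using fb gb indep_var_rv1[OF iv'] indep_var_rv2[OF iv']
      by (auto intro!: integrable_const_bound[where B=b] integrable_const_bound[where f="\<lambda>\<omega>. g (\<Delta> J \<omega>)" and B=c])
    from indep_var_lebesgue_integral[OF iv' this] show ?thesis .
  qed
  have main: "expectation (\<lambda>\<omega>. S J (D \<omega>) ^ (2*n)) \<le> moment_const B n * (real J * s) ^ n" if "J \<le> N" for J
    using that
  proof (induction n arbitrary: J)
    case 0
    then show ?case by (simp add: prob_space)
  next
    case (Suc n)
    note IHn = Suc.IH
    define c where "c = 4 ^ Suc n * (moment_const B n * B 1 + B (Suc n))"
    have mc0: "0 \<le> moment_const B n" by (rule moment_const_nonneg) (rule B0)
    have c0: "0 \<le> c" unfolding c_def using mc0 B0 by simp
    have "expectation (\<lambda>\<omega>. S J (D \<omega>) ^ (2*Suc n)) \<le> c * (real J * s) ^ Suc n"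
      using \<open>J \<le> N\<close>
    proof (induction J)
      case 0
      then show ?case by (simp add: S_def)
    next
      case (Suc J)
      then have J: "J < N" "J \<le> N" by auto
      define m where "m = Suc n"
      define U where "U \<omega> = Re (\<phi> J (D \<omega>) * d (\<Delta> J \<omega>))" for \<omega>
      define T where "T \<omega> = norm (d (\<Delta> J \<omega>))" for \<omega>
      have m1: "1 \<le> m" by (simp add: m_def)
      note [measurable] = SD_rv[OF J(2)] \<phi>D_rv[OF J(1)] \<Delta>_rv[OF J(1)]
      have [measurable]: "random_variable borel U" "random_variable borel T" unfolding U_def T_def by measurable
      have UT: "\<bar>U \<omega>\<bar> \<le> T \<omega>" for \<omega>
      proof -
        have "\<bar>U \<omega>\<bar> \<le> norm (\<phi> J (D \<omega>)) * norm (d (\<Delta> J \<omega>))"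
          unfolding U_def by (metis abs_Re_le_cmod norm_mult)
        also have "\<dots> \<le> 1 * T \<omega>" unfolding T_def by (intro mult_right_mono \<phi>_bound) auto
        finally show ?thesis by simp
      qed
      have T2: "T \<omega> \<le> 2" "0 \<le> T \<omega>" for \<omega> unfolding T_def using d_bound by auto
      have Tk: "\<bar>T \<omega> ^ k\<bar> \<le> 2 ^ k" for \<omega> k
        unfolding power_abs using T2[of \<omega>] by (intro power_mono) auto
      have dk: "\<bar>cmod (d v) ^ k\<bar> \<le> 2 ^ k" for v k
        unfolding power_abs using d_bound[of v] by (intro power_mono) auto
      have pw: "S (Suc J) (D \<omega>) ^ (2*m) \<le> S J (D \<omega>) ^ (2*m)
          + (2 * real m * (S J (D \<omega>) ^ (2*m-1) * U \<omega>) + 4 ^ m * (S J (D \<omega>) ^ (2*n) * T \<omega>^2 + T \<omega> ^ (2*m)))" for \<omega>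
      proof -
        have e: "S (Suc J) (D \<omega>) = S J (D \<omega>) + U \<omega>" by (simp add: S_def U_def D_def)
        have n2: "2*m-2 = 2*n" by (simp add: m_def)
        have u2: "(U \<omega>)\<^sup>2 \<le> (T \<omega>)\<^sup>2" using UT[of \<omega>] by (metis abs_le_square_iff abs_of_nonneg T2(2))
        have u3: "U \<omega> ^ (2*m) \<le> T \<omega> ^ (2*m)" using power_mono[OF UT[of \<omega>], of "2*m"] by (simp add: power_even_abs)
        have "S J (D \<omega>) ^ (2*n) * (U \<omega>)\<^sup>2 + U \<omega> ^ (2*m) \<le> S J (D \<omega>) ^ (2*n) * (T \<omega>)\<^sup>2 + T \<omega> ^ (2*m)"
          by (intro add_mono mult_left_mono u2 u3) (simp add: zero_le_even_power)
        then show ?thesis unfolding e using even_power_add_le[OF m1, of "S J (D \<omega>)" "U \<omega>"] unfolding n2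
          by (smt (verit) mult.assoc mult_left_mono zero_le_power)
      qed
      have bi: "integrable M f" if "random_variable borel f" "\<And>\<omega>. \<bar>f \<omega>\<bar> \<le> b" for f and b :: real
        using that by (intro integrable_const_bound[where B=b]) auto
      have iS: "integrable M (\<lambda>\<omega>. S J (D \<omega>) ^ k)" for k
        by (rule bi[OF _ S_pow]) measurable
      have iSU: "integrable M (\<lambda>\<omega>. S J (D \<omega>) ^ k * U \<omega>)" for k
      proof (rule bi)
        show "\<bar>S J (D \<omega>) ^ k * U \<omega>\<bar> \<le> (2 * real J) ^ k * 2" for \<omega>
          unfolding abs_mult using UT[of \<omega>] T2[of \<omega>] by (intro mult_mono S_pow) auto
      qed measurable
      have iST: "integrable M (\<lambda>\<omega>. S J (D \<omega>) ^ k * (T \<omega>)^2)" for k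
      proof (rule bi)
        show "\<bar>S J (D \<omega>) ^ k * (T \<omega>)^2\<bar> \<le> (2 * real J) ^ k * 2^2" for \<omega>
          unfolding abs_mult by (intro mult_mono S_pow Tk) auto
      qed measurable
      have iT: "integrable M (\<lambda>\<omega>. T \<omega> ^ k)" for k
      proof (rule bi)
        show "\<bar>T \<omega> ^ k\<bar> \<le> 2^k" for \<omega> by (rule Tk)
      qed measurable
      have iS': "integrable M (\<lambda>\<omega>. S (Suc J) (D \<omega>) ^ k)" for k
      proof (rule bi[OF _ S_pow])
        show "random_variable borel (\<lambda>\<omega>. S (Suc J) (D \<omega>) ^ k)" using SD_rv[OF Suc.prems] by measurable
      qed
      \<comment> \<open>The mean of \<open>d\<close> vanishes as a complex number. To use
        independence for real variables, the real part is expanded as Re phi Re d - Im phi Im d, and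
        each product factorises separately.\<close>
      have zero: "expectation (\<lambda>\<omega>. S J (D \<omega>) ^ k * U \<omega>) = 0" for k
      proof -
        have [measurable]: "S J \<in> borel_measurable (PiM {0..<J} (\<lambda>_. borel))" "\<phi> J \<in> borel_measurable (PiM {0..<J} (\<lambda>_. borel))"
          using S_meas \<phi>_meas J by auto
        have id: "integrable M (\<lambda>\<omega>. d (\<Delta> J \<omega>))"
          using d_bound by (intro integrable_const_bound[where B=2]) auto
        have re: "expectation (\<lambda>\<omega>. Re (d (\<Delta> J \<omega>))) = 0" and im: "expectation (\<lambda>\<omega>. Im (d (\<Delta> J \<omega>))) = 0"
          using mean[OF J(1)] integral_Re[OF id] integral_Im[OF id] by auto
        have b1: "\<bar>S J \<delta> ^ k * Re (\<phi> J \<delta>)\<bar> \<le> (2 * real J) ^ k * 1" for \<delta>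
          unfolding abs_mult using \<phi>_bound[of J \<delta>] abs_Re_le_cmod[of "\<phi> J \<delta>"] by (intro mult_mono S_pow) auto
        have b2: "\<bar>S J \<delta> ^ k * Im (\<phi> J \<delta>)\<bar> \<le> (2 * real J) ^ k * 1" for \<delta>
          unfolding abs_mult using \<phi>_bound[of J \<delta>] abs_Im_le_cmod[of "\<phi> J \<delta>"] by (intro mult_mono S_pow) auto
        have b3: "\<bar>Re (d v)\<bar> \<le> 2" "\<bar>Im (d v)\<bar> \<le> 2" for v
          using d_bound[of v] abs_Re_le_cmod[of "d v"] abs_Im_le_cmod[of "d v"] by auto
        have e1: "expectation (\<lambda>\<omega>. (S J (D \<omega>) ^ k * Re (\<phi> J (D \<omega>))) * Re (d (\<Delta> J \<omega>))) = 0"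
          using S_restrict[OF J(2)] \<phi>_restrict[OF J(1)] re
          by (subst indep_E[OF J(1) _ _ _ b1 b3(1)]) auto
        have e2: "expectation (\<lambda>\<omega>. (S J (D \<omega>) ^ k * Im (\<phi> J (D \<omega>))) * Im (d (\<Delta> J \<omega>))) = 0"
          using S_restrict[OF J(2)] \<phi>_restrict[OF J(1)] im
          by (subst indep_E[OF J(1) _ _ _ b2 b3(2)]) auto
        have i1: "integrable M (\<lambda>\<omega>. (S J (D \<omega>) ^ k * Re (\<phi> J (D \<omega>))) * Re (d (\<Delta> J \<omega>)))"
        proof (rule bi)
          show "\<bar>(S J (D \<omega>) ^ k * Re (\<phi> J (D \<omega>))) * Re (d (\<Delta> J \<omega>))\<bar> \<le> ((2 * real J) ^ k * 1) * 2" for \<omega>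
            unfolding abs_mult[of "S J (D \<omega>) ^ k * Re (\<phi> J (D \<omega>))"] by (intro mult_mono b1 b3) auto
        qed measurable
        have i2: "integrable M (\<lambda>\<omega>. (S J (D \<omega>) ^ k * Im (\<phi> J (D \<omega>))) * Im (d (\<Delta> J \<omega>)))"
        proof (rule bi)
          show "\<bar>(S J (D \<omega>) ^ k * Im (\<phi> J (D \<omega>))) * Im (d (\<Delta> J \<omega>))\<bar> \<le> ((2 * real J) ^ k * 1) * 2" for \<omega>
            unfolding abs_mult[of "S J (D \<omega>) ^ k * Im (\<phi> J (D \<omega>))"] by (intro mult_mono b2 b3) auto
        qed measurable
        have "(\<lambda>\<omega>. S J (D \<omega>) ^ k * U \<omega>) = (\<lambda>\<omega>. (S J (D \<omega>) ^ k * Re (\<phi> J (D \<omega>))) * Re (d (\<Delta> J \<omega>)) - (S J (D \<omega>) ^ k * Im (\<phi> J (D \<omega>))) * Im (d (\<Delta> J \<omega>)))"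
          by (simp add: U_def algebra_simps fun_eq_iff)
        then show ?thesis using Bochner_Integration.integral_diff[OF i1 i2] e1 e2 by simp
      qed
      have ST: "expectation (\<lambda>\<omega>. S J (D \<omega>) ^ (2*n) * (T \<omega>)^2) = expectation (\<lambda>\<omega>. S J (D \<omega>) ^ (2*n)) * expectation (\<lambda>\<omega>. (T \<omega>)^2)"
        unfolding T_def
      proof (rule indep_E[OF J(1)])
        show "(\<lambda>\<delta>. S J \<delta> ^ (2*n)) \<in> borel_measurable (PiM {0..<J} (\<lambda>_. borel))" using S_meas[OF J(2)] by measurable
        show "\<bar>S J \<delta> ^ (2*n)\<bar> \<le> (2 * real J) ^ (2*n)" for \<delta> by (rule S_pow)
        show "\<bar>(cmod (d v))\<^sup>2\<bar> \<le> 2^2" for v by (rule dk)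
        show "S J (restrict \<delta> {0..<J}) ^ (2*n) = S J \<delta> ^ (2*n)" for \<delta>
          by (simp only: S_restrict[OF J(2)])
      qed measurable
      have T2E: "expectation (\<lambda>\<omega>. (T \<omega>)^2) \<le> B 1 * s" using moment[OF J(1), of 1] by (simp add: T_def)
      have T2E0: "0 \<le> expectation (\<lambda>\<omega>. (T \<omega>)^2)" by (intro integral_nonneg_AE) auto
      have TmE: "expectation (\<lambda>\<omega>. T \<omega> ^ (2*m)) \<le> B m * s ^ m" using moment[OF J(1), of m] by (simp add: T_def)
      have SnE: "expectation (\<lambda>\<omega>. S J (D \<omega>) ^ (2*n)) \<le> moment_const B n * (real J * s) ^ n" by (rule IHn) (rule J(2))
      have "expectation (\<lambda>\<omega>. S (Suc J) (D \<omega>) ^ (2*m)) \<le> expectation (\<lambda>\<omega>. S J (D \<omega>) ^ (2*m)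
          + (2 * real m * (S J (D \<omega>) ^ (2*m-1) * U \<omega>) + 4 ^ m * (S J (D \<omega>) ^ (2*n) * T \<omega>^2 + T \<omega> ^ (2*m))))"
        by (intro integral_mono pw iS' Bochner_Integration.integrable_add integrable_mult_right iS iSU iST iT)
      also have "\<dots> = expectation (\<lambda>\<omega>. S J (D \<omega>) ^ (2*m)) + 4 ^ m * (expectation (\<lambda>\<omega>. S J (D \<omega>) ^ (2*n) * (T \<omega>)^2) + expectation (\<lambda>\<omega>. T \<omega> ^ (2*m)))"
        using zero[of "2*m-1"] by (simp add: iS iSU iST iT)
      also have "\<dots> \<le> c * (real J * s) ^ m + 4 ^ m * (moment_const B n * (real J * s) ^ n * (B 1 * s) + B m * s ^ m)"
      proof (intro add_mono mult_left_mono)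
        show "expectation (\<lambda>\<omega>. S J (D \<omega>) ^ (2*m)) \<le> c * (real J * s) ^ m" using Suc.IH J unfolding m_def by simp
        show "expectation (\<lambda>\<omega>. S J (D \<omega>) ^ (2*n) * (T \<omega>)^2) \<le> moment_const B n * (real J * s) ^ n * (B 1 * s)"
          unfolding ST using T2E T2E0 SnE mc0 s0 by (intro mult_mono) auto
      qed (use TmE in auto)
      also have "\<dots> = s ^ m * (c * real J ^ m + 4 ^ m * (moment_const B n * B 1 * real J ^ n + B m))"
        by (simp add: m_def power_mult_distrib algebra_simps)
      also have "\<dots> \<le> s ^ m * (c * real J ^ m + c * real (Suc J) ^ n)"
      proof (intro mult_left_mono add_left_mono)
        have "moment_const B n * B 1 * real J ^ n + B m \<le> moment_const B n * B 1 * real (Suc J) ^ n + B m * real (Suc J) ^ n"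
        proof (intro add_mono mult_left_mono power_mono mult_nonneg_nonneg)
          show "B m \<le> B m * real (Suc J) ^ n"
            using mult_left_mono[OF one_le_power[of "real (Suc J)" n] B0[of m]] by simp
        qed (use mc0 B0 in auto)
        then have "4 ^ m * (moment_const B n * B 1 * real J ^ n + B m)
            \<le> 4 ^ m * (moment_const B n * B 1 * real (Suc J) ^ n + B m * real (Suc J) ^ n)"
          by (intro mult_left_mono) auto
        then show "4 ^ m * (moment_const B n * B 1 * real J ^ n + B m) \<le> c * real (Suc J) ^ n"
          unfolding c_def m_def by (simp add: algebra_simps)
      qed (use s0 in auto)
      \<comment> \<open>With m = n + 1, J^m + (J + 1)^n is at most (J + 1)^m. This closes the
        induction on \<open>J\<close> with the same constant \<open>c\<close>.\<close>
      also have "\<dots> \<le> s ^ m * (c * real (Suc J) ^ m)"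
      proof (intro mult_left_mono)
        have "real J ^ m + real (Suc J) ^ n \<le> real J * real (Suc J) ^ n + real (Suc J) ^ n"
          unfolding m_def power_Suc by (intro add_mono mult_left_mono power_mono) auto
        also have "\<dots> = real (Suc J) ^ m" by (simp add: m_def algebra_simps)
        finally show "c * real J ^ m + c * real (Suc J) ^ n \<le> c * real (Suc J) ^ m"
          using c0 by (metis distrib_left mult_left_mono)
      qed (use s0 in auto)
      finally show ?case by (simp add: m_def power_mult_distrib mult_ac)
    qed
    then show ?case unfolding c_def by simp
  qed
  show ?thesis using main[OF J] unfolding S_def D_def .
qed

section \<open>Sums over a lattice of times\<close>

lemma (in prob_space) expectation_cis_normal:
  assumes D: "distributed M lborel X (normal_density 0 \<sigma>)" and \<sigma>: "\<sigma> > 0"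
  shows "expectation (\<lambda>\<omega>. cis (a * X \<omega>)) = of_real (exp (- (a * \<sigma>)\<^sup>2 / 2))"
proof -
  have D': "distributed M lborel (\<lambda>x. X x / \<sigma>) std_normal_density"
    using normal_standard_normal_convert[OF \<sigma>, of X 0] D by simp
  have [measurable]: "random_variable borel X" using distributed_measurable[OF D] by simp
  have "std_normal_distribution = distr M borel (\<lambda>x. X x / \<sigma>)"
    using distributed_distr_eq_density[OF D'] by (simp cong: distr_cong)
  then have "char std_normal_distribution (a * \<sigma>) = expectation (\<lambda>\<omega>. iexp (a * \<sigma> * (X \<omega> / \<sigma>)))"
    unfolding char_def by (simp only:) (subst integral_distr, auto)
  also have "\<dots> = expectation (\<lambda>\<omega>. cis (a * X \<omega>))"
    using \<sigma> by (intro Bochner_Integration.integral_cong) (auto simp: cis_conv_exp)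
  finally show ?thesis using char_std_normal_distribution by (simp add: fun_eq_iff)
qed

lemma (in prob_space) expectation_even_moment_normal:
  assumes D: "distributed M lborel X (normal_density 0 \<sigma>)" and \<sigma>: "\<sigma> > 0"
  shows "integrable M (\<lambda>\<omega>. X \<omega> ^ (2*n))"
    and "expectation (\<lambda>\<omega>. X \<omega> ^ (2*n)) = (\<sigma>\<^sup>2) ^ n * (fact (2*n) / (2 ^ n * fact n))"
proof -
  note m = normal_moment_even[of \<sigma> 0 n, OF \<sigma>, unfolded diff_zero]
  have "integrable lborel (\<lambda>x. normal_density 0 \<sigma> x * x ^ (2*n))"
    using m unfolding has_bochner_integral_iff by blast
  then show "integrable M (\<lambda>\<omega>. X \<omega> ^ (2*n))"
    using distributed_integrable[OF D, of "\<lambda>x. x ^ (2*n)"] by simp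
  have "expectation (\<lambda>\<omega>. X \<omega> ^ (2*n)) = (LINT x|lborel. normal_density 0 \<sigma> x * x ^ (2*n))"
    using distributed_integral[OF D, of "\<lambda>x. x ^ (2*n)"] by simp
  also have "\<dots> = fact (2 * n) / ((2 / \<sigma>\<^sup>2)^n * fact n)"
    using m unfolding has_bochner_integral_iff by blast
  also have "\<dots> = (\<sigma>\<^sup>2) ^ n * (fact (2*n) / (2 ^ n * fact n))"
    by (simp add: power_divide)
  finally show "expectation (\<lambda>\<omega>. X \<omega> ^ (2*n)) = (\<sigma>\<^sup>2) ^ n * (fact (2*n) / (2 ^ n * fact n))" .
qed

lemma add_power_le_2power:
  fixes a b :: real
  assumes "0 \<le> a" "0 \<le> b"
  shows "(a + b) ^ n \<le> 2 ^ n * (a ^ n + b ^ n)"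
proof -
  have "(a + b) ^ n \<le> (2 * max a b) ^ n" using assms by (intro power_mono) auto
  also have "\<dots> = 2 ^ n * (max a b) ^ n" by (simp add: power_mult_distrib)
  also have "(max a b) ^ n \<le> a ^ n + b ^ n" using assms by (auto simp: max_def)
  finally show ?thesis by simp
qed

lemma norm_cis_diff_le: "norm (cis a - cis b) \<le> \<bar>a - b\<bar>"
proof -
  have "cis a - cis b = cis b * (cis (a - b) - 1)"
    by (simp add: algebra_simps cis_mult)
  then have "norm (cis a - cis b) = norm (cis (a - b) - 1)" by (simp add: norm_mult)
  also have "\<dots> \<le> \<bar>a - b\<bar>"
    using iexp_approx1[of "a - b" 0] by (simp add: cis_conv_exp)
  finally show ?thesis .
qed

text \<open>The two summands are the Gaussian 2n-th moment of 2 pi y times the increment and the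
  2n-th power of the bound 2 pi^2 y^2 tau for the distance of the mean from 1; the factor 4^n comes
  from splitting the power of their sum.\<close>

definition increment_const :: "nat \<Rightarrow> real" where
  "increment_const n = 4 ^ n * ((2*pi)^(2*n) * (fact (2*n) / (2 ^ n * fact n)) + (2*pi\<^sup>2)^(2*n))"

lemma increment_const_nonneg: "0 \<le> increment_const n"
  by (simp add: increment_const_def)

text \<open>The subtracted number is the mean of the exponential, so this controls the martingale
  difference. Its fluctuating part is at most linear in the increment and gives (y^2 tau)^n; the
  shift of the mean gives (y^2 tau)^(2n), which is no larger because y^2 tau is at most 1.\<close>

lemma (in prob_space) increment_moment_le:
  assumes D: "distributed M lborel X (normal_density 0 (sqrt \<tau>))" and \<tau>: "\<tau> > 0" and y: "y\<^sup>2 * \<tau> \<le> 1"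
  shows "expectation (\<lambda>\<omega>. norm (cis (- (2*pi*y) * X \<omega>) - of_real (exp (- (2*pi\<^sup>2*y\<^sup>2*\<tau>)))) ^ (2*n))
           \<le> increment_const n * (y\<^sup>2*\<tau>) ^ n"
proof -
  define q where "q = exp (- (2*pi\<^sup>2*y\<^sup>2*\<tau>))"
  have [measurable]: "random_variable borel X" using distributed_measurable[OF D] by simp
  have q: "0 < q" "q \<le> 1" using \<tau> by (auto simp: q_def)
  have q1: "1 - q \<le> 2*pi\<^sup>2*y\<^sup>2*\<tau>" using exp_ge_add_one_self[of "- (2*pi\<^sup>2*y\<^sup>2*\<tau>)"] by (simp add: q_def)
  have dv: "norm (cis (- (2*pi*y) * v) - of_real q) \<le> \<bar>2*pi*y * v\<bar> + 2*pi\<^sup>2*y\<^sup>2*\<tau>" for v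
  proof -
    have "norm (cis (- (2*pi*y) * v) - of_real q) \<le> norm (cis (- (2*pi*y) * v) - cis 0) + norm (cis 0 - complex_of_real q)"
      using norm_triangle_ineq[of "cis (- (2*pi*y) * v) - cis 0" "cis 0 - complex_of_real q"] by simp
    also have "norm (cis 0 - complex_of_real q) = \<bar>1 - q\<bar>"
      by (metis cis_zero norm_of_real of_real_1 of_real_diff)
    also have "\<dots> \<le> 2*pi\<^sup>2*y\<^sup>2*\<tau>" using q q1 by simp
    finally show ?thesis using norm_cis_diff_le[of "- (2*pi*y) * v" 0] by simp
  qed
  have pw: "norm (cis (- (2*pi*y) * v) - of_real q) ^ (2*n) \<le> 4 ^ n * ((2*pi*y)^(2*n) * v^(2*n) + (2*pi\<^sup>2*y\<^sup>2*\<tau>)^(2*n))" for v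
  proof -
    have "norm (cis (- (2*pi*y) * v) - of_real q) ^ (2*n) \<le> (\<bar>2*pi*y * v\<bar> + 2*pi\<^sup>2*y\<^sup>2*\<tau>) ^ (2*n)"
      by (intro power_mono dv) auto
    also have "\<dots> \<le> 2 ^ (2*n) * (\<bar>2*pi*y * v\<bar> ^ (2*n) + (2*pi\<^sup>2*y\<^sup>2*\<tau>) ^ (2*n))"
      using \<tau> by (intro add_power_le_2power) auto
    also have "\<bar>2*pi*y * v\<bar> ^ (2*n) = (2*pi*y)^(2*n) * v^(2*n)"
      by (simp only: power_even_abs even_mult_iff even_numeral simp_thms power_mult_distrib[symmetric])
    finally show ?thesis by (simp add: power_mult)
  qed
  note mom = expectation_even_moment_normal[OF D, of n]
  have s: "0 < sqrt \<tau>" using \<tau> by simp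
  have "expectation (\<lambda>\<omega>. norm (cis (- (2*pi*y) * X \<omega>) - of_real q) ^ (2*n))
      \<le> expectation (\<lambda>\<omega>. 4 ^ n * ((2*pi*y)^(2*n) * X \<omega>^(2*n) + (2*pi\<^sup>2*y\<^sup>2*\<tau>)^(2*n)))"
  proof (rule integral_mono[OF _ _ pw])
    show i2: "integrable M (\<lambda>\<omega>. 4 ^ n * ((2*pi*y)^(2*n) * X \<omega>^(2*n) + (2*pi\<^sup>2*y\<^sup>2*\<tau>)^(2*n)))"
      using mom(1)[OF s] by simp
    show "integrable M (\<lambda>\<omega>. norm (cis (- (2*pi*y) * X \<omega>) - of_real q) ^ (2*n))"
    proof (rule Bochner_Integration.integrable_bound[OF i2])
      have [measurable]: "cis \<in> borel_measurable borel"
        by (intro borel_measurable_continuous_onI continuous_on_cis continuous_on_id)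
      show "random_variable borel (\<lambda>\<omega>. norm (cis (- (2*pi*y) * X \<omega>) - of_real q) ^ (2*n))" by measurable
      show "AE \<omega> in M. norm (norm (cis (- (2*pi*y) * X \<omega>) - of_real q) ^ (2*n)) \<le> norm (4 ^ n * ((2*pi*y)^(2*n) * X \<omega>^(2*n) + (2*pi\<^sup>2*y\<^sup>2*\<tau>)^(2*n)))"
        using pw by (intro always_eventually allI) (smt (verit) real_norm_def zero_le_power norm_ge_zero)
    qed
  qed
  also have "\<dots> = 4 ^ n * ((2*pi*y)^(2*n) * (\<tau> ^ n * (fact (2*n) / (2 ^ n * fact n))) + (2*pi\<^sup>2*y\<^sup>2*\<tau>)^(2*n))"
    using mom[OF s] \<tau> by (simp add: prob_space)
  also have "\<dots> \<le> increment_const n * (y\<^sup>2*\<tau>) ^ n"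
  proof -
    have e1: "(2*pi*y)^(2*n) * (\<tau> ^ n * (fact (2*n) / (2 ^ n * fact n))) = (2*pi)^(2*n) * (fact (2*n) / (2 ^ n * fact n)) * (y\<^sup>2*\<tau>) ^ n"
      by (simp add: power_mult_distrib power_mult)
    have "(2*pi\<^sup>2*y\<^sup>2*\<tau>)^(2*n) = (2*pi\<^sup>2)^(2*n) * ((y\<^sup>2*\<tau>) ^ n * (y\<^sup>2*\<tau>) ^ n)"
      by (simp add: power_mult_distrib power_mult power2_eq_square mult_ac)
    also have "\<dots> \<le> (2*pi\<^sup>2)^(2*n) * ((y\<^sup>2*\<tau>) ^ n * 1)"
      using y \<tau> by (intro mult_left_mono power_le_one) auto
    finally have e2: "(2*pi\<^sup>2*y\<^sup>2*\<tau>)^(2*n) \<le> (2*pi\<^sup>2)^(2*n) * (y\<^sup>2*\<tau>) ^ n" by simp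
    show ?thesis unfolding e1 increment_const_def mult.assoc[of "4^n"]
      by (rule mult_left_mono) (use e2 in \<open>auto simp: distrib_right\<close>)
  qed
  finally show ?thesis unfolding q_def .
qed

lemma standard_brownian_motionD:
  assumes "standard_brownian_motion M X"
  shows "prob_space M"
    and "\<And>t. t \<in> {0..1} \<Longrightarrow> X t \<in> borel_measurable M"
    and "\<And>(n::nat) t. strict_mono_on {0..n} t \<Longrightarrow> t ` {0..n} \<subseteq> {0..1} \<Longrightarrow>
      prob_space.indep_vars M (\<lambda>_. borel) (\<lambda>j \<omega>. X (t (Suc j)) \<omega> - X (t j) \<omega>) {0..<n}"
    and "\<And>s t. 0 \<le> s \<Longrightarrow> s < t \<Longrightarrow> t \<le> 1 \<Longrightarrow>
      distributed M lborel (\<lambda>\<omega>. X t \<omega> - X s \<omega>) (normal_density 0 (sqrt (t - s)))"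
    and "AE \<omega> in M. continuous_on {0..1} (\<lambda>t. X t \<omega>)"
  using assms unfolding standard_brownian_motion_def by simp_all

text \<open>16^n and the inner 4^n arise from raising |A| <= 2 (2 + |S|) to the power 2n; 2^(n+1)
  arises from bounding |S|^(2n) by the moments of its real and imaginary parts.\<close>

definition lattice_const :: "nat \<Rightarrow> real" where
  "lattice_const n = 16 ^ n * (4 ^ n + 2 ^ Suc n * moment_const increment_const n)"

lemma lattice_const_nonneg: "0 \<le> lattice_const n"
  using moment_const_nonneg[of increment_const n] increment_const_nonneg by (simp add: lattice_const_def)

text \<open>The lattice sum is compared with its own shift by one time step. Consecutive terms,
  after multiplication of the earlier one by its predicted factor, differ by a martingale
  difference, so the sum times the prefactor equals boundary terms plus a martingale. The prefactor
  is at least 1/2 by assumption, and the martingale has total variance of order y^2, whatever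
  \<open>N\<close> is.\<close>

lemma lattice_sum_moment_le:
  fixes N :: nat and x y u \<tau> :: real
  defines "\<tau> \<equiv> 1 / real N"
  assumes bm: "standard_brownian_motion M X"
    and N: "1 \<le> N" and y: "y\<^sup>2 \<le> real N"
    and c: "1/2 \<le> norm (1 - of_real (exp (- (2*pi\<^sup>2*y\<^sup>2*\<tau>))) * cis (- (2*pi*x*\<tau>)))"
    and u: "0 \<le> u" "u \<le> \<tau>"
  shows "(LINT \<omega>|M. norm (\<Sum>j<N. cis (- (2*pi*(x * (real j*\<tau> + u) + y * X (real j*\<tau> + u) \<omega>)))) ^ (2*n))
           \<le> lattice_const n * (1 + y\<^sup>2) ^ n"
proof -
  interpret prob_space M by (rule standard_brownian_motionD(1)[OF bm])
  define q where "q = exp (- (2*pi\<^sup>2*y\<^sup>2*\<tau>))"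
  define c where "c = cis (- (2*pi*x*\<tau>))"
  define t where "t j = real j * \<tau> + u" for j
  define \<Delta> where "\<Delta> j \<omega> = X (t (Suc j)) \<omega> - X (t j) \<omega>" for j \<omega>
  define d where "d v = cis (- (2*pi*y) * v) - of_real q" for v
  \<comment> \<open>The product over past increments rebuilds the phase of \<open>X (t j)\<close>
    relative to \<open>X (t 0)\<close>. The phase at \<open>t 0\<close> is no function of these
    increments; it is pulled out of the whole sum as a factor of modulus 1.\<close>
  define \<phi> where "\<phi> j \<delta> = cis (- (2*pi*x*t (Suc j))) * (\<Prod>i<j. cis (- (2*pi*y) * \<delta> i))" for j and \<delta> :: "nat \<Rightarrow> real"
  define a where "a j \<omega> = cis (- (2*pi*(x * t j + y * X (t j) \<omega>)))" for j \<omega>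
  \<comment> \<open>\<open>N\<close> lattice times in [0, 1] have \<open>N - 1\<close> increments
    between them; one more shift would leave the interval.\<close>
  define J where "J = N - 1"
  define S where "S \<omega> = (\<Sum>j<J. \<phi> j (\<lambda>i. \<Delta> i \<omega>) * d (\<Delta> j \<omega>))" for \<omega>
  define A where "A \<omega> = (\<Sum>j<N. a j \<omega>)" for \<omega>
  have \<tau>: "0 < \<tau>" "real N * \<tau> = 1" using N by (auto simp: \<tau>_def)
  have NJ: "N = Suc J" using N by (simp add: J_def)
  have t_range: "0 \<le> t j \<and> t j \<le> 1" if "j \<le> J" for j
  proof -
    have "t j \<le> real J * \<tau> + \<tau>" unfolding t_def using that u \<tau> by (intro add_mono mult_right_mono) auto
    also have "\<dots> = 1" using \<tau> NJ by (simp add: algebra_simps)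
    finally show ?thesis using u \<tau> by (simp add: t_def)
  qed
  have t_mono: "strict_mono_on {0..J} t"
    using \<tau> by (auto simp: strict_mono_on_def t_def)
  have [measurable]: "cis \<in> borel_measurable borel"
    by (intro borel_measurable_continuous_onI continuous_on_cis continuous_on_id)
  have ind: "indep_vars (\<lambda>_. borel) \<Delta> {0..<J}"
    unfolding \<Delta>_def using t_mono t_range
    by (intro standard_brownian_motionD(3)[OF bm]) auto
  have dist: "distributed M lborel (\<Delta> j) (normal_density 0 (sqrt \<tau>))" if "j < J" for j
  proof -
    have "t (Suc j) - t j = \<tau>" by (simp add: t_def algebra_simps)
    moreover have "distributed M lborel (\<lambda>\<omega>. X (t (Suc j)) \<omega> - X (t j) \<omega>) (normal_density 0 (sqrt (t (Suc j) - t j)))"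
    proof -
      have "0 \<le> t j \<and> t j < t (Suc j) \<and> t (Suc j) \<le> 1"
        using t_range[of j] t_range[of "Suc j"] that \<tau> by (simp add: t_def algebra_simps)
      then show ?thesis by (intro standard_brownian_motionD(4)[OF bm]) auto
    qed
    ultimately show ?thesis by (simp add: \<Delta>_def[abs_def])
  qed
  have rvX[measurable]: "random_variable borel (X (t j))" if "j \<le> J" for j
    using t_range[OF that] by (intro standard_brownian_motionD(2)[OF bm]) auto
  have q01: "0 < q" "q \<le> 1" using \<tau> by (auto simp: q_def)
  have [measurable]: "d \<in> borel_measurable borel" unfolding d_def by measurable
  have d_bound: "norm (d v) \<le> 2" for v
  proof -
    have "norm (d v) \<le> norm (cis (- (2*pi*y) * v)) + norm (complex_of_real q)" unfolding d_def by (rule norm_triangle_ineq4)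
    then show ?thesis using q01 by simp
  qed
  have \<phi>_bound: "norm (\<phi> j \<delta>) = 1" for j \<delta> by (simp add: \<phi>_def norm_mult prod_norm[symmetric])
  have \<phi>_meas: "\<phi> j \<in> borel_measurable (PiM {0..<j} (\<lambda>_. borel))" for j
    unfolding \<phi>_def
  proof (intro borel_measurable_times borel_measurable_const borel_measurable_prod)
    fix i assume i: "i \<in> {..<j}"
    have [measurable]: "(\<lambda>\<delta>. \<delta> i) \<in> borel_measurable (PiM {0..<j} (\<lambda>_. borel :: real measure))"
      using i by (intro measurable_component_singleton) auto
    show "(\<lambda>\<delta>. cis (- (2*pi*y) * \<delta> i)) \<in> borel_measurable (PiM {0..<j} (\<lambda>_. borel :: real measure))" by measurable
  qed
  have \<phi>_restrict: "\<phi> j (restrict \<delta> {0..<j}) = \<phi> j \<delta>" for j \<delta>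
    unfolding \<phi>_def by (intro arg_cong2[where f="(*)"] refl prod.cong) auto
  have mean: "expectation (\<lambda>\<omega>. d (\<Delta> j \<omega>)) = 0" if "j < J" for j
  proof -
    have [measurable]: "random_variable borel (\<Delta> j)" using distributed_measurable[OF dist[OF that]] by simp
    have i: "integrable M (\<lambda>\<omega>. cis (- (2*pi*y) * \<Delta> j \<omega>))" by (intro integrable_const_bound[where B=1]) auto
    have "expectation (\<lambda>\<omega>. cis (- (2*pi*y) * \<Delta> j \<omega>)) = of_real (exp (- (- (2*pi*y) * sqrt \<tau>)\<^sup>2 / 2))"
      using \<tau> by (intro expectation_cis_normal dist that) auto
    also have "exp (- (- (2*pi*y) * sqrt \<tau>)\<^sup>2 / 2) = q" using \<tau> by (simp add: q_def power_mult_distrib)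
    finally show ?thesis unfolding d_def using i by (simp add: prob_space)
  qed
  have yt: "y\<^sup>2 * \<tau> \<le> 1" using y N by (simp add: \<tau>_def)
  have moment: "expectation (\<lambda>\<omega>. norm (d (\<Delta> j \<omega>)) ^ (2*n)) \<le> increment_const n * (y\<^sup>2 * \<tau>) ^ n" if "j < J" for j n
    using increment_moment_le[OF dist[OF that] \<tau>(1) yt, of n] unfolding d_def q_def .
  define mc where "mc = moment_const increment_const n"
  have mc0: "0 \<le> mc" unfolding mc_def by (intro moment_const_nonneg increment_const_nonneg)
  \<comment> \<open>Here the number of steps cancels: at most 1 / tau steps of variance of order y^2
    tau.\<close>
  have Jn: "mc * (real J * (y\<^sup>2 * \<tau>)) ^ n \<le> mc * (y\<^sup>2) ^ n"
  proof (intro mult_left_mono power_mono)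
    have "real J * (y\<^sup>2 * \<tau>) \<le> real N * (y\<^sup>2 * \<tau>)" using NJ \<tau> by (intro mult_right_mono) auto
    also have "\<dots> = y\<^sup>2" using \<tau>(2) by (metis mult.assoc mult.commute mult.right_neutral)
    finally show "real J * (y\<^sup>2 * \<tau>) \<le> y\<^sup>2" .
  qed (use mc0 \<tau> in auto)
  have ReS: "expectation (\<lambda>\<omega>. Re (S \<omega>) ^ (2*n)) \<le> mc * (y\<^sup>2) ^ n"
  proof -
    have "expectation (\<lambda>\<omega>. (\<Sum>j<J. Re (\<phi> j (\<lambda>i. \<Delta> i \<omega>) * d (\<Delta> j \<omega>))) ^ (2*n)) \<le> mc * (real J * (y\<^sup>2 * \<tau>)) ^ n"
      unfolding mc_def using \<tau>
      by (intro martingale_moment_le[OF ind _ d_bound \<phi>_meas \<phi>_restrict _ mean moment increment_const_nonneg])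
         (auto simp: \<phi>_bound)
    then show ?thesis using Jn unfolding S_def Re_sum by linarith
  qed
  \<comment> \<open>Replacing \<open>\<phi>\<close> by -i times \<open>\<phi>\<close> turns
    imaginary parts into real parts, so the same moment inequality applies.\<close>
  have ImS: "expectation (\<lambda>\<omega>. Im (S \<omega>) ^ (2*n)) \<le> mc * (y\<^sup>2) ^ n"
  proof -
    have m: "(\<lambda>\<delta>. - \<i> * \<phi> j \<delta>) \<in> borel_measurable (PiM {0..<j} (\<lambda>_. borel))" for j
      using \<phi>_meas by measurable
    have r: "- \<i> * \<phi> j (restrict \<delta> {0..<j}) = - \<i> * \<phi> j \<delta>" for j \<delta>
      by (simp only: \<phi>_restrict)
    have "expectation (\<lambda>\<omega>. (\<Sum>j<J. Re (- \<i> * \<phi> j (\<lambda>i. \<Delta> i \<omega>) * d (\<Delta> j \<omega>))) ^ (2*n)) \<le> mc * (real J * (y\<^sup>2 * \<tau>)) ^ n"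
      unfolding mc_def using \<tau>
      by (intro martingale_moment_le[OF ind _ d_bound m r _ mean moment increment_const_nonneg])
         (auto simp: \<phi>_bound norm_mult)
    moreover have "Re (- \<i> * z * w) = Im (z * w)" for z w by simp
    ultimately show ?thesis using Jn unfolding S_def Im_sum by (simp only:)
  qed
  have rv\<Delta>[measurable]: "random_variable borel (\<Delta> j)" if "j < J" for j
    using distributed_measurable[OF dist[OF that]] by simp
  have [measurable]: "random_variable borel S"
    unfolding S_def
  proof (intro borel_measurable_sum borel_measurable_times)
    fix j assume j: "j \<in> {..<J}"
    have [measurable]: "random_variable borel (\<Delta> j)" using j by (intro rv\<Delta>) auto
    show "random_variable borel (\<lambda>\<omega>. d (\<Delta> j \<omega>))" by measurable
    show "random_variable borel (\<lambda>\<omega>. \<phi> j (\<lambda>i. \<Delta> i \<omega>))"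
      unfolding \<phi>_def
    proof (intro borel_measurable_times borel_measurable_const borel_measurable_prod)
      fix i assume "i \<in> {..<j}"
      then have [measurable]: "random_variable borel (\<Delta> i)" using j by (intro rv\<Delta>) auto
      show "random_variable borel (\<lambda>\<omega>. cis (- (2*pi*y) * \<Delta> i \<omega>))" by measurable
    qed
  qed
  have S_norm: "norm (S \<omega>) \<le> 2 * real J" for \<omega>
  proof -
    have "norm (S \<omega>) \<le> (\<Sum>j<J. norm (\<phi> j (\<lambda>i. \<Delta> i \<omega>) * d (\<Delta> j \<omega>)))" unfolding S_def by (rule norm_sum)
    also have "\<dots> \<le> (\<Sum>j<J. 2)" by (intro sum_mono) (simp add: norm_mult \<phi>_bound d_bound)
    finally show ?thesis by simp
  qed
  have S_pow: "\<bar>v ^ k\<bar> \<le> (2 * real J) ^ k" if "\<bar>v\<bar> \<le> norm (S \<omega>)" for v \<omega> k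
    unfolding power_abs using that S_norm[of \<omega>] by (intro power_mono) auto
  have iRe: "integrable M (\<lambda>\<omega>. Re (S \<omega>) ^ k)" for k
  proof (intro integrable_const_bound[where B="(2 * real J) ^ k"])
    show "AE \<omega> in M. norm (Re (S \<omega>) ^ k) \<le> (2 * real J) ^ k"
      unfolding real_norm_def by (intro always_eventually allI) (rule S_pow, rule abs_Re_le_cmod)
  qed measurable
  have iIm: "integrable M (\<lambda>\<omega>. Im (S \<omega>) ^ k)" for k
  proof (intro integrable_const_bound[where B="(2 * real J) ^ k"])
    show "AE \<omega> in M. norm (Im (S \<omega>) ^ k) \<le> (2 * real J) ^ k"
      unfolding real_norm_def by (intro always_eventually allI) (rule S_pow, rule abs_Im_le_cmod)
  qed measurable
  have iS: "integrable M (\<lambda>\<omega>. norm (S \<omega>) ^ k)" for k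
  proof (intro integrable_const_bound[where B="(2 * real J) ^ k"])
    show "AE \<omega> in M. norm (norm (S \<omega>) ^ k) \<le> (2 * real J) ^ k"
    proof (intro always_eventually allI)
      show "norm (norm (S \<omega>) ^ k) \<le> (2 * real J) ^ k" for \<omega>
        unfolding real_norm_def by (rule S_pow[of "norm (S \<omega>)" \<omega>]) simp
    qed
  qed measurable
  have Sn: "norm (S \<omega>) ^ (2*n) \<le> 2 ^ n * (Re (S \<omega>) ^ (2*n) + Im (S \<omega>) ^ (2*n))" for \<omega>
  proof -
    have "norm (S \<omega>) ^ (2*n) = ((Re (S \<omega>))\<^sup>2 + (Im (S \<omega>))\<^sup>2) ^ n" by (simp add: power_mult cmod_power2)
    also have "\<dots> \<le> 2 ^ n * (((Re (S \<omega>))\<^sup>2) ^ n + ((Im (S \<omega>))\<^sup>2) ^ n)" by (intro add_power_le_2power) auto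
    finally show ?thesis by (simp add: power_mult)
  qed
  have ES: "expectation (\<lambda>\<omega>. norm (S \<omega>) ^ (2*n)) \<le> 2 ^ n * (2 * (mc * (y\<^sup>2) ^ n))"
  proof -
    have "expectation (\<lambda>\<omega>. norm (S \<omega>) ^ (2*n)) \<le> expectation (\<lambda>\<omega>. 2 ^ n * (Re (S \<omega>) ^ (2*n) + Im (S \<omega>) ^ (2*n)))"
      by (intro integral_mono iS Sn integrable_mult_right Bochner_Integration.integrable_add iRe iIm)
    also have "\<dots> = 2 ^ n * (expectation (\<lambda>\<omega>. Re (S \<omega>) ^ (2*n)) + expectation (\<lambda>\<omega>. Im (S \<omega>) ^ (2*n)))"
      using iRe iIm by simp
    also have "\<dots> \<le> 2 ^ n * (mc * (y\<^sup>2) ^ n + mc * (y\<^sup>2) ^ n)" using ReS ImS by (intro mult_left_mono add_mono) auto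
    finally show ?thesis by simp
  qed
  have aS: "a (Suc j) \<omega> - of_real q * c * a j \<omega> = cis (- (2*pi*y* X (t 0) \<omega>)) * (\<phi> j (\<lambda>i. \<Delta> i \<omega>) * d (\<Delta> j \<omega>))" for j \<omega>
  proof -
    have p: "(\<Prod>i<j. cis (- (2*pi*y) * \<Delta> i \<omega>)) = cis (- (2*pi*y) * (X (t j) \<omega> - X (t 0) \<omega>))"
      by (induction j) (simp_all add: \<Delta>_def cis_mult algebra_simps)
    have e1: "cis (- (2*pi*y* X (t 0) \<omega>)) * (\<phi> j (\<lambda>i. \<Delta> i \<omega>) * cis (- (2*pi*y) * \<Delta> j \<omega>)) = a (Suc j) \<omega>"
      unfolding \<phi>_def p a_def cis_mult by (rule arg_cong[where f=cis]) (simp add: \<Delta>_def algebra_simps)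
    have ts: "t (Suc j) = t j + \<tau>" by (simp add: t_def algebra_simps)
    have e2: "cis (- (2*pi*y* X (t 0) \<omega>)) * \<phi> j (\<lambda>i. \<Delta> i \<omega>) = c * a j \<omega>"
      unfolding \<phi>_def p a_def c_def ts cis_mult by (rule arg_cong[where f=cis]) (simp add: algebra_simps)
    have "cis (- (2*pi*y* X (t 0) \<omega>)) * (\<phi> j (\<lambda>i. \<Delta> i \<omega>) * d (\<Delta> j \<omega>))
       = cis (- (2*pi*y* X (t 0) \<omega>)) * (\<phi> j (\<lambda>i. \<Delta> i \<omega>) * cis (- (2*pi*y) * \<Delta> j \<omega>)) - of_real q * (cis (- (2*pi*y* X (t 0) \<omega>)) * \<phi> j (\<lambda>i. \<Delta> i \<omega>))"
      by (simp add: d_def algebra_simps)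
    then show ?thesis unfolding e1 e2 by (simp add: mult_ac)
  qed
  \<comment> \<open>Summation by parts: both shifted sums equal \<open>A\<close> up to one boundary
    term of modulus 1, which leaves (1 - q c) A on one side.\<close>
  have A_le: "norm (A \<omega>) \<le> 2 * (2 + norm (S \<omega>))" for \<omega>
  proof -
    have "(\<Sum>j<J. a (Suc j) \<omega> - of_real q * c * a j \<omega>) = cis (- (2*pi*y* X (t 0) \<omega>)) * S \<omega>"
      unfolding aS S_def by (simp add: sum_distrib_left)
    moreover have "(\<Sum>j<J. a (Suc j) \<omega> - of_real q * c * a j \<omega>) = (A \<omega> - a 0 \<omega>) - of_real q * c * (A \<omega> - a J \<omega>)"
    proof -
      have s1: "(\<Sum>j<J. a (Suc j) \<omega>) = A \<omega> - a 0 \<omega>"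
        unfolding A_def NJ by (subst sum.lessThan_Suc_shift) simp
      have s2: "(\<Sum>j<J. a j \<omega>) = A \<omega> - a J \<omega>"
        unfolding A_def NJ by simp
      show ?thesis unfolding sum_subtractf sum_distrib_left[symmetric] s1 s2 ..
    qed
    ultimately have "(1 - of_real q * c) * A \<omega> = a 0 \<omega> - of_real q * c * a J \<omega> + cis (- (2*pi*y* X (t 0) \<omega>)) * S \<omega>"
      by (simp add: algebra_simps)
    then have "norm (1 - of_real q * c) * norm (A \<omega>) = norm (a 0 \<omega> - of_real q * c * a J \<omega> + cis (- (2*pi*y* X (t 0) \<omega>)) * S \<omega>)"
      by (metis norm_mult)
    also have "\<dots> \<le> (norm (a 0 \<omega>) + norm (of_real q * c * a J \<omega>)) + norm (cis (- (2*pi*y* X (t 0) \<omega>)) * S \<omega>)"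
      by (intro norm_triangle_le add_mono norm_triangle_ineq4) auto
    also have "\<dots> \<le> 2 + norm (S \<omega>)" using q01 by (simp add: norm_mult a_def c_def)
    finally have "norm (1 - of_real q * c) * norm (A \<omega>) \<le> 2 + norm (S \<omega>)" .
    moreover have "1/2 * norm (A \<omega>) \<le> norm (1 - of_real q * c) * norm (A \<omega>)"
      using assms(5) unfolding q_def c_def by (intro mult_right_mono) auto
    ultimately have "1/2 * norm (A \<omega>) \<le> 2 + norm (S \<omega>)" by (rule order_trans[rotated])
    then show ?thesis by simp
  qed
  have A_pow: "norm (A \<omega>) ^ (2*n) \<le> 16 ^ n * (4 ^ n + norm (S \<omega>) ^ (2*n))" for \<omega>
  proof -
    have "norm (A \<omega>) ^ (2*n) \<le> (2 * (2 + norm (S \<omega>))) ^ (2*n)" by (intro power_mono A_le) auto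
    also have "\<dots> = 4 ^ n * (2 + norm (S \<omega>)) ^ (2*n)"
      by (simp only: power_mult_distrib) (simp add: power_mult)
    also have "\<dots> \<le> 4 ^ n * (2 ^ (2*n) * (2 ^ (2*n) + norm (S \<omega>) ^ (2*n)))" by (intro mult_left_mono add_power_le_2power) auto
    also have "\<dots> = 16 ^ n * (4 ^ n + norm (S \<omega>) ^ (2*n))" by (simp add: power_mult flip: mult.assoc power_mult_distrib)
    finally show ?thesis .
  qed
  have [measurable]: "random_variable borel A"
    unfolding A_def
  proof (intro borel_measurable_sum)
    fix j assume "j \<in> {..<N}"
    then have [measurable]: "random_variable borel (X (t j))" using NJ by (intro rvX) auto
    show "random_variable borel (a j)" unfolding a_def by measurable
  qed
  have "expectation (\<lambda>\<omega>. norm (A \<omega>) ^ (2*n)) \<le> expectation (\<lambda>\<omega>. 16 ^ n * (4 ^ n + norm (S \<omega>) ^ (2*n)))"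
  proof (rule integral_mono[OF _ _ A_pow])
    show i2: "integrable M (\<lambda>\<omega>. 16 ^ n * (4 ^ n + norm (S \<omega>) ^ (2*n)))" using iS by simp
    show "integrable M (\<lambda>\<omega>. norm (A \<omega>) ^ (2*n))"
      by (rule Bochner_Integration.integrable_bound[OF i2]) (use A_pow in \<open>auto intro!: always_eventually\<close>)
  qed
  also have "\<dots> = 16 ^ n * (4 ^ n + expectation (\<lambda>\<omega>. norm (S \<omega>) ^ (2*n)))" using iS by (simp add: prob_space)
  also have "\<dots> \<le> 16 ^ n * (4 ^ n + 2 ^ n * (2 * (mc * (y\<^sup>2) ^ n)))" using ES by simp
  also have "\<dots> \<le> 16 ^ n * (4 ^ n * (1 + y\<^sup>2) ^ n + 2 ^ n * (2 * (mc * (1 + y\<^sup>2) ^ n)))"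
  proof (intro mult_left_mono add_mono power_mono)
    show "4 ^ n \<le> 4 ^ n * (1 + y\<^sup>2) ^ n" using one_le_power[of "1 + y\<^sup>2" n] by simp
  qed (use mc0 in auto)
  also have "\<dots> = lattice_const n * (1 + y\<^sup>2) ^ n" unfolding lattice_const_def mc_def by (simp add: algebra_simps)
  finally show ?thesis unfolding A_def a_def t_def .
qed

section \<open>Transforms of paths\<close>

text \<open>Brownian paths are continuous only almost surely and only on [0, 1]. Joint
  measurability, Fubini's theorem and continuity of transforms are simplest for a process that is
  continuous on the whole line for every outcome.\<close>

lemma continuous_version:
  assumes bm: "standard_brownian_motion M X"
  obtains Z :: "real \<Rightarrow> 'w \<Rightarrow> real" where "\<And>t. Z t \<in> borel_measurable M"
    and "\<And>\<omega>. continuous_on UNIV (\<lambda>t. Z t \<omega>)" and "AE \<omega> in M. \<forall>t\<in>{0..1}. Z t \<omega> = X t \<omega>"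
proof -
  from standard_brownian_motionD(5)[OF bm] obtain N where
    N: "{\<omega>\<in>space M. \<not> continuous_on {0..1} (\<lambda>t. X t \<omega>)} \<subseteq> N" "N \<in> sets M" "emeasure M N = 0"
    by (rule AE_E)
  \<comment> \<open>Time is clamped to [0, 1], and the path is replaced by 0 on the measurable null
    set \<open>N\<close> that covers the discontinuous paths, so measurability at each time
    survives.\<close>
  define Z where "Z t \<omega> = (if \<omega> \<in> space M - N then X (max 0 (min 1 t)) \<omega> else 0)" for t \<omega>
  show ?thesis
  proof
    fix t :: real
    have [measurable]: "X (max 0 (min 1 t)) \<in> borel_measurable M"
      by (intro standard_brownian_motionD(2)[OF bm]) auto
    show "Z t \<in> borel_measurable M" unfolding Z_def using N(2) by measurable
  next
    fix \<omega>
    show "continuous_on UNIV (\<lambda>t. Z t \<omega>)"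
    proof (cases "\<omega> \<in> space M - N")
      case True
      then have "continuous_on {0..1} (\<lambda>t. X t \<omega>)" using N(1) by auto
      then have "continuous_on UNIV (\<lambda>t. X (max 0 (min 1 t)) \<omega>)"
        by (rule continuous_on_compose2) (auto intro!: continuous_intros)
      then show ?thesis using True by (simp add: Z_def)
    next
      case False
      then have "Z t \<omega> = 0" for t by (simp only: Z_def if_False)
      then show ?thesis by simp
    qed
  next
    have "AE \<omega> in M. \<omega> \<notin> N" using N(2,3) by (intro AE_not_in) (simp add: null_sets_def)
    then show "AE \<omega> in M. \<forall>t\<in>{0..1}. Z t \<omega> = X t \<omega>"
      using AE_space by eventually_elim (auto simp: Z_def min_def max_def)
  qed
qed

text \<open>Rounding time down to multiples of 1 / (m + 1) leaves countably many values, hence a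
  jointly measurable function; continuity of the paths gives pointwise convergence.\<close>

lemma measurable_continuous_process:
  fixes Z :: "real \<Rightarrow> 'w \<Rightarrow> real"
  assumes m: "\<And>t. Z t \<in> borel_measurable M" and c: "\<And>\<omega>. continuous_on UNIV (\<lambda>t. Z t \<omega>)"
  shows "(\<lambda>p. Z (fst p) (snd p)) \<in> borel_measurable (lborel \<Otimes>\<^sub>M M)"
proof (rule borel_measurable_LIMSEQ_metric[where f="\<lambda>m p. Z (real_of_int \<lfloor>real (Suc m) * fst p\<rfloor> / real (Suc m)) (snd p)"])
  fix m :: nat
  show "(\<lambda>p. Z (real_of_int \<lfloor>real (Suc m) * fst p\<rfloor> / real (Suc m)) (snd p)) \<in> borel_measurable (lborel \<Otimes>\<^sub>M M)"
  proof (rule measurable_compose_countable[where f="\<lambda>k p. Z (real_of_int k / real (Suc m)) (snd p)" and g="\<lambda>p. \<lfloor>real (Suc m) * fst p\<rfloor>"])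
    show "(\<lambda>p. Z (real_of_int k / real (Suc m)) (snd p)) \<in> borel_measurable (lborel \<Otimes>\<^sub>M M)" for k
      using m by measurable
    show "(\<lambda>p. \<lfloor>real (Suc m) * fst p\<rfloor>) \<in> (lborel \<Otimes>\<^sub>M M) \<rightarrow>\<^sub>M count_space UNIV" by measurable
  qed
next
  fix p :: "real \<times> 'w" assume "p \<in> space (lborel \<Otimes>\<^sub>M M)"
  have "(\<lambda>m. real_of_int \<lfloor>real (Suc m) * fst p\<rfloor> / real (Suc m)) \<longlonglongrightarrow> fst p"
  proof (rule real_tendsto_sandwich)
    show "\<forall>\<^sub>F m in sequentially. fst p - 1 / real (Suc m) \<le> real_of_int \<lfloor>real (Suc m) * fst p\<rfloor> / real (Suc m)"
    proof (intro always_eventually allI)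
      fix m
      have "real (Suc m) * fst p - 1 \<le> real_of_int \<lfloor>real (Suc m) * fst p\<rfloor>" by linarith
      then have "(real (Suc m) * fst p - 1) / real (Suc m) \<le> real_of_int \<lfloor>real (Suc m) * fst p\<rfloor> / real (Suc m)"
        by (intro divide_right_mono) auto
      then show "fst p - 1 / real (Suc m) \<le> real_of_int \<lfloor>real (Suc m) * fst p\<rfloor> / real (Suc m)"
        by (simp add: diff_divide_distrib)
    qed
    show "\<forall>\<^sub>F m in sequentially. real_of_int \<lfloor>real (Suc m) * fst p\<rfloor> / real (Suc m) \<le> fst p"
    proof (intro always_eventually allI)
      fix m
      have "real_of_int \<lfloor>real (Suc m) * fst p\<rfloor> / real (Suc m) \<le> (real (Suc m) * fst p) / real (Suc m)"
        by (intro divide_right_mono) auto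
      then show "real_of_int \<lfloor>real (Suc m) * fst p\<rfloor> / real (Suc m) \<le> fst p" by simp
    qed
    have "(\<lambda>m. fst p - 1 / real (Suc m)) \<longlonglongrightarrow> fst p - 0"
      by (intro tendsto_intros LIMSEQ_Suc[OF lim_1_over_n])
    then show "(\<lambda>m. fst p - 1 / real (Suc m)) \<longlonglongrightarrow> fst p" by simp
  qed simp
  moreover have "isCont (\<lambda>t. Z t (snd p)) (fst p)"
    using c[of "snd p"] by (simp add: continuous_on_eq_continuous_at)
  ultimately show "(\<lambda>m. Z (real_of_int \<lfloor>real (Suc m) * fst p\<rfloor> / real (Suc m)) (snd p)) \<longlonglongrightarrow> Z (fst p) (snd p)"
    by (rule isCont_tendsto_compose[rotated])
qed

definition path_ft :: "(real \<Rightarrow> real) \<Rightarrow> real \<Rightarrow> real \<Rightarrow> complex" where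
  "path_ft w x y = (LINT t:{0..1}|lborel. cis (- (2*pi*(x * t + y * w t))))"

section \<open>Cutting the time interval into blocks, and moments of the transform at one
  frequency\<close>

lemma set_integrable_continuous_bounded:
  fixes f :: "real \<Rightarrow> 'b::{banach,second_countable_topology}"
  assumes "continuous_on UNIV f" and "I \<subseteq> {a..b}" "I \<in> sets borel"
  shows "set_integrable lborel I f"
  by (rule set_integrable_subset[OF borel_integrable_atLeastAtMost'[of a b f]])
     (use assms in \<open>auto intro: continuous_on_subset\<close>)

lemma set_integral_blocks:
  fixes f :: "real \<Rightarrow> complex"
  assumes f: "continuous_on UNIV f" and \<tau>: "0 \<le> \<tau>"
  shows "(LINT t:{0..<real J * \<tau>}|lborel. f t) = (LINT u:{0..<\<tau>}|lborel. (\<Sum>j<J. f (real j * \<tau> + u)))"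
proof (induction J)
  case 0
  then show ?case by (simp add: set_lebesgue_integral_def)
next
  case (Suc J)
  define b where "b = real J * \<tau>"
  have b: "0 \<le> b" "real (Suc J) * \<tau> = b + \<tau>" using \<tau> by (auto simp: b_def algebra_simps)
  have eq: "{0..<real (Suc J) * \<tau>} = {0..<real J * \<tau>} \<union> {real J * \<tau>..<real J * \<tau> + \<tau>}"
    unfolding b(2) b_def[symmetric] using b(1) \<tau> by auto
  have "(LINT t:{0..<real (Suc J) * \<tau>}|lborel. f t) = (LINT t:{0..<real J * \<tau>}|lborel. f t) + (LINT t:{real J * \<tau>..<real J * \<tau> + \<tau>}|lborel. f t)"
    unfolding eq
    by (rule set_integral_Un[OF _ set_integrable_continuous_bounded[OF f, of _ 0 "real J * \<tau>"]
        set_integrable_continuous_bounded[OF f, of _ "real J * \<tau>" "real J * \<tau> + \<tau>"]]) auto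
  also have "(LINT t:{real J * \<tau>..<real J * \<tau> + \<tau>}|lborel. f t) = (LINT u:{0..<\<tau>}|lborel. f (real J * \<tau> + u))"
    unfolding set_lebesgue_integral_def
    by (subst lborel_integral_real_affine[where c=1 and t="real J * \<tau>"])
       (auto intro!: Bochner_Integration.integral_cong simp: indicator_def)
  also have "(LINT t:{0..<real J * \<tau>}|lborel. f t) + (LINT u:{0..<\<tau>}|lborel. f (real J * \<tau> + u))
      = (LINT u:{0..<\<tau>}|lborel. (\<Sum>j<J. f (real j * \<tau> + u)) + f (real J * \<tau> + u))"
  proof -
    have c: "continuous_on UNIV (\<lambda>u. f (real j * \<tau> + u))" for j
      by (intro continuous_on_compose2[OF f] continuous_intros) auto
    show ?thesis unfolding Suc.IH
      by (intro set_integral_add(2)[symmetric] set_integrable_continuous_bounded[of _ _ 0 \<tau>] continuous_on_sum c) auto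
  qed
  finally show ?case by simp
qed

lemma path_ft_blocks:
  assumes w: "continuous_on UNIV w" and N: "N \<ge> 1"
  shows "path_ft w x y = (LINT u:{0..<1 / real N}|lborel.
           (\<Sum>j<N. cis (- (2*pi*(x * (real j * (1 / real N) + u) + y * w (real j * (1 / real N) + u))))))"
proof -
  have "continuous_on UNIV (\<lambda>t. cis (- (2*pi*(x * t + y * w t))))"
    by (intro continuous_intros continuous_on_cis w)
  note b = set_integral_blocks[OF this, of "1 / real N" N]
  \<comment> \<open>The blocks are half open so that they partition the interval; the endpoint 1 is
    a null set.\<close>
  have "path_ft w x y = (LINT t:{0..<1}|lborel. cis (- (2*pi*(x * t + y * w t))))"
    unfolding path_ft_def
    by (intro set_integral_discrete_difference[where X="{1}"]) auto
  then show ?thesis using b N by simp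
qed

lemma norm_path_ft_le: "norm (path_ft w x y) \<le> 1"
proof -
  have "norm (path_ft w x y) \<le> (LINT t|lborel. norm (indicator {0..1} t *\<^sub>R cis (- (2*pi*(x * t + y * w t)))))"
    unfolding path_ft_def set_lebesgue_integral_def by (rule integral_norm_bound)
  also have "\<dots> = (LINT t|lborel. indicator {0..1::real} t)"
    by (intro Bochner_Integration.integral_cong) auto
  also have "\<dots> = 1" by simp
  finally show ?thesis .
qed

lemma power_ge_tangent:
  fixes a z :: real
  assumes "0 \<le> a" "0 \<le> z" "1 \<le> m"
  shows "a ^ m + real m * a ^ (m - 1) * (z - a) \<le> z ^ m"
proof (cases "a = 0")
  case True
  then show ?thesis using assms by (cases "m = 1") (auto simp: power_0_left)
next
  case False
  then have a: "0 < a" using assms by simp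
  have "1 + real m * (z / a - 1) \<le> (1 + (z / a - 1)) ^ m"
    using a assms by (intro Bernoulli_inequality) auto
  then have "a ^ m * (1 + real m * (z / a - 1)) \<le> a ^ m * (z / a) ^ m"
    using a by (intro mult_left_mono) auto
  also have "\<dots> = z ^ m" using a by (simp add: power_divide)
  also have "a ^ m * (1 + real m * (z / a - 1)) = a ^ m + real m * a ^ (m - 1) * (z - a)"
  proof -
    obtain k where "m = Suc k" using assms by (cases m) auto
    then show ?thesis using a by (simp add: field_simps)
  qed
  finally show ?thesis .
qed

text \<open>Jensen's inequality for the m-th power. The tangent of \<open>power_ge_tangent\<close>
  is taken at the mean \<open>a\<close> of \<open>g\<close>, so its linear part integrates to
  0.\<close>

lemma set_integral_power_le:
  fixes g :: "real \<Rightarrow> real"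
  assumes g: "continuous_on UNIV g" and g0: "\<And>u. 0 \<le> g u" and \<tau>: "0 < \<tau>" and m: "1 \<le> m"
  shows "(LINT u:{0..<\<tau>}|lborel. g u) ^ m \<le> \<tau> ^ (m - 1) * (LINT u:{0..<\<tau>}|lborel. g u ^ m)"
proof -
  define a where "a = (LINT u:{0..<\<tau>}|lborel. g u) / \<tau>"
  have I: "set_integrable lborel {0..<\<tau>} h" if "continuous_on UNIV h" for h :: "real \<Rightarrow> real"
    by (rule set_integrable_continuous_bounded[OF that, of _ 0 \<tau>]) auto
  have ig: "set_integrable lborel {0..<\<tau>} g" by (rule I[OF g])
  have a0: "0 \<le> a" unfolding a_def set_lebesgue_integral_def using g0 \<tau>
    by (intro divide_nonneg_pos integral_nonneg_AE) auto
  have c: "(LINT u:{0..<\<tau>}|lborel. k) = \<tau> * k" for k :: real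
    using \<tau> by (simp add: set_lebesgue_integral_def)
  have "(LINT u:{0..<\<tau>}|lborel. a ^ m + real m * a ^ (m - 1) * (g u - a)) \<le> (LINT u:{0..<\<tau>}|lborel. g u ^ m)"
    by (intro set_integral_mono I power_ge_tangent a0 g0 m continuous_intros g)
  also have "(LINT u:{0..<\<tau>}|lborel. a ^ m + real m * a ^ (m - 1) * (g u - a)) = \<tau> * a ^ m"
  proof -
    have "(LINT u:{0..<\<tau>}|lborel. a ^ m + real m * a ^ (m - 1) * (g u - a))
       = (LINT u:{0..<\<tau>}|lborel. a ^ m) + real m * a ^ (m - 1) * ((LINT u:{0..<\<tau>}|lborel. g u) - (LINT u:{0..<\<tau>}|lborel. a))"
      using ig I[of "\<lambda>_. a"] I[of "\<lambda>_. a^m"] I[of "\<lambda>u. real m * a ^ (m - 1) * (g u - a)"]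
      by (subst set_integral_add(2)) (auto intro!: continuous_intros g simp: set_integral_diff(2))
    then show ?thesis using \<tau> by (simp add: c a_def)
  qed
  finally have "\<tau> ^ (m - 1) * (\<tau> * a ^ m) \<le> \<tau> ^ (m - 1) * (LINT u:{0..<\<tau>}|lborel. g u ^ m)"
    using \<tau> by (intro mult_left_mono) auto
  moreover have "\<tau> ^ (m - 1) * (\<tau> * a ^ m) = (LINT u:{0..<\<tau>}|lborel. g u) ^ m"
  proof -
    have "\<tau> ^ (m - 1) * (\<tau> * a ^ m) = (\<tau> ^ (m - 1) * \<tau>) * a ^ m" by simp
    also have "\<tau> ^ (m - 1) * \<tau> = \<tau> ^ m" using m by (metis One_nat_def Suc_le_lessD power_minus_mult)
    also have "\<tau> ^ m * a ^ m = (LINT u:{0..<\<tau>}|lborel. g u) ^ m"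
      using \<tau> by (simp add: a_def power_divide)
    finally show ?thesis .
  qed
  ultimately show ?thesis by simp
qed

text \<open>The order of |F|^2: the transform is an integral of lattice sums over one block, whose
  length is about 1 / max(|x|, 1 + y^2), and the square of a lattice sum is of order 1 +
  y^2.\<close>

definition decay :: "real \<Rightarrow> real \<Rightarrow> real" where
  "decay x y = (1 + y\<^sup>2) / (max \<bar>x\<bar> (1 + y\<^sup>2))\<^sup>2"

lemma decay_pos: "0 < decay x y"
proof -
  have "0 < 1 + y\<^sup>2" by (intro add_pos_nonneg) auto
  then show ?thesis unfolding decay_def by (intro divide_pos_pos zero_less_power) auto
qed

text \<open>The number of blocks is chosen so that shifting by one block either reverses the phase
  (frequency \<open>x\<close> dominates) or contracts the conditional mean (frequency \<open>y\<close> dominates).\<close>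

lemma block_count_exists:
  fixes x y :: real
  assumes "1 + y\<^sup>2 \<le> \<bar>x\<bar> \<or> 1 \<le> y\<^sup>2"
  obtains N :: nat where "1 \<le> N" "max \<bar>x\<bar> (1 + y\<^sup>2) \<le> real N"
    "1/2 \<le> norm (1 - complex_of_real (exp (- (2*pi\<^sup>2*y\<^sup>2*(1 / real N)))) * cis (- (2*pi*x*(1 / real N))))"
proof (cases "1 + y\<^sup>2 \<le> \<bar>x\<bar>")
  case True
  \<comment> \<open>With \<open>N\<close> between 2 |x| and 2 |x| + 1 the angle 2 pi |x| / N lies in
    [pi/2, pi]. Its cosine is nonpositive, so the real part of the prefactor is at least 1 whatever
    \<open>q\<close> is.\<close>
  define N where "N = nat \<lceil>2 * \<bar>x\<bar>\<rceil>"
  have x1: "1 \<le> \<bar>x\<bar>" using True by (smt (verit) zero_le_power2)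
  have N: "2 * \<bar>x\<bar> \<le> real N" "real N \<le> 2 * \<bar>x\<bar> + 1" using x1 unfolding N_def by linarith+
  have N1: "1 \<le> N" using N x1 by linarith
  define q where "q = exp (- (2*pi\<^sup>2*y\<^sup>2*(1 / real N)))"
  define \<alpha> where "\<alpha> = 2*pi*(\<bar>x\<bar> / real N)"
  have "pi / 2 \<le> \<alpha>"
  proof -
    have "1/4 \<le> \<bar>x\<bar> / real N" using N x1 by (simp add: field_simps)
    then have "2*pi*(1/4) \<le> \<alpha>" unfolding \<alpha>_def by (intro mult_left_mono) auto
    then show ?thesis by simp
  qed
  moreover have "\<alpha> \<le> pi"
  proof -
    have "\<bar>x\<bar> / real N \<le> 1/2" using N x1 by (simp add: field_simps)
    then have "\<alpha> \<le> 2*pi*(1/2)" unfolding \<alpha>_def by (intro mult_left_mono) auto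
    then show ?thesis by simp
  qed
  ultimately have "cos \<alpha> \<le> cos (pi/2)" by (intro cos_monotone_0_pi_le) auto
  then have ca: "cos \<alpha> \<le> 0" by simp
  have "cos (- (2*pi*x*(1 / real N))) = cos \<alpha>"
    unfolding \<alpha>_def by (cases "x \<ge> 0") (auto simp: abs_if)
  then have c: "cos (- (2*pi*x*(1 / real N))) \<le> 0" using ca by simp
  have "1 \<le> 1 - q * cos (- (2*pi*x*(1 / real N)))"
    using mult_nonneg_nonpos[of q, OF _ c] by (simp add: q_def)
  also have "\<dots> = Re (1 - complex_of_real q * cis (- (2*pi*x*(1 / real N))))" by simp
  also have "\<dots> \<le> norm (1 - complex_of_real q * cis (- (2*pi*x*(1 / real N))))" by (rule complex_Re_le_cmod)
  finally show ?thesis using that[of N] N N1 True x1 unfolding q_def by auto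
next
  case False
  then have y: "1 \<le> y\<^sup>2" "\<bar>x\<bar> < 1 + y\<^sup>2" using assms by auto
  \<comment> \<open>Here y^2 >= 1, so \<open>N\<close> is at most 2 (1 + y^2) + 1 <= 5 y^2. The
    exponent 2 pi^2 y^2 / N is then at least 1, which gives q <= 1/2 and a prefactor of at least 1/2
    for any phase.\<close>
  define a where "a = 2 * (1 + y\<^sup>2)"
  define N where "N = nat \<lceil>a\<rceil>"
  have "0 \<le> a" using y by (simp add: a_def)
  then have "a \<le> real N" "real N \<le> a + 1" unfolding N_def by linarith+
  then have N: "2 * (1 + y\<^sup>2) \<le> real N" "real N \<le> 2 * (1 + y\<^sup>2) + 1" by (simp_all add: a_def)
  have "1 \<le> real N" by (rule order_trans[OF _ N(1)]) simp
  then have N1: "1 \<le> N" by simp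
  define q where "q = exp (- (2*pi\<^sup>2*y\<^sup>2*(1 / real N)))"
  have "1/5 \<le> y\<^sup>2 * (1 / real N)" using N y N1 by (simp add: field_simps)
  moreover have "9 \<le> pi\<^sup>2" using pi_gt3 power_mono[of 3 pi 2] by simp
  ultimately have "9 * (1/5) \<le> pi\<^sup>2 * (y\<^sup>2 * (1 / real N))" by (intro mult_mono) auto
  then have "1 \<le> 2*pi\<^sup>2*y\<^sup>2*(1 / real N)" by (simp add: mult_ac)
  then have "2 \<le> exp (2*pi\<^sup>2*y\<^sup>2*(1 / real N))"
    using exp_ge_add_one_self[of "2*pi\<^sup>2*y\<^sup>2*(1 / real N)"] by linarith
  then have q: "q \<le> 1/2" "0 < q" unfolding q_def exp_minus by (auto simp: field_simps)
  have "1/2 \<le> norm (1::complex) - norm (complex_of_real q * cis (- (2*pi*x*(1 / real N))))"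
    using q by (simp add: norm_mult)
  also have "\<dots> \<le> norm (1 - complex_of_real q * cis (- (2*pi*x*(1 / real N))))" by (rule norm_triangle_ineq2)
  finally show ?thesis using that[of N] N N1 y unfolding q_def by auto
qed

text \<open>The summand 2^n covers low frequencies, where no suitable block count is available but
  |F| <= 1 and \<open>decay\<close> is at least 1/2.\<close>

definition path_ft_const :: "nat \<Rightarrow> real" where
  "path_ft_const n = lattice_const n + 2 ^ n"

lemma path_ft_const_nonneg: "0 \<le> path_ft_const n"
  using lattice_const_nonneg[of n] by (simp add: path_ft_const_def)

text \<open>The transform is the integral over one block of the lattice sums \<open>A u\<close>.
  Jensen's inequality moves the 2n-th power under the integral at the price of tau^(2n-1), Fubini
  exchanges it with the expectation, and the lattice bound applies for every offset
  \<open>u\<close>. The result tau^(2n) (1 + y^2)^n is \<open>decay\<close> to the power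
  \<open>n\<close>, because tau is at most 1 / max(|x|, 1 + y^2).\<close>

lemma path_ft_moment_le:
  assumes bm: "standard_brownian_motion M X"
    and Zm: "\<And>t. Z t \<in> borel_measurable M" and Zc: "\<And>\<omega>. continuous_on UNIV (\<lambda>t. Z t \<omega>)"
    and ZX: "AE \<omega> in M. \<forall>t\<in>{0..1}. Z t \<omega> = X t \<omega>"
  shows "(\<integral>\<^sup>+\<omega>. ennreal (norm (path_ft (\<lambda>t. Z t \<omega>) x y) ^ (2*n)) \<partial>M) \<le> ennreal (path_ft_const n * decay x y ^ n)"
proof (cases "n = 0 \<or> \<not> (1 + y\<^sup>2 \<le> \<bar>x\<bar> \<or> 1 \<le> y\<^sup>2)")
  case True
  interpret prob_space M by (rule standard_brownian_motionD(1)[OF bm])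
  have "1 \<le> 2 ^ n * decay x y ^ n"
  proof (cases "n = 0")
    case False
    then have y: "\<bar>x\<bar> < 1 + y\<^sup>2" "y\<^sup>2 < 1" using True by auto
    have "1 \<le> 2 * decay x y" using y by (simp add: decay_def max_def power2_eq_square divide_simps add_pos_nonneg)
    then have "1 \<le> (2 * decay x y) ^ n" by (rule one_le_power)
    then show ?thesis by (simp add: power_mult_distrib)
  qed simp
  also have "\<dots> \<le> path_ft_const n * decay x y ^ n"
    using lattice_const_nonneg[of n] decay_pos[of x y] by (intro mult_right_mono) (auto simp: path_ft_const_def)
  finally have *: "1 \<le> path_ft_const n * decay x y ^ n" .
  have "(\<integral>\<^sup>+\<omega>. ennreal (norm (path_ft (\<lambda>t. Z t \<omega>) x y) ^ (2*n)) \<partial>M) \<le> (\<integral>\<^sup>+\<omega>. 1 \<partial>M)"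
    by (intro nn_integral_mono) (simp add: power_le_one norm_path_ft_le)
  also have "\<dots> = 1" by (simp add: emeasure_space_1)
  also have "\<dots> \<le> ennreal (path_ft_const n * decay x y ^ n)" using * by simp
  finally show ?thesis .
next
  case False
  then have n: "1 \<le> n" and xy: "1 + y\<^sup>2 \<le> \<bar>x\<bar> \<or> 1 \<le> y\<^sup>2" by auto
  interpret prob_space M by (rule standard_brownian_motionD(1)[OF bm])
  from block_count_exists[OF xy] obtain N :: nat where N: "1 \<le> N" "max \<bar>x\<bar> (1 + y\<^sup>2) \<le> real N"
    "1/2 \<le> norm (1 - complex_of_real (exp (- (2*pi\<^sup>2*y\<^sup>2*(1 / real N)))) * cis (- (2*pi*x*(1 / real N))))"
    by blast
  define \<tau> where "\<tau> = 1 / real N"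
  define A where "A u \<omega> = (\<Sum>j<N. cis (- (2*pi*(x * (real j * \<tau> + u) + y * Z (real j * \<tau> + u) \<omega>))))" for u \<omega>
  have \<tau>: "0 < \<tau>" "real N * \<tau> = 1" using N by (auto simp: \<tau>_def)
  have y2: "y\<^sup>2 \<le> real N" using N(2) by auto
  have [measurable]: "cis \<in> borel_measurable borel"
    by (intro borel_measurable_continuous_onI continuous_on_cis continuous_on_id)
  have A_cont: "continuous_on UNIV (\<lambda>u. A u \<omega>)" for \<omega>
  proof -
    have "continuous_on UNIV (\<lambda>u. Z (real j * \<tau> + u) \<omega>)" for j
      by (intro continuous_on_compose2[OF Zc[of \<omega>]] continuous_intros) auto
    then show ?thesis unfolding A_def by (intro continuous_intros continuous_on_cis)
  qed
  have A_meas[measurable]: "(\<lambda>p. A (fst p) (snd p)) \<in> borel_measurable (lborel \<Otimes>\<^sub>M M)"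
  proof -
    have *: "(\<lambda>p. Z (real j * \<tau> + fst p) (snd p)) \<in> borel_measurable (lborel \<Otimes>\<^sub>M M)" for j
    proof -
      have "(\<lambda>p. Z (fst ((\<lambda>q. (real j * \<tau> + fst q, snd q)) p)) (snd ((\<lambda>q. (real j * \<tau> + fst q, snd q)) p))) \<in> borel_measurable (lborel \<Otimes>\<^sub>M M)"
        by (rule measurable_compose[OF _ measurable_continuous_process[OF Zm Zc]]) measurable
      then show ?thesis by simp
    qed
    show ?thesis unfolding A_def
    proof (intro borel_measurable_sum)
      fix j
      note [measurable] = *[of j]
      show "(\<lambda>p. cis (- (2*pi*(x * (real j * \<tau> + fst p) + y * Z (real j * \<tau> + fst p) (snd p))))) \<in> borel_measurable (lborel \<Otimes>\<^sub>M M)"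
        by measurable
    qed
  qed
  have A_bd: "norm (A u \<omega>) \<le> real N" for u \<omega>
  proof -
    have "norm (A u \<omega>) \<le> (\<Sum>j<N. 1)" unfolding A_def by (rule sum_norm_le) simp
    then show ?thesis by simp
  qed
  have pt: "ennreal (norm (path_ft (\<lambda>t. Z t \<omega>) x y) ^ (2*n))
      \<le> ennreal (\<tau> ^ (2*n-1)) * (\<integral>\<^sup>+u. ennreal (indicator {0..<\<tau>} u * norm (A u \<omega>) ^ (2*n)) \<partial>lborel)" for \<omega>
  proof -
    have cn: "continuous_on UNIV (\<lambda>u. norm (A u \<omega>))" by (intro continuous_intros A_cont)
    have "norm (path_ft (\<lambda>t. Z t \<omega>) x y) = norm (LINT u:{0..<\<tau>}|lborel. A u \<omega>)"
      unfolding path_ft_blocks[OF Zc N(1)] A_def \<tau>_def ..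
    also have "\<dots> \<le> (LINT u:{0..<\<tau>}|lborel. norm (A u \<omega>))"
      by (rule set_integral_norm_bound[OF set_integrable_continuous_bounded[OF A_cont, of _ 0 \<tau>]]) auto
    finally have "norm (path_ft (\<lambda>t. Z t \<omega>) x y) ^ (2*n) \<le> (LINT u:{0..<\<tau>}|lborel. norm (A u \<omega>)) ^ (2*n)"
      by (intro power_mono) auto
    also have "\<dots> \<le> \<tau> ^ (2*n-1) * (LINT u:{0..<\<tau>}|lborel. norm (A u \<omega>) ^ (2*n))"
      using n \<tau> by (intro set_integral_power_le cn) auto
    finally have "ennreal (norm (path_ft (\<lambda>t. Z t \<omega>) x y) ^ (2*n)) \<le> ennreal (\<tau> ^ (2*n-1)) * ennreal (LINT u:{0..<\<tau>}|lborel. norm (A u \<omega>) ^ (2*n))"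
      using \<tau> by (subst ennreal_mult'[symmetric]) (auto intro: ennreal_leI)
    also have "ennreal (LINT u:{0..<\<tau>}|lborel. norm (A u \<omega>) ^ (2*n)) = (\<integral>\<^sup>+u. ennreal (indicator {0..<\<tau>} u * norm (A u \<omega>) ^ (2*n)) \<partial>lborel)"
    proof -
      have "set_integrable lborel {0..<\<tau>} (\<lambda>u. norm (A u \<omega>) ^ (2*n))"
        by (rule set_integrable_continuous_bounded[of _ _ 0 \<tau>]) (auto intro!: continuous_intros A_cont)
      then show ?thesis unfolding set_lebesgue_integral_def set_integrable_def
        by (subst nn_integral_eq_integral) auto
    qed
    finally show ?thesis .
  qed
  \<comment> \<open>The lattice bound concerns the Brownian motion \<open>X\<close> itself. For
    fixed \<open>u\<close> all lattice times lie in [0, 1], where \<open>X\<close> and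
    \<open>Z\<close> agree almost surely.\<close>
  have EA: "(\<integral>\<^sup>+\<omega>. ennreal (norm (A u \<omega>) ^ (2*n)) \<partial>M) \<le> ennreal (lattice_const n * (1 + y\<^sup>2) ^ n)" if u: "u \<in> {0..<\<tau>}" for u
  proof -
    have tr: "real j * \<tau> + u \<in> {0..1}" if "j < N" for j
    proof -
      have "real j * \<tau> + u \<le> (real N - 1) * \<tau> + \<tau>" using that u \<tau> by (intro add_mono mult_right_mono) auto
      also have "\<dots> = 1" using \<tau> by (simp add: algebra_simps)
      finally show ?thesis using u \<tau> by simp
    qed
    have [measurable]: "A u \<in> borel_measurable M" unfolding A_def using Zm by measurable
    define A' where "A' \<omega> = (\<Sum>j<N. cis (- (2*pi*(x * (real j * \<tau> + u) + y * X (real j * \<tau> + u) \<omega>))))" for \<omega>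
    have [measurable]: "A' \<in> borel_measurable M"
      unfolding A'_def
    proof (intro borel_measurable_sum)
      fix j assume "j \<in> {..<N}"
      then have [measurable]: "X (real j * \<tau> + u) \<in> borel_measurable M"
        using tr by (intro standard_brownian_motionD(2)[OF bm]) auto
      show "(\<lambda>\<omega>. cis (- (2*pi*(x * (real j * \<tau> + u) + y * X (real j * \<tau> + u) \<omega>)))) \<in> borel_measurable M" by measurable
    qed
    have ae: "AE \<omega> in M. norm (A u \<omega>) ^ (2*n) = norm (A' \<omega>) ^ (2*n)"
      using ZX
    proof eventually_elim
      case (elim \<omega>)
      have "A u \<omega> = A' \<omega>" unfolding A_def A'_def
      proof (rule sum.cong[OF refl])
        fix j assume "j \<in> {..<N}"
        then have "Z (real j * \<tau> + u) \<omega> = X (real j * \<tau> + u) \<omega>" using elim tr by blast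
        then show "cis (- (2*pi*(x * (real j * \<tau> + u) + y * Z (real j * \<tau> + u) \<omega>)))
           = cis (- (2*pi*(x * (real j * \<tau> + u) + y * X (real j * \<tau> + u) \<omega>)))" by simp
      qed
      then show ?case by simp
    qed
    have i: "integrable M (\<lambda>\<omega>. norm (A u \<omega>) ^ (2*n))"
    proof (rule integrable_const_bound)
      show "AE \<omega> in M. norm (norm (A u \<omega>) ^ (2*n)) \<le> real N ^ (2*n)"
        by (intro always_eventually allI) (simp add: power_mono A_bd)
    qed measurable
    have "(\<integral>\<^sup>+\<omega>. ennreal (norm (A u \<omega>) ^ (2*n)) \<partial>M) = ennreal (expectation (\<lambda>\<omega>. norm (A u \<omega>) ^ (2*n)))"
      by (rule nn_integral_eq_integral[OF i]) simp
    also have "expectation (\<lambda>\<omega>. norm (A u \<omega>) ^ (2*n)) = expectation (\<lambda>\<omega>. norm (A' \<omega>) ^ (2*n))"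
      by (rule integral_cong_AE[OF _ _ ae]) measurable
    also have "\<dots> \<le> lattice_const n * (1 + y\<^sup>2) ^ n"
      unfolding A'_def \<tau>_def using u N y2
      by (intro lattice_sum_moment_le[OF bm]) (auto simp: \<tau>_def)
    finally show ?thesis by (simp add: ennreal_leI)
  qed
  have "(\<integral>\<^sup>+\<omega>. ennreal (norm (path_ft (\<lambda>t. Z t \<omega>) x y) ^ (2*n)) \<partial>M)
      \<le> (\<integral>\<^sup>+\<omega>. ennreal (\<tau> ^ (2*n-1)) * (\<integral>\<^sup>+u. ennreal (indicator {0..<\<tau>} u * norm (A u \<omega>) ^ (2*n)) \<partial>lborel) \<partial>M)"
    by (intro nn_integral_mono pt)
  also have "\<dots> = ennreal (\<tau> ^ (2*n-1)) * (\<integral>\<^sup>+\<omega>. (\<integral>\<^sup>+u. ennreal (indicator {0..<\<tau>} u * norm (A u \<omega>) ^ (2*n)) \<partial>lborel) \<partial>M)"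
  proof (rule nn_integral_cmult)
    interpret L: pair_sigma_finite lborel M ..
    have "(\<lambda>p. ennreal (indicator {0..<\<tau>} (fst p) * norm (A (fst p) (snd p)) ^ (2*n))) \<in> borel_measurable (lborel \<Otimes>\<^sub>M M)" by measurable
    from measurable_compose[OF _ this, of "\<lambda>q. (snd q, fst q)" "M \<Otimes>\<^sub>M lborel"]
    have "(\<lambda>p. ennreal (indicator {0..<\<tau>} (snd p) * norm (A (snd p) (fst p)) ^ (2*n))) \<in> borel_measurable (M \<Otimes>\<^sub>M lborel)"
      by simp
    then show "(\<lambda>\<omega>. \<integral>\<^sup>+u. ennreal (indicator {0..<\<tau>} u * norm (A u \<omega>) ^ (2*n)) \<partial>lborel) \<in> borel_measurable M"
      by (intro lborel.borel_measurable_nn_integral) (simp add: split_beta)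
  qed
  also have "(\<integral>\<^sup>+\<omega>. (\<integral>\<^sup>+u. ennreal (indicator {0..<\<tau>} u * norm (A u \<omega>) ^ (2*n)) \<partial>lborel) \<partial>M)
      = (\<integral>\<^sup>+u. (\<integral>\<^sup>+\<omega>. ennreal (indicator {0..<\<tau>} u * norm (A u \<omega>) ^ (2*n)) \<partial>M) \<partial>lborel)"
  proof -
    interpret L: pair_sigma_finite lborel M ..
    show ?thesis by (rule L.Fubini') (simp add: split_beta)
  qed
  also have "\<dots> \<le> (\<integral>\<^sup>+u. ennreal (lattice_const n * (1 + y\<^sup>2) ^ n) * indicator {0..<\<tau>} u \<partial>lborel)"
    using EA by (intro nn_integral_mono) (auto simp: indicator_def)
  also have "\<dots> = ennreal (lattice_const n * (1 + y\<^sup>2) ^ n) * ennreal \<tau>"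
    using \<tau> by (simp add: nn_integral_cmult_indicator)
  also have "ennreal (\<tau> ^ (2*n-1)) * (ennreal (lattice_const n * (1 + y\<^sup>2) ^ n) * ennreal \<tau>) = ennreal (\<tau> ^ (2*n) * (lattice_const n * (1 + y\<^sup>2) ^ n))"
  proof -
    have "\<tau> ^ (2*n) = \<tau> ^ (2*n-1) * \<tau>" using power_minus_mult[of "2*n" \<tau>] n by simp
    moreover have "0 \<le> lattice_const n * (1 + y\<^sup>2) ^ n" using lattice_const_nonneg[of n] by simp
    ultimately show ?thesis using \<tau> by (simp only: ennreal_mult[symmetric] less_imp_le mult_nonneg_nonneg zero_le_power) (simp add: mult_ac)
  qed
  also have "\<dots> \<le> ennreal (path_ft_const n * decay x y ^ n)"
  proof (rule ennreal_leI)
    have "0 < max \<bar>x\<bar> (1 + y\<^sup>2)" by (auto simp: max_def add_pos_nonneg)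
    then have "\<tau> \<le> 1 / max \<bar>x\<bar> (1 + y\<^sup>2)" unfolding \<tau>_def using N by (intro divide_left_mono) auto
    then have "\<tau> ^ (2*n) \<le> (1 / max \<bar>x\<bar> (1 + y\<^sup>2)) ^ (2*n)" using \<tau> by (intro power_mono) auto
    then have "\<tau> ^ (2*n) * (lattice_const n * (1 + y\<^sup>2) ^ n) \<le> (1 / max \<bar>x\<bar> (1 + y\<^sup>2)) ^ (2*n) * (lattice_const n * (1 + y\<^sup>2) ^ n)"
      using lattice_const_nonneg[of n] by (intro mult_right_mono) auto
    also have "\<dots> = lattice_const n * decay x y ^ n"
      by (simp add: decay_def power_divide power_mult)
    also have "\<dots> \<le> path_ft_const n * decay x y ^ n"
      using decay_pos[of x y] by (intro mult_right_mono) (auto simp: path_ft_const_def)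
    finally show "\<tau> ^ (2*n) * (lattice_const n * (1 + y\<^sup>2) ^ n) \<le> path_ft_const n * decay x y ^ n" .
  qed
  finally show ?thesis by (simp add: mult_left_mono)
qed

section \<open>From a lattice of frequencies to all frequencies\<close>

lemma path_ft_lipschitz:
  assumes w: "continuous_on UNIV w" and m: "\<And>t. t \<in> {0..1} \<Longrightarrow> \<bar>w t\<bar> \<le> m"
  shows "norm (path_ft w x y - path_ft w x' y') \<le> 2*pi*(\<bar>x - x'\<bar> + m * \<bar>y - y'\<bar>)"
proof -
  define f where "f x y t = cis (- (2*pi*(x * t + y * w t)))" for x y t
  have c: "continuous_on UNIV (f x y)" for x y
    unfolding f_def by (intro continuous_intros continuous_on_cis w)
  have i: "set_integrable lborel {0..1} h" if "continuous_on UNIV h" for h :: "real \<Rightarrow> 'b::{banach,second_countable_topology}"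
    by (rule set_integrable_continuous_bounded[OF that, of _ 0 1]) auto
  have "path_ft w x y - path_ft w x' y' = (LINT t:{0..1}|lborel. f x y t - f x' y' t)"
    unfolding path_ft_def f_def[symmetric] by (rule set_integral_diff(2)[symmetric]) (intro i c)+
  also have "norm \<dots> \<le> (LINT t:{0..1}|lborel. norm (f x y t - f x' y' t))"
    by (rule set_integral_norm_bound) (intro i continuous_intros c)
  also have "\<dots> \<le> (LINT t:{0..1::real}|lborel. 2*pi*(\<bar>x - x'\<bar> + m * \<bar>y - y'\<bar>))"
  proof (rule set_integral_mono)
    fix t :: real assume t: "t \<in> {0..1}"
    have "norm (f x y t - f x' y' t) \<le> \<bar>- (2*pi*(x * t + y * w t)) - - (2*pi*(x' * t + y' * w t))\<bar>"
      unfolding f_def by (rule norm_cis_diff_le)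
    also have "- (2*pi*(x * t + y * w t)) - - (2*pi*(x' * t + y' * w t)) = - (2*pi) * ((x - x') * t + (y - y') * w t)"
      by (simp add: algebra_simps)
    also have "\<bar>\<dots>\<bar> = 2*pi*\<bar>(x - x') * t + (y - y') * w t\<bar>" by (simp add: abs_mult)
    also have "\<dots> \<le> 2*pi*(\<bar>x - x'\<bar> * 1 + \<bar>y - y'\<bar> * m)"
    proof (intro mult_left_mono order_trans[OF abs_triangle_ineq] add_mono)
      show "\<bar>(x - x') * t\<bar> \<le> \<bar>x - x'\<bar> * 1" unfolding abs_mult using t by (intro mult_left_mono) auto
      show "\<bar>(y - y') * w t\<bar> \<le> \<bar>y - y'\<bar> * m" unfolding abs_mult using m[OF t] by (intro mult_left_mono) auto
    qed auto
    finally show "norm (f x y t - f x' y' t) \<le> 2*pi*(\<bar>x - x'\<bar> + m * \<bar>y - y'\<bar>)" by (simp add: mult.commute)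
  qed (intro i continuous_intros c)+
  also have "\<dots> = 2*pi*(\<bar>x - x'\<bar> + m * \<bar>y - y'\<bar>)" by (simp add: set_lebesgue_integral_def)
  finally show ?thesis .
qed

lemma power2_add_le: "(a + b)\<^sup>2 \<le> 2 * a\<^sup>2 + 2 * (b::real)\<^sup>2"
  using sum_squares_bound[of a b] by (simp add: power2_sum)

lemma decay_compare:
  assumes "\<bar>x - x'\<bar> \<le> 1" "\<bar>y - y'\<bar> \<le> 1"
  shows "decay x' y' \<le> 27 * decay x y"
proof -
  have sq: "1 + b\<^sup>2 \<le> 3 * (1 + a\<^sup>2)" if "\<bar>a - b\<bar> \<le> 1" for a b :: real
  proof -
    have "b\<^sup>2 = (a + (b - a))\<^sup>2" by simp
    also have "\<dots> \<le> 2 * a\<^sup>2 + 2 * (b - a)\<^sup>2"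
      by (rule power2_add_le)
    also have "(b - a)\<^sup>2 \<le> 1" using that by (simp add: abs_square_le_1 abs_minus_commute)
    finally have "b\<^sup>2 \<le> 2 * a\<^sup>2 + 2" by simp
    also have "\<dots> \<le> 3 * a\<^sup>2 + 2" by simp
    finally show ?thesis by (simp add: distrib_left)
  qed
  define A where "A = max \<bar>x\<bar> (1 + y\<^sup>2)"
  define A' where "A' = max \<bar>x'\<bar> (1 + y'\<^sup>2)"
  have s1: "1 + y'\<^sup>2 \<le> 3 * (1 + y\<^sup>2)" by (rule sq) (rule assms(2))
  have s2: "1 + y\<^sup>2 \<le> 3 * (1 + y'\<^sup>2)" by (rule sq) (use assms(2) in \<open>simp add: abs_minus_commute\<close>)
  have A'1: "1 + y'\<^sup>2 \<le> A'" "\<bar>x'\<bar> \<le> A'" by (auto simp: A'_def)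
  have "1 \<le> A'" using A'1(1) zero_le_power2[of y'] by linarith
  have "\<bar>x\<bar> \<le> \<bar>x'\<bar> + 1" using assms(1) by linarith
  then have "\<bar>x\<bar> \<le> 3 * A'" using A'1 \<open>1 \<le> A'\<close> by linarith
  moreover have "1 + y\<^sup>2 \<le> 3 * A'" by (rule order_trans[OF s2]) (use A'1(1) in simp)
  ultimately have AA: "A \<le> 3 * A'" by (simp add: A_def)
  have A0: "0 < A" unfolding A_def using zero_le_power2[of y] by (simp add: less_max_iff_disj add_pos_nonneg)
  have "A\<^sup>2 \<le> (3 * A')\<^sup>2" using AA A0 by (intro power_mono) auto
  then have A2: "A\<^sup>2 \<le> 9 * A'\<^sup>2" by (simp add: power_mult_distrib)
  have "decay x' y' = (1 + y'\<^sup>2) / A'\<^sup>2" by (simp add: decay_def A'_def)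
  also have "\<dots> \<le> (3 * (1 + y\<^sup>2)) / (A\<^sup>2 / 9)"
    using A2 A0 s1 by (intro frac_le) (auto intro: add_nonneg_nonneg)
  also have "\<dots> = 27 * decay x y" by (simp add: decay_def A_def)
  finally show ?thesis .
qed

text \<open>On the box of radius m the bound to be proved is at least of order m^(-2). Rounding a
  frequency to a lattice of mesh m^(-2) changes the transform by O(m^(-2)), so the square of this
  error is harmless.\<close>

lemma decay_ge:
  assumes "\<bar>x\<bar> \<le> m" "\<bar>y\<bar> \<le> m" "1 \<le> m"
  shows "1 / (2 * m\<^sup>2) \<le> decay x y"
proof -
  have m2: "1 \<le> m\<^sup>2" using assms(3) by simp
  have y2: "y\<^sup>2 \<le> m\<^sup>2" using power_mono[OF assms(2), of 2] by simp
  have p: "0 < 1 + y\<^sup>2" by (intro add_pos_nonneg) auto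
  have m0: "0 < m\<^sup>2" using m2 by linarith
  show ?thesis
  proof (cases "\<bar>x\<bar> \<le> 1 + y\<^sup>2")
    case True
    then have "decay x y = 1 / (1 + y\<^sup>2)" using p by (simp add: decay_def max_def power2_eq_square)
    moreover have "1 / (2 * m\<^sup>2) \<le> 1 / (1 + y\<^sup>2)" using p m2 m0 y2 by (intro divide_left_mono mult_pos_pos) auto
    ultimately show ?thesis by simp
  next
    case False
    then have e: "decay x y = (1 + y\<^sup>2) / x\<^sup>2" by (simp add: decay_def max_def)
    have x2: "x\<^sup>2 \<le> m\<^sup>2" using power_mono[OF assms(1), of 2] by simp
    have x0: "0 < x\<^sup>2" using False p by auto
    have "1 / (2 * m\<^sup>2) \<le> 1 / m\<^sup>2" using m2 by (intro divide_left_mono) auto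
    also have "\<dots> \<le> (1 + y\<^sup>2) / x\<^sup>2" using x2 x0 by (intro frac_le) auto
    finally show ?thesis unfolding e .
  qed
qed

lemma measurable_path_ft:
  fixes Z :: "real \<Rightarrow> 'w \<Rightarrow> real"
  assumes Zm: "\<And>t. Z t \<in> borel_measurable M" and Zc: "\<And>\<omega>. continuous_on UNIV (\<lambda>t. Z t \<omega>)"
  shows "(\<lambda>\<omega>. path_ft (\<lambda>t. Z t \<omega>) x y) \<in> borel_measurable M"
proof -
  have [measurable]: "cis \<in> borel_measurable borel"
    by (intro borel_measurable_continuous_onI continuous_on_cis continuous_on_id)
  from measurable_compose[OF _ measurable_continuous_process[OF Zm Zc], of "\<lambda>q. (snd q, fst q)" "M \<Otimes>\<^sub>M lborel"]
  have [measurable]: "(\<lambda>q. Z (snd q) (fst q)) \<in> borel_measurable (M \<Otimes>\<^sub>M lborel)" by simp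
  have "(\<lambda>q. indicator {0..1} (snd q) *\<^sub>R cis (- (2*pi*(x * snd q + y * Z (snd q) (fst q))))) \<in> borel_measurable (M \<Otimes>\<^sub>M lborel)"
    by measurable
  then show ?thesis unfolding path_ft_def set_lebesgue_integral_def
    by (intro lborel.borel_measurable_lebesgue_integral) (simp add: split_beta)
qed

lemma summable_inverse_Suc_power2: "summable (\<lambda>k. 1 / (real (Suc k))\<^sup>2)"
proof -
  have "summable (\<lambda>k. inverse ((real k)\<^sup>2))" using inverse_power_summable[of 2, where ?'a=real] by simp
  then have "summable (\<lambda>k. inverse ((real (Suc k))\<^sup>2))"
    by (subst summable_Suc_iff[where f="\<lambda>k. inverse ((real k)\<^sup>2)"])
  then show ?thesis by (simp add: inverse_eq_divide)
qed

text \<open>The moments, normalised by \<open>decay\<close> to the power \<open>n\<close> and by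
  m^8, are summed over all lattice points and all m. The m-th lattice has (2 m^3 + 1)^2 <= 9 m^6
  points, so the expectations sum like 1 / m^2. The sum is therefore finite almost surely, and its
  value bounds every single term.\<close>

lemma AE_path_ft_lattice:
  assumes bm: "standard_brownian_motion M X"
    and Zm: "\<And>t. Z t \<in> borel_measurable M" and Zc: "\<And>\<omega>. continuous_on UNIV (\<lambda>t. Z t \<omega>)"
    and ZX: "AE \<omega> in M. \<forall>t\<in>{0..1}. Z t \<omega> = X t \<omega>"
  shows "AE \<omega> in M. \<exists>C\<ge>0. \<forall>m\<ge>1. \<forall>a\<in>{- (int m ^ 3)..int m ^ 3}. \<forall>b\<in>{- (int m ^ 3)..int m ^ 3}.
           norm (path_ft (\<lambda>t. Z t \<omega>) (of_int a / (real m)\<^sup>2) (of_int b / (real m)\<^sup>2)) ^ (2*n)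
             \<le> C * real m ^ 8 * decay (of_int a / (real m)\<^sup>2) (of_int b / (real m)\<^sup>2) ^ n"
proof -
  interpret prob_space M by (rule standard_brownian_motionD(1)[OF bm])
  define P where "P m a b \<omega> = norm (path_ft (\<lambda>t. Z t \<omega>) (of_int a / (real m)\<^sup>2) (of_int b / (real m)\<^sup>2)) ^ (2*n)" for m :: nat and a b :: int and \<omega>
  define v where "v m a b = decay (of_int a / (real m)\<^sup>2) (of_int b / (real m)\<^sup>2) ^ n" for m :: nat and a b :: int
  define I where "I m = {- (int m ^ 3)..int m ^ 3}" for m :: nat
  \<comment> \<open>The index is shifted so that only m = \<open>Suc k\<close> >= 1 occurs and no
    mesh is infinite.\<close>
  define T where "T k \<omega> = (\<Sum>a\<in>I (Suc k). \<Sum>b\<in>I (Suc k). ennreal (1 / (real (Suc k) ^ 8 * v (Suc k) a b)) * ennreal (P (Suc k) a b \<omega>))" for k \<omega>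
  have v0: "0 < v m a b" for m a b unfolding v_def by (intro zero_less_power decay_pos)
  note [measurable] = measurable_path_ft[OF Zm Zc]
  have Pm[measurable]: "P m a b \<in> borel_measurable M" for m a b unfolding P_def by measurable
  have [measurable]: "T k \<in> borel_measurable M" for k unfolding T_def by measurable
  have EP: "(\<integral>\<^sup>+\<omega>. ennreal (P m a b \<omega>) \<partial>M) \<le> ennreal (path_ft_const n * v m a b)" for m a b
    unfolding P_def v_def by (rule path_ft_moment_le[OF bm Zm Zc ZX])
  have ET: "(\<integral>\<^sup>+\<omega>. T k \<omega> \<partial>M) \<le> ennreal (9 * path_ft_const n * (1 / real (Suc k) ^ 2))" for k
  proof -
    have "(\<integral>\<^sup>+\<omega>. T k \<omega> \<partial>M) = (\<Sum>a\<in>I (Suc k). \<Sum>b\<in>I (Suc k). ennreal (1 / (real (Suc k) ^ 8 * v (Suc k) a b)) * (\<integral>\<^sup>+\<omega>. ennreal (P (Suc k) a b \<omega>) \<partial>M))"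
      unfolding T_def by (simp add: nn_integral_sum nn_integral_cmult)
    also have "\<dots> \<le> (\<Sum>a\<in>I (Suc k). \<Sum>b\<in>I (Suc k). ennreal (path_ft_const n / real (Suc k) ^ 8))"
    proof (intro sum_mono)
      fix a b
      have "ennreal (1 / (real (Suc k) ^ 8 * v (Suc k) a b)) * (\<integral>\<^sup>+\<omega>. ennreal (P (Suc k) a b \<omega>) \<partial>M)
          \<le> ennreal (1 / (real (Suc k) ^ 8 * v (Suc k) a b)) * ennreal (path_ft_const n * v (Suc k) a b)"
        by (intro mult_left_mono EP) auto
      also have "\<dots> = ennreal (1 / (real (Suc k) ^ 8 * v (Suc k) a b) * (path_ft_const n * v (Suc k) a b))"
        using v0[of "Suc k" a b] path_ft_const_nonneg[of n] by (intro ennreal_mult[symmetric]) auto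
      also have "1 / (real (Suc k) ^ 8 * v (Suc k) a b) * (path_ft_const n * v (Suc k) a b) = path_ft_const n / real (Suc k) ^ 8"
        using v0[of "Suc k" a b] by simp
      finally show "ennreal (1 / (real (Suc k) ^ 8 * v (Suc k) a b)) * (\<integral>\<^sup>+\<omega>. ennreal (P (Suc k) a b \<omega>) \<partial>M)
          \<le> ennreal (path_ft_const n / real (Suc k) ^ 8)" .
    qed
    also have "\<dots> = ennreal (real (card (I (Suc k)) ^ 2) * (path_ft_const n / real (Suc k) ^ 8))"
    proof -
      define p where "p = path_ft_const n / real (Suc k) ^ 8"
      have "0 \<le> p" using path_ft_const_nonneg[of n] by (simp add: p_def)
      then show ?thesis unfolding p_def[symmetric]
        by (simp add: ennreal_mult ennreal_of_nat_eq_real_of_nat power2_eq_square mult.assoc)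
    qed
    also have "\<dots> \<le> ennreal (9 * path_ft_const n * (1 / real (Suc k) ^ 2))"
    proof (rule ennreal_leI)
      have "real (card (I (Suc k))) = 2 * real (Suc k) ^ 3 + 1"
      proof -
        have "card (I (Suc k)) = nat (2 * int (Suc k) ^ 3 + 1)" by (simp add: I_def)
        then have "int (card (I (Suc k))) = 2 * int (Suc k) ^ 3 + 1" by simp
        then have "real_of_int (int (card (I (Suc k)))) = real_of_int (2 * int (Suc k) ^ 3 + 1)" by (rule arg_cong)
        then show ?thesis by simp
      qed
      also have "\<dots> \<le> 3 * real (Suc k) ^ 3" using one_le_power[of "real (Suc k)" 3] by simp
      finally have "real (card (I (Suc k))) ^ 2 \<le> (3 * real (Suc k) ^ 3) ^ 2" by (intro power_mono) auto
      then have "real (card (I (Suc k)) ^ 2) * (path_ft_const n / real (Suc k) ^ 8) \<le> (3 * real (Suc k) ^ 3) ^ 2 * (path_ft_const n / real (Suc k) ^ 8)"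
        using path_ft_const_nonneg[of n] by (intro mult_right_mono) auto
      also have "\<dots> = 9 * path_ft_const n * (real (Suc k) ^ 6 / real (Suc k) ^ 8)" by (simp add: power_mult_distrib flip: power_mult)
      also have "real (Suc k) ^ 6 / real (Suc k) ^ 8 = 1 / real (Suc k) ^ 2"
      proof -
        have "real (Suc k) ^ 8 = real (Suc k) ^ 6 * real (Suc k) ^ 2" unfolding power_add[symmetric] by simp
        then show ?thesis by (simp only:) (rule nonzero_divide_mult_cancel_left, simp)
      qed
      finally show "real (card (I (Suc k)) ^ 2) * (path_ft_const n / real (Suc k) ^ 8) \<le> 9 * path_ft_const n * (1 / real (Suc k) ^ 2)" .
    qed
    finally show ?thesis .
  qed
  have "(\<integral>\<^sup>+\<omega>. (\<Sum>k. T k \<omega>) \<partial>M) = (\<Sum>k. \<integral>\<^sup>+\<omega>. T k \<omega> \<partial>M)" by (rule nn_integral_suminf) measurable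
  also have "\<dots> \<le> (\<Sum>k. ennreal (9 * path_ft_const n * (1 / real (Suc k) ^ 2)))" by (intro suminf_le ET) auto
  also have "\<dots> < \<infinity>"
  proof -
    have "summable (\<lambda>k. 9 * path_ft_const n * (1 / real (Suc k) ^ 2))"
      by (intro summable_mult summable_inverse_Suc_power2)
    then show ?thesis using path_ft_const_nonneg[of n] by (subst suminf_ennreal2) auto
  qed
  finally have "(\<integral>\<^sup>+\<omega>. (\<Sum>k. T k \<omega>) \<partial>M) \<noteq> \<infinity>" by simp
  then have "AE \<omega> in M. (\<Sum>k. T k \<omega>) \<noteq> \<infinity>" by (intro nn_integral_PInf_AE) measurable
  then show ?thesis
  proof eventually_elim
    case (elim \<omega>)
    define C where "C = enn2real (\<Sum>k. T k \<omega>)"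
    have C: "(\<Sum>k. T k \<omega>) = ennreal C" "0 \<le> C" using elim by (auto simp: C_def less_top)
    show ?case
    proof (intro exI[of _ C] conjI C(2) allI impI ballI)
      fix m :: nat and a b assume m: "1 \<le> m" and a: "a \<in> {- (int m ^ 3)..int m ^ 3}" and b: "b \<in> {- (int m ^ 3)..int m ^ 3}"
      then obtain k where k: "m = Suc k" by (cases m) auto
      have "ennreal (1 / (real (Suc k) ^ 8 * v (Suc k) a b)) * ennreal (P (Suc k) a b \<omega>) \<le> (\<Sum>b\<in>I (Suc k). ennreal (1 / (real (Suc k) ^ 8 * v (Suc k) a b)) * ennreal (P (Suc k) a b \<omega>))"
        using b k by (intro member_le_sum[where f="\<lambda>b. ennreal (1 / (real (Suc k) ^ 8 * v (Suc k) a b)) * ennreal (P (Suc k) a b \<omega>)"]) (auto simp: I_def)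
      also have "\<dots> \<le> T k \<omega>"
        unfolding T_def using a k by (intro member_le_sum[where f="\<lambda>a. (\<Sum>b\<in>I (Suc k). ennreal (1 / (real (Suc k) ^ 8 * v (Suc k) a b)) * ennreal (P (Suc k) a b \<omega>))"]) (auto simp: I_def)
      also have "\<dots> \<le> (\<Sum>k. T k \<omega>)" using sum_le_suminf[of "\<lambda>k. T k \<omega>" "{k}"] by simp
      finally have "ennreal (1 / (real m ^ 8 * v m a b) * P m a b \<omega>) \<le> ennreal C"
        unfolding C(1) k using v0[of "Suc k" a b] by (subst ennreal_mult) (auto simp: P_def)
      then have "1 / (real m ^ 8 * v m a b) * P m a b \<omega> \<le> C" using C(2) by (simp add: ennreal_le_iff)
      then have "P m a b \<omega> \<le> C * real m ^ 8 * v m a b" using v0[of m a b] m by (simp add: field_simps)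
      then show "norm (path_ft (\<lambda>t. Z t \<omega>) (of_int a / (real m)\<^sup>2) (of_int b / (real m)\<^sup>2)) ^ (2*n)
             \<le> C * real m ^ 8 * decay (of_int a / (real m)\<^sup>2) (of_int b / (real m)\<^sup>2) ^ n"
        by (simp add: P_def v_def)
    qed
  qed
qed

text \<open>The n-th root turns the loss m^8 into m^(8/n), with m comparable to 1 + |x| + |y|. The
  value at a general frequency is compared with that at a lattice point at coordinate distance at
  most m^(-2), by the Lipschitz bound and \<open>decay_compare\<close>.\<close>

lemma path_ft_bound_of_lattice:
  assumes w: "continuous_on UNIV w" and n: "1 \<le> n" and C0: "0 \<le> C"
    and C: "\<And>m a b. 1 \<le> m \<Longrightarrow> a\<in>{- (int m ^ 3)..int m ^ 3} \<Longrightarrow> b\<in>{- (int m ^ 3)..int m ^ 3} \<Longrightarrow>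
           norm (path_ft w (of_int a / (real m)\<^sup>2) (of_int b / (real m)\<^sup>2)) ^ (2*n)
             \<le> C * real m ^ 8 * decay (of_int a / (real m)\<^sup>2) (of_int b / (real m)\<^sup>2) ^ n"
  shows "\<exists>K>0. \<forall>x y. (norm (path_ft w x y))\<^sup>2 \<le> K * decay x y * (1 + \<bar>x\<bar> + \<bar>y\<bar>) powr (8 / real n)"
proof -
  have "compact (w ` {0..1})" by (intro compact_continuous_image continuous_on_subset[OF w]) auto
  then obtain B where B: "\<And>t. t \<in> {0..1} \<Longrightarrow> \<bar>w t\<bar> \<le> B" "0 < B"
    using compact_imp_bounded bounded_pos by (metis imageI real_norm_def)
  define L where "L = 2*pi*(1 + B)"
  \<comment> \<open>The outer 2 splits the square of a sum, 27 is the constant of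
    \<open>decay_compare\<close>, 2 powr (8 / n) comes from m <= 2 (1 + |x| + |y|), and the inner 2
    from the factor 1/2 in \<open>decay_ge\<close>; \<open>L\<close> is a Lipschitz constant of the
    transform.\<close>
  define K where "K = 2 * (C powr (1 / real n) * 2 powr (8 / real n) * 27 + 2 * L\<^sup>2)"
  have L0: "0 < L" using B(2) by (auto simp: L_def intro!: mult_pos_pos)
  have K0: "0 < K" unfolding K_def using L0 by (intro mult_pos_pos add_nonneg_pos) auto
  have "(norm (path_ft w x y))\<^sup>2 \<le> K * decay x y * (1 + \<bar>x\<bar> + \<bar>y\<bar>) powr (8 / real n)" for x y
  proof -
    define M where "M = max 1 (max \<bar>x\<bar> \<bar>y\<bar>)"
    define m where "m = nat \<lceil>M\<rceil>"
    have M: "1 \<le> M" "\<bar>x\<bar> \<le> M" "\<bar>y\<bar> \<le> M" "M \<le> 1 + \<bar>x\<bar> + \<bar>y\<bar>" by (auto simp: M_def)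
    have m: "M \<le> real m" "real m \<le> M + 1" using M unfolding m_def by linarith+
    have m1: "1 \<le> m" using M m by linarith
    define a where "a = round (x * (real m)\<^sup>2)"
    define b where "b = round (y * (real m)\<^sup>2)"
    have grid: "round (z * (real m)\<^sup>2) \<in> {- (int m ^ 3)..int m ^ 3} \<and> \<bar>z - of_int (round (z * (real m)\<^sup>2)) / (real m)\<^sup>2\<bar> \<le> 1 / (real m)\<^sup>2"
      if z: "\<bar>z\<bar> \<le> M" for z
    proof -
      have r: "\<bar>of_int (round (z * (real m)\<^sup>2)) - z * (real m)\<^sup>2\<bar> \<le> 1/2" by (rule of_int_round_abs_le)
      have "\<bar>z * (real m)\<^sup>2\<bar> \<le> real m * (real m)\<^sup>2" unfolding abs_mult using z m by (intro mult_mono) auto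
      also have "\<dots> = real m ^ 3" by (simp add: power2_eq_square power3_eq_cube)
      finally have "\<bar>real_of_int (round (z * (real m)\<^sup>2))\<bar> \<le> real m ^ 3 + 1/2" using r by linarith
      then have "\<bar>real_of_int (round (z * (real m)\<^sup>2))\<bar> < real_of_int (int m ^ 3 + 1)" by simp
      then have "\<bar>round (z * (real m)\<^sup>2)\<bar> < int m ^ 3 + 1" by linarith
      moreover have "\<bar>z - of_int (round (z * (real m)\<^sup>2)) / (real m)\<^sup>2\<bar> = \<bar>of_int (round (z * (real m)\<^sup>2)) - z * (real m)\<^sup>2\<bar> / (real m)\<^sup>2"
      proof -
        have "z - of_int (round (z * (real m)\<^sup>2)) / (real m)\<^sup>2 = (z * (real m)\<^sup>2 - of_int (round (z * (real m)\<^sup>2))) / (real m)\<^sup>2"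
          using m1 by (simp add: field_simps)
        then show ?thesis by (simp add: abs_minus_commute)
      qed
      moreover have "\<dots> \<le> 1 / (real m)\<^sup>2" using r m1 by (intro divide_right_mono) auto
      ultimately show ?thesis by auto
    qed
    define x' where "x' = of_int a / (real m)\<^sup>2"
    define y' where "y' = of_int b / (real m)\<^sup>2"
    have gx: "a \<in> {- (int m ^ 3)..int m ^ 3}" "\<bar>x - x'\<bar> \<le> 1 / (real m)\<^sup>2" using grid[OF M(2)] by (auto simp: a_def x'_def)
    have gy: "b \<in> {- (int m ^ 3)..int m ^ 3}" "\<bar>y - y'\<bar> \<le> 1 / (real m)\<^sup>2" using grid[OF M(3)] by (auto simp: b_def y'_def)
    have m2: "1 / (real m)\<^sup>2 \<le> 1" using m1 by simp
    have dc: "decay x' y' \<le> 27 * decay x y" using gx gy m2 by (intro decay_compare) auto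
    have d0: "0 < decay x' y'" by (rule decay_pos)
    define u where "u = norm (path_ft w x' y')"
    have "(u\<^sup>2) ^ n \<le> C * real m ^ 8 * decay x' y' ^ n"
      using C[OF m1 gx(1) gy(1)] unfolding x'_def y'_def u_def by (simp add: power_mult)
    then have "((u\<^sup>2) ^ n) powr (1 / real n) \<le> (C * real m ^ 8 * decay x' y' ^ n) powr (1 / real n)"
      by (intro powr_mono2) (auto simp: u_def)
    moreover have rt: "(z ^ n) powr (1 / real n) = z" if "0 \<le> z" for z :: real
      using that n by (cases "z = 0") (auto simp: powr_realpow[symmetric] powr_powr power_0_left)
    moreover have "(C * real m ^ 8 * decay x' y' ^ n) powr (1 / real n) = C powr (1 / real n) * (real m ^ 8) powr (1 / real n) * decay x' y'"
      using C0 d0 by (simp add: powr_mult rt)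
    moreover have "(real m ^ 8) powr (1 / real n) = real m powr (8 / real n)"
    proof -
      have "real m powr 8 = real m ^ 8" using m1 by simp
      then have "(real m ^ 8) powr (1 / real n) = (real m powr 8) powr (1 / real n)" by (simp only:)
      also have "\<dots> = real m powr (8 * (1 / real n))" by (rule powr_powr)
      finally show ?thesis by simp
    qed
    ultimately have u2: "u\<^sup>2 \<le> C powr (1 / real n) * real m powr (8 / real n) * decay x' y'" by simp
    define E where "E = (1 + \<bar>x\<bar> + \<bar>y\<bar>) powr (8 / real n)"
    have E1: "1 \<le> E" unfolding E_def using n by (intro ge_one_powr_ge_zero) auto
    have mE: "real m powr (8 / real n) \<le> 2 powr (8 / real n) * E"
    proof -
      have "real m \<le> 2 * (1 + \<bar>x\<bar> + \<bar>y\<bar>)" unfolding distrib_left using m M by linarith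
      then have "real m powr (8 / real n) \<le> (2 * (1 + \<bar>x\<bar> + \<bar>y\<bar>)) powr (8 / real n)" by (intro powr_mono2) auto
      then show ?thesis unfolding E_def by (simp only: powr_mult)
    qed
    have u2': "u\<^sup>2 \<le> C powr (1 / real n) * (2 powr (8 / real n) * E) * (27 * decay x y)"
      using d0 dc mE by (intro order_trans[OF u2] mult_mono) (auto simp: E_def)
    have "norm (path_ft w x y - path_ft w x' y') \<le> 2*pi*(\<bar>x - x'\<bar> + B * \<bar>y - y'\<bar>)" by (rule path_ft_lipschitz[OF w B(1)])
    also have "\<dots> \<le> 2*pi*(1 / (real m)\<^sup>2 + B * (1 / (real m)\<^sup>2))"
      using gx gy B(2) by (intro mult_left_mono add_mono) auto
    also have "\<dots> = L / (real m)\<^sup>2" by (simp add: L_def add_divide_distrib algebra_simps)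
    finally have nd: "norm (path_ft w x y - path_ft w x' y') \<le> L / (real m)\<^sup>2" .
    then have "(norm (path_ft w x y - path_ft w x' y'))\<^sup>2 \<le> (L / (real m)\<^sup>2)\<^sup>2" by (intro power_mono) auto
    also have "\<dots> = L\<^sup>2 * (1 / (real m)\<^sup>2 * (1 / (real m)\<^sup>2))" by (simp add: power_divide power2_eq_square)
    also have "\<dots> \<le> L\<^sup>2 * (1 / (real m)\<^sup>2 * 1)" using m2 by (intro mult_left_mono) auto
    also have "1 / (real m)\<^sup>2 * 1 \<le> 2 * decay x y"
    proof -
      have "1 / (2 * (real m)\<^sup>2) \<le> decay x y" using M m m1 by (intro decay_ge) auto
      then show ?thesis by (simp add: field_simps)
    qed
    finally have nd2: "(norm (path_ft w x y - path_ft w x' y'))\<^sup>2 \<le> L\<^sup>2 * (2 * decay x y)" by (simp add: mult_left_mono)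
    have "norm (path_ft w x y) \<le> u + norm (path_ft w x y - path_ft w x' y')"
      unfolding u_def by (metis add.commute diff_add_cancel norm_triangle_ineq)
    then have "(norm (path_ft w x y))\<^sup>2 \<le> (u + norm (path_ft w x y - path_ft w x' y'))\<^sup>2" by (intro power_mono) auto
    also have "\<dots> \<le> 2 * u\<^sup>2 + 2 * (norm (path_ft w x y - path_ft w x' y'))\<^sup>2"
      by (rule power2_add_le)
    also have "\<dots> \<le> 2 * (C powr (1 / real n) * (2 powr (8 / real n) * E) * (27 * decay x y)) + 2 * (L\<^sup>2 * (2 * decay x y * E))"
    proof (intro add_mono mult_left_mono)
      show "(norm (path_ft w x y - path_ft w x' y'))\<^sup>2 \<le> L\<^sup>2 * (2 * decay x y * E)"
      proof (rule order_trans[OF nd2])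
        have "2 * decay x y * 1 \<le> 2 * decay x y * E" using E1 decay_pos[of x y] by (intro mult_left_mono) auto
        then show "L\<^sup>2 * (2 * decay x y) \<le> L\<^sup>2 * (2 * decay x y * E)" by (intro mult_left_mono) auto
      qed
    qed (use u2' in auto)
    also have "\<dots> = K * decay x y * E" by (simp add: K_def algebra_simps)
    finally show ?thesis unfolding E_def .
  qed
  then show ?thesis using K0 by blast
qed

text \<open>The exponents epsilon are uncountable, but the moment orders \<open>n\<close> are not:
  one null set serves all \<open>n\<close>, and any \<open>n\<close> above 8 / epsilon yields the
  bound for epsilon.\<close>

lemma AE_path_ft_bound:
  assumes bm: "standard_brownian_motion M X"
    and Zm: "\<And>t. Z t \<in> borel_measurable M" and Zc: "\<And>\<omega>. continuous_on UNIV (\<lambda>t. Z t \<omega>)"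
    and ZX: "AE \<omega> in M. \<forall>t\<in>{0..1}. Z t \<omega> = X t \<omega>"
  shows "AE \<omega> in M. \<forall>\<epsilon>>0. \<exists>K>0. \<forall>x y.
           (norm (path_ft (\<lambda>t. Z t \<omega>) x y))\<^sup>2 \<le> K * decay x y * (1 + \<bar>x\<bar> + \<bar>y\<bar>) powr \<epsilon>"
proof -
  have "AE \<omega> in M. \<forall>n. \<exists>C\<ge>0. \<forall>m\<ge>1. \<forall>a\<in>{- (int m ^ 3)..int m ^ 3}. \<forall>b\<in>{- (int m ^ 3)..int m ^ 3}.
           norm (path_ft (\<lambda>t. Z t \<omega>) (of_int a / (real m)\<^sup>2) (of_int b / (real m)\<^sup>2)) ^ (2*n)
             \<le> C * real m ^ 8 * decay (of_int a / (real m)\<^sup>2) (of_int b / (real m)\<^sup>2) ^ n"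
    unfolding AE_all_countable by (intro allI AE_path_ft_lattice[OF bm Zm Zc ZX])
  then show ?thesis
  proof eventually_elim
    case (elim \<omega>)
    show ?case
    proof (intro allI impI)
      fix \<epsilon> :: real assume \<epsilon>: "0 < \<epsilon>"
      obtain n :: nat where n: "8 / \<epsilon> < real n" using reals_Archimedean2 by blast
      have n0: "0 < real n" using n \<epsilon> by (meson divide_pos_pos less_trans zero_less_numeral)
      then have n1: "1 \<le> n" by simp
      have e: "8 / real n \<le> \<epsilon>" using n \<epsilon> n0 by (simp add: field_simps)
      from elim obtain C where C: "0 \<le> C" "\<And>m a b. 1 \<le> m \<Longrightarrow> a\<in>{- (int m ^ 3)..int m ^ 3} \<Longrightarrow> b\<in>{- (int m ^ 3)..int m ^ 3} \<Longrightarrow>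
           norm (path_ft (\<lambda>t. Z t \<omega>) (of_int a / (real m)\<^sup>2) (of_int b / (real m)\<^sup>2)) ^ (2*n)
             \<le> C * real m ^ 8 * decay (of_int a / (real m)\<^sup>2) (of_int b / (real m)\<^sup>2) ^ n" by meson
      from path_ft_bound_of_lattice[OF Zc n1 C(1), of \<omega>] C(2) obtain K where
        K: "0 < K" "\<And>x y. (norm (path_ft (\<lambda>t. Z t \<omega>) x y))\<^sup>2 \<le> K * decay x y * (1 + \<bar>x\<bar> + \<bar>y\<bar>) powr (8 / real n)" by auto
      show "\<exists>K>0. \<forall>x y. (norm (path_ft (\<lambda>t. Z t \<omega>) x y))\<^sup>2 \<le> K * decay x y * (1 + \<bar>x\<bar> + \<bar>y\<bar>) powr \<epsilon>"
      proof (intro exI[of _ K] conjI K(1) allI)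
        fix x y
        have "K * decay x y * (1 + \<bar>x\<bar> + \<bar>y\<bar>) powr (8 / real n) \<le> K * decay x y * (1 + \<bar>x\<bar> + \<bar>y\<bar>) powr \<epsilon>"
          using K(1) decay_pos[of x y] e by (intro mult_left_mono powr_mono) auto
        then show "(norm (path_ft (\<lambda>t. Z t \<omega>) x y))\<^sup>2 \<le> K * decay x y * (1 + \<bar>x\<bar> + \<bar>y\<bar>) powr \<epsilon>"
          using K(2)[of x y] by linarith
      qed
    qed
  qed
qed

section \<open>Mean values against Gaussian weights\<close>

text \<open>Lebesgue measure on [0, 1], written as a density so that its space is the whole line:
  functions continuous on \<open>UNIV\<close> are then measurable, and its square lives on the Borel
  sets of the plane.\<close>

definition unit_measure :: "real measure" where
  "unit_measure = density lborel (\<lambda>x. ennreal (indicator {0..1} x))"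

lemma sets_unit_measure[simp, measurable_cong]: "sets unit_measure = sets borel"
  by (simp add: unit_measure_def)

lemma space_unit_measure[simp]: "space unit_measure = UNIV"
  by (simp add: unit_measure_def)

lemma prob_space_unit_measure: "prob_space unit_measure"
  by (rule prob_spaceI) (simp add: unit_measure_def emeasure_density ennreal_indicator)

lemma measurable_pair_unit_measure:
  assumes "f \<in> borel_measurable borel"
  shows "f \<in> borel_measurable (unit_measure \<Otimes>\<^sub>M unit_measure)"
proof -
  have "sets (unit_measure \<Otimes>\<^sub>M unit_measure) = sets (borel :: (real \<times> real) measure)"
    by (subst borel_prod[symmetric]) (rule sets_pair_measure_cong[OF sets_unit_measure sets_unit_measure])
  from measurable_cong_sets[OF this refl] assms show ?thesis by blast
qed

lemma AE_unit_measure: "AE t in unit_measure. t \<in> {0..1}"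
  unfolding unit_measure_def by (subst AE_density) (auto simp: indicator_def)

lemma AE_pair_unit_measure:
  "AE p in (unit_measure \<Otimes>\<^sub>M unit_measure). fst p \<in> {0..1} \<and> snd p \<in> {0..1}"
proof -
  interpret U: prob_space unit_measure by (rule prob_space_unit_measure)
  interpret UU: pair_sigma_finite unit_measure unit_measure ..
  have "{p \<in> space (unit_measure \<Otimes>\<^sub>M unit_measure). fst p \<in> {0..1} \<and> snd p \<in> {0..1}} \<in> sets (unit_measure \<Otimes>\<^sub>M unit_measure)"
    by measurable
  then show ?thesis
    by (rule UU.AE_pair_measure) (use AE_unit_measure in \<open>auto intro: AE_mp\<close>)
qed

lemma path_ft_eq_unit_measure:
  assumes "continuous_on UNIV w"
  shows "path_ft w x y = (LINT t|unit_measure. cis (- (2*pi*(x * t + y * w t))))"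
proof -
  have "(\<lambda>t. cis (- (2*pi*(x * t + y * w t)))) \<in> borel_measurable borel"
    by (intro borel_measurable_continuous_onI continuous_intros continuous_on_cis assms)
  then show ?thesis
    unfolding path_ft_def unit_measure_def set_lebesgue_integral_def by (subst integral_density) auto
qed

lemma norm_path_ft_sq:
  assumes w: "continuous_on UNIV w"
  shows "(norm (path_ft w x y))\<^sup>2 = (LINT p|(unit_measure \<Otimes>\<^sub>M unit_measure).
           cos (2*pi*(x * (fst p - snd p) + y * (w (fst p) - w (snd p)))))"
proof -
  interpret U: prob_space unit_measure by (rule prob_space_unit_measure)
  interpret UU: pair_prob_space unit_measure unit_measure ..
  define f where "f t = cis (- (2*pi*(x * t + y * w t)))" for t
  have fc: "continuous_on UNIV f" unfolding f_def by (intro continuous_intros continuous_on_cis w)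
  have fm: "f \<in> borel_measurable borel" by (rule borel_measurable_continuous_onI[OF fc])
  have fi: "integrable unit_measure f"
    by (rule U.integrable_const_bound[where B=1]) (use fm in \<open>auto simp: f_def\<close>)
  have gm: "(\<lambda>p. f (fst p) * cnj (f (snd p))) \<in> borel_measurable (unit_measure \<Otimes>\<^sub>M unit_measure)"
    by (intro measurable_pair_unit_measure borel_measurable_continuous_onI continuous_intros
        continuous_on_compose2[OF fc]) auto
  have gi: "integrable (unit_measure \<Otimes>\<^sub>M unit_measure) (\<lambda>p. f (fst p) * cnj (f (snd p)))"
    by (rule UU.integrable_const_bound[where B=1]) (use gm in \<open>auto simp: f_def norm_mult\<close>)
  have "complex_of_real ((norm (path_ft w x y))\<^sup>2) = (LINT t|unit_measure. f t) * cnj (LINT t|unit_measure. f t)"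
    unfolding path_ft_eq_unit_measure[OF w] f_def[symmetric] by (rule complex_norm_square)
  also have "\<dots> = (LINT t|unit_measure. (LINT t'|unit_measure. f t * cnj (f t')))"
    using fi by (simp add: integral_cnj[symmetric])
  also have "\<dots> = (LINT p|(unit_measure \<Otimes>\<^sub>M unit_measure). f (fst p) * cnj (f (snd p)))"
    using UU.integral_fst'[of "\<lambda>p. f (fst p) * cnj (f (snd p))"] gi by simp
  finally have "(norm (path_ft w x y))\<^sup>2 = Re (LINT p|(unit_measure \<Otimes>\<^sub>M unit_measure). f (fst p) * cnj (f (snd p)))"
    by (metis Re_complex_of_real)
  also have "\<dots> = (LINT p|(unit_measure \<Otimes>\<^sub>M unit_measure). Re (f (fst p) * cnj (f (snd p))))"
    by (rule integral_Re[OF gi, symmetric])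
  finally have eq: "(norm (path_ft w x y))\<^sup>2 = (LINT p|(unit_measure \<Otimes>\<^sub>M unit_measure). Re (f (fst p) * cnj (f (snd p))))" .
  have "Re (f t * cnj (f t')) = cos (2*pi*(x * (t - t') + y * (w t - w t')))" for t t'
  proof -
    have "f t * cnj (f t') = cis (- (2*pi*(x * (t - t') + y * (w t - w t'))))"
      unfolding f_def cis_cnj cis_mult by (rule arg_cong[where f=cis]) (simp add: algebra_simps)
    then show ?thesis by simp
  qed
  then show ?thesis unfolding eq by simp
qed

lemma integral_normal_cos:
  assumes R: "0 < R"
  shows "(LINT x|density lborel (normal_density 0 R). cos (a * x + b)) = exp (- (a * R)\<^sup>2 / 2) * cos b"
proof -
  let ?N = "density lborel (\<lambda>x. ennreal (normal_density 0 R x))"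
  interpret prob_space ?N using prob_space_normal_density[OF R] by simp
  have D: "distributed ?N lborel (\<lambda>x. x) (normal_density 0 R)"
    unfolding distributed_def by (simp add: distr_id2)
  have [measurable]: "cis \<in> borel_measurable borel"
    by (intro borel_measurable_continuous_onI continuous_on_cis continuous_on_id)
  have i: "integrable ?N (\<lambda>x. cis b * cis (a * x))"
    by (rule integrable_const_bound[where B=1]) (auto simp: norm_mult)
  have "(LINT x|?N. cos (a * x + b)) = (LINT x|?N. Re (cis b * cis (a * x)))"
    by (simp add: cis_mult add.commute)
  also have "\<dots> = Re (LINT x|?N. cis b * cis (a * x))" by (rule integral_Re[OF i])
  also have "\<dots> = Re (cis b * of_real (exp (- (a * R)\<^sup>2 / 2)))"
    using expectation_cis_normal[OF D R, of a] by simp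
  finally show ?thesis by simp
qed

text \<open>Mean square increment of the path over time differences of order 1 / R. The kernel is
  the characteristic function of a normal law of deviation R at 2 pi times the time difference. For
  Brownian paths the mean is of order R^(-2), one factor from the measure of near pairs and one from
  the variance of increments.\<close>

definition path_variation :: "(real \<Rightarrow> real) \<Rightarrow> real \<Rightarrow> real" where
  "path_variation w R = (LINT p|(unit_measure \<Otimes>\<^sub>M unit_measure).
     exp (- (2*pi\<^sup>2*R\<^sup>2*(fst p - snd p)\<^sup>2)) * (w (fst p) - w (snd p))\<^sup>2)"

text \<open>By \<open>norm_path_ft_sq\<close> the square is a double integral over times. After
  Fubini the average over the frequency acts only on the time difference and turns its cosine into a
  Gaussian kernel.\<close>

lemma integral_normal_path_ft_sq:
  assumes w: "continuous_on UNIV w" and R: "0 < R"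
  shows "(LINT x|density lborel (normal_density 0 R). (norm (path_ft w x y))\<^sup>2)
    = (LINT p|(unit_measure \<Otimes>\<^sub>M unit_measure).
         exp (- (2*pi\<^sup>2*R\<^sup>2*(fst p - snd p)\<^sup>2)) * cos (2*pi*y*(w (fst p) - w (snd p))))"
proof -
  let ?N = "density lborel (\<lambda>x. ennreal (normal_density 0 R x))"
  let ?UU = "(unit_measure \<Otimes>\<^sub>M unit_measure)"
  interpret N: prob_space ?N using prob_space_normal_density[OF R] by simp
  interpret U: prob_space unit_measure by (rule prob_space_unit_measure)
  interpret UU: pair_prob_space unit_measure unit_measure ..
  interpret P: pair_prob_space ?UU ?N ..
  define g where "g p x = cos (2*pi*(x * (fst p - snd p) + y * (w (fst p) - w (snd p))))" for p :: "real \<times> real" and x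
  have gc: "continuous_on UNIV (\<lambda>q. g (fst q) (snd q))"
    unfolding g_def by (intro continuous_intros continuous_on_compose2[OF w]) auto
  have "(\<lambda>q. g (fst q) (snd q)) \<in> borel_measurable (borel \<Otimes>\<^sub>M borel)"
    using borel_measurable_continuous_onI[OF gc] by (simp add: borel_prod)
  moreover have "sets (?UU \<Otimes>\<^sub>M ?N) = sets (borel \<Otimes>\<^sub>M borel)"
    by (intro sets_pair_measure_cong) (auto simp: borel_prod[symmetric] intro!: sets_pair_measure_cong)
  ultimately have gm: "(\<lambda>q. g (fst q) (snd q)) \<in> borel_measurable (?UU \<Otimes>\<^sub>M ?N)"
    by (simp cong: measurable_cong_sets)
  have gi: "integrable (?UU \<Otimes>\<^sub>M ?N) (case_prod g)"
  proof (rule P.integrable_const_bound[where B=1])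
    show "case_prod g \<in> borel_measurable (?UU \<Otimes>\<^sub>M ?N)" using gm by (simp add: split_beta')
  qed (auto simp: g_def split_beta)
  have "(LINT x|?N. (norm (path_ft w x y))\<^sup>2) = (LINT x|?N. (LINT p|?UU. g p x))"
    unfolding norm_path_ft_sq[OF w] g_def ..
  also have "\<dots> = (LINT p|?UU. (LINT x|?N. g p x))"
    by (rule P.Fubini_integral[OF gi])
  finally have eq: "(LINT x|?N. (norm (path_ft w x y))\<^sup>2) = (LINT p|?UU. (LINT x|?N. g p x))" .
  have "(LINT x|?N. g p x) = exp (- (2*pi\<^sup>2*R\<^sup>2*(fst p - snd p)\<^sup>2)) * cos (2*pi*y*(w (fst p) - w (snd p)))" for p
  proof -
    have "(LINT x|?N. g p x) = (LINT x|?N. cos ((2*pi*(fst p - snd p)) * x + 2*pi*y*(w (fst p) - w (snd p))))"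
      unfolding g_def by (intro Bochner_Integration.integral_cong refl arg_cong[where f=cos]) (simp add: algebra_simps)
    also have "\<dots> = exp (- ((2*pi*(fst p - snd p)) * R)\<^sup>2 / 2) * cos (2*pi*y*(w (fst p) - w (snd p)))"
      by (rule integral_normal_cos[OF R])
    also have "- ((2*pi*(fst p - snd p)) * R)\<^sup>2 / 2 = - (2*pi\<^sup>2*R\<^sup>2*(fst p - snd p)\<^sup>2)"
      by (simp add: power_mult_distrib)
    finally show ?thesis .
  qed
  then show ?thesis unfolding eq by simp
qed

lemma cos_ge_one_minus_sq: "1 - v\<^sup>2 / 2 \<le> cos (v::real)"
proof -
  have "cos v = 1 - 2 * (sin (v/2))\<^sup>2" using cos_double_sin[of "v/2"] by simp
  moreover have "(sin (v/2))\<^sup>2 \<le> (v/2)\<^sup>2"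
    by (simp only: abs_le_square_iff[symmetric] abs_sin_x_le_abs_x)
  ultimately show ?thesis by (simp add: power_divide)
qed

text \<open>The value exp(- pi^2 / 2) of the kernel at time difference 1 / (2 R), times that length
  multiplied by R.\<close>

definition kernel_const :: real where "kernel_const = exp (- (pi\<^sup>2 / 2)) / 2"

lemma integral_gauss_kernel_ge:
  assumes R: "1 \<le> R"
  shows "kernel_const / R \<le> (LINT p|(unit_measure \<Otimes>\<^sub>M unit_measure). exp (- (2*pi\<^sup>2*R\<^sup>2*(fst p - snd p)\<^sup>2)))"
proof -
  interpret U: prob_space unit_measure by (rule prob_space_unit_measure)
  interpret UU: pair_prob_space unit_measure unit_measure ..
  let ?k = "\<lambda>p::real\<times>real. exp (- (2*pi\<^sup>2*R\<^sup>2*(fst p - snd p)\<^sup>2))"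
  have km: "?k \<in> borel_measurable (unit_measure \<Otimes>\<^sub>M unit_measure)"
    by (intro measurable_pair_unit_measure borel_measurable_continuous_onI continuous_intros)
  have ki: "integrable (unit_measure \<Otimes>\<^sub>M unit_measure) ?k"
    by (rule UU.integrable_const_bound[where B=1]) (use km in auto)
  have inner: "kernel_const / R \<le> (LINT t'|unit_measure. ?k (t, t'))" if t: "t \<in> {0..1}" for t
  proof -
    define h where "h = 1 / (2*R)"
    \<comment> \<open>The interval of length \<open>h\<close> next to \<open>t\<close> is placed to
      the right or to the left of \<open>t\<close> so that it stays inside [0, 1].\<close>
    define l where "l = (if t \<le> 1/2 then t else t - h)"
    have hR: "h \<le> 1/2" "0 < h" using R by (auto simp: h_def field_simps)
    have sub: "{l..l + h} \<subseteq> {0..1}" using t hR by (auto simp: l_def)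
    have near: "\<bar>t - t'\<bar> \<le> h" if "t' \<in> {l..l + h}" for t'
      using that by (auto simp: l_def split: if_splits)
    have low: "exp (- (pi\<^sup>2 / 2)) * indicator {l..l + h} t' \<le> ?k (t, t')" for t'
    proof (cases "t' \<in> {l..l + h}")
      case True
      have "(t - t')\<^sup>2 \<le> (h)\<^sup>2" using power_mono[OF near[OF True], of 2] by simp
      then have "2*pi\<^sup>2*R\<^sup>2*(t - t')\<^sup>2 \<le> 2*pi\<^sup>2*R\<^sup>2*(h)\<^sup>2" by (intro mult_left_mono) auto
      also have "\<dots> = pi\<^sup>2 / 2" using R by (simp add: h_def power_divide power_mult_distrib)
      finally show ?thesis using True by simp
    qed simp
    have km': "(\<lambda>t'. ?k (t, t')) \<in> borel_measurable unit_measure"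
      unfolding fst_conv snd_conv by measurable
    have i: "integrable unit_measure (\<lambda>t'. ?k (t, t'))"
      by (rule U.integrable_const_bound[where B=1]) (use km' in auto)
    have "kernel_const / R = exp (- (pi\<^sup>2 / 2)) * U.prob {l..l + h}"
    proof -
      have "emeasure unit_measure {l..l + h} = (\<integral>\<^sup>+x. indicator {l..l + h} x \<partial>lborel)"
      proof -
        have "ennreal (indicator {0..1} x) * indicator {l..l + h} x = indicator {l..l + h} x" for x
        proof (cases "x \<in> {l..l + h}")
          case True
          then have "x \<in> {0..1}" using sub by blast
          then show ?thesis using True by simp
        qed simp
        then show ?thesis unfolding unit_measure_def by (subst emeasure_density) simp_all
      qed
      also have "\<dots> = ennreal (h)" using hR by simp
      finally have "U.prob {l..l + h} = h" using hR by (simp add: measure_def)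
      then show ?thesis by (simp add: kernel_const_def h_def)
    qed
    also have "\<dots> = (LINT t'|unit_measure. exp (- (pi\<^sup>2 / 2)) * indicator {l..l + h} t')" by simp
    also have "\<dots> \<le> (LINT t'|unit_measure. ?k (t, t'))"
      by (intro integral_mono low i) (simp add: integrable_indicator_iff U.emeasure_finite less_top[symmetric])
    finally show ?thesis .
  qed
  have "kernel_const / R = (LINT t|unit_measure. kernel_const / R)" using U.prob_space by simp
  also have "\<dots> \<le> (LINT t|unit_measure. (LINT t'|unit_measure. ?k (t, t')))"
    by (rule integral_mono_AE) (use UU.integrable_fst'[OF ki] AE_unit_measure inner in \<open>auto intro: AE_mp\<close>)
  also have "\<dots> = (LINT p|(unit_measure \<Otimes>\<^sub>M unit_measure). ?k p)"
    using UU.integral_fst'[OF ki] by simp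
  finally show ?thesis .
qed

text \<open>cos v >= 1 - v^2 / 2 separates the total mass of the kernel from an error of size y^2
  times the path variation. For Brownian paths the error is of order y^2 / R^2, so the main term of
  order 1 / R survives up to |y| of order sqrt R.\<close>

lemma integral_normal_path_ft_sq_ge:
  assumes w: "continuous_on UNIV w" and R: "1 \<le> R"
  shows "kernel_const / R - 2*pi\<^sup>2*y\<^sup>2 * path_variation w R
    \<le> (LINT x|density lborel (normal_density 0 R). (norm (path_ft w x y))\<^sup>2)"
proof -
  interpret U: prob_space unit_measure by (rule prob_space_unit_measure)
  interpret UU: pair_prob_space unit_measure unit_measure ..
  let ?UU = "(unit_measure \<Otimes>\<^sub>M unit_measure)"
  define k where "k p = exp (- (2*pi\<^sup>2*R\<^sup>2*(fst p - snd p)\<^sup>2))" for p :: "real \<times> real"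
  define v where "v p = w (fst p) - w (snd p)" for p :: "real \<times> real"
  have "compact (w ` {0..1})" by (intro compact_continuous_image continuous_on_subset[OF w]) auto
  then obtain B where B: "\<And>t. t \<in> {0..1} \<Longrightarrow> \<bar>w t\<bar> \<le> B"
    using compact_imp_bounded bounded_pos by (metis imageI real_norm_def)
  have kc: "continuous_on UNIV k" and vc: "continuous_on UNIV v"
    unfolding k_def v_def by (intro continuous_intros continuous_on_compose2[OF w]; simp)+
  have k1: "0 \<le> k p" "k p \<le> 1" for p by (auto simp: k_def)
  have m: "f \<in> borel_measurable ?UU" if "continuous_on UNIV f" for f :: "real \<times> real \<Rightarrow> real"
    by (intro measurable_pair_unit_measure borel_measurable_continuous_onI that)
  have ki: "integrable ?UU k"
    by (rule UU.integrable_const_bound[where B=1]) (use m[OF kc] k1 in auto)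
  have kci: "integrable ?UU (\<lambda>p. k p * cos (2*pi*y * v p))"
  proof (rule UU.integrable_const_bound[where B=1])
    show "AE p in ?UU. norm (k p * cos (2*pi*y * v p)) \<le> 1"
    proof (intro always_eventually allI)
      fix p
      have "\<bar>k p\<bar> * \<bar>cos (2*pi*y * v p)\<bar> \<le> 1 * 1" using k1[of p] by (intro mult_mono) auto
      then show "norm (k p * cos (2*pi*y * v p)) \<le> 1" by (simp add: abs_mult)
    qed
  qed (intro m continuous_intros kc vc)
  have kvi: "integrable ?UU (\<lambda>p. k p * (v p)\<^sup>2)"
  proof (rule UU.integrable_const_bound[where B="(2*B)\<^sup>2"])
    show "AE p in ?UU. norm (k p * (v p)\<^sup>2) \<le> (2*B)\<^sup>2"
      using AE_pair_unit_measure
    proof eventually_elim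
      case (elim p)
      have "\<bar>v p\<bar> \<le> 2 * B" using B[of "fst p"] B[of "snd p"] elim unfolding v_def by linarith
      then have "(v p)\<^sup>2 \<le> (2*B)\<^sup>2" by (metis abs_ge_zero power2_abs power_mono)
      then have "\<bar>k p\<bar> * (v p)\<^sup>2 \<le> 1 * (2*B)\<^sup>2" using k1[of p] by (intro mult_mono) auto
      then show ?case by (simp add: abs_mult)
    qed
  qed (intro m continuous_intros kc vc)
  have "kernel_const / R - 2*pi\<^sup>2*y\<^sup>2 * path_variation w R \<le> (LINT p|?UU. k p) - 2*pi\<^sup>2*y\<^sup>2 * (LINT p|?UU. k p * (v p)\<^sup>2)"
    using integral_gauss_kernel_ge[OF R] by (simp add: path_variation_def k_def v_def)
  also have "\<dots> = (LINT p|?UU. k p - 2*pi\<^sup>2*y\<^sup>2 * (k p * (v p)\<^sup>2))"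
    using ki kvi by simp
  also have "\<dots> \<le> (LINT p|?UU. k p * cos (2*pi*y * v p))"
  proof (rule integral_mono)
    fix p
    have "k p * (1 - (2*pi*y * v p)\<^sup>2 / 2) \<le> k p * cos (2*pi*y * v p)"
      by (intro mult_left_mono cos_ge_one_minus_sq k1)
    then show "k p - 2*pi\<^sup>2*y\<^sup>2 * (k p * (v p)\<^sup>2) \<le> k p * cos (2*pi*y * v p)"
      by (simp add: power_mult_distrib algebra_simps)
  qed (use ki kvi kci in auto)
  also have "\<dots> = (LINT x|density lborel (normal_density 0 R). (norm (path_ft w x y))\<^sup>2)"
    using R by (subst integral_normal_path_ft_sq[OF w]) (auto simp: k_def v_def)
  finally show ?thesis .
qed

section \<open>The size of the path variation\<close>

lemma nn_integral_gauss_abs: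
  assumes R: "0 < R"
  shows "(\<integral>\<^sup>+u. ennreal (exp (- (2*pi\<^sup>2*R\<^sup>2*u\<^sup>2)) * \<bar>u\<bar>) \<partial>lborel) = ennreal (1 / (2*pi\<^sup>2*R\<^sup>2))"
proof -
  \<comment> \<open>With this deviation 1 / (2 sigma^2) equals 2 pi^2 R^2, so the integral is a
    multiple of the first absolute moment of a normal law.\<close>
  define \<sigma> where "\<sigma> = 1 / (2*pi*R)"
  have \<sigma>: "0 < \<sigma>" using R by (simp add: \<sigma>_def)
  have e: "exp (- (2*pi\<^sup>2*R\<^sup>2*u\<^sup>2)) * \<bar>u\<bar> = sqrt (2*pi) * \<sigma> * (normal_density 0 \<sigma> u * \<bar>u\<bar> ^ (2*0+1))" for u
  proof -
    have "- (2*pi\<^sup>2*R\<^sup>2*u\<^sup>2) = - u\<^sup>2 / (2 * \<sigma>\<^sup>2)"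
      using R by (simp add: \<sigma>_def power_divide power_mult_distrib field_simps)
    moreover have "sqrt (2 * pi * \<sigma>\<^sup>2) = sqrt (2*pi) * \<sigma>" using \<sigma> by (simp add: real_sqrt_mult)
    ultimately show ?thesis using \<sigma> by (simp add: normal_density_def)
  qed
  have "has_bochner_integral lborel (\<lambda>u. normal_density 0 \<sigma> u * \<bar>u - 0\<bar> ^ (2*0+1)) (2 ^ 0 * \<sigma> ^ (2*0+1) * fact 0 * sqrt (2/pi))"
    by (rule normal_moment_abs_odd[OF \<sigma>])
  then have "has_bochner_integral lborel (\<lambda>u. exp (- (2*pi\<^sup>2*R\<^sup>2*u\<^sup>2)) * \<bar>u\<bar>) (sqrt (2*pi) * \<sigma> * (2 ^ 0 * \<sigma> ^ (2*0+1) * fact 0 * sqrt (2/pi)))"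
    unfolding e by (intro has_bochner_integral_mult_right) simp
  then have "(\<integral>\<^sup>+u. ennreal (exp (- (2*pi\<^sup>2*R\<^sup>2*u\<^sup>2)) * \<bar>u\<bar>) \<partial>lborel) = ennreal (sqrt (2*pi) * \<sigma> * (2 ^ 0 * \<sigma> ^ (2*0+1) * fact 0 * sqrt (2/pi)))"
    by (intro nn_integral_eq_integral[THEN trans]) (auto simp: has_bochner_integral_iff)
  also have "sqrt (2*pi) * \<sigma> * (2 ^ 0 * \<sigma> ^ (2*0+1) * fact 0 * sqrt (2/pi)) = (sqrt (2*pi) * sqrt (2/pi)) * \<sigma>\<^sup>2"
    by (simp add: power2_eq_square mult_ac)
  also have "sqrt (2*pi) * sqrt (2/pi) = 2" by (simp flip: real_sqrt_mult)
  also have "2 * \<sigma>\<^sup>2 = 1 / (2*pi\<^sup>2*R\<^sup>2)" by (simp add: \<sigma>_def power_divide power_mult_distrib)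
  finally show ?thesis .
qed

text \<open>The expected squared increment is the time difference. Fubini therefore leaves the
  kernel times |t - t'|, and extending the inner integral to the whole line gives the Gaussian
  integral just computed.\<close>

lemma expectation_path_variation_le:
  assumes bm: "standard_brownian_motion M X"
    and Zm: "\<And>t. Z t \<in> borel_measurable M" and Zc: "\<And>\<omega>. continuous_on UNIV (\<lambda>t. Z t \<omega>)"
    and ZX: "AE \<omega> in M. \<forall>t\<in>{0..1}. Z t \<omega> = X t \<omega>" and R: "0 < R"
  shows "(\<lambda>\<omega>. path_variation (\<lambda>t. Z t \<omega>) R) \<in> borel_measurable M"
    and "(\<integral>\<^sup>+\<omega>. ennreal (path_variation (\<lambda>t. Z t \<omega>) R) \<partial>M) \<le> ennreal (1 / (2*pi\<^sup>2*R\<^sup>2))"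
proof -
  interpret prob_space M by (rule standard_brownian_motionD(1)[OF bm])
  interpret U: prob_space unit_measure by (rule prob_space_unit_measure)
  let ?UU = "(unit_measure \<Otimes>\<^sub>M unit_measure)"
  interpret UU: pair_prob_space unit_measure unit_measure ..
  interpret P: pair_sigma_finite ?UU M ..
  define k where "k p = exp (- (2*pi\<^sup>2*R\<^sup>2*(fst p - snd p)\<^sup>2))" for p :: "real \<times> real"
  define f where "f p \<omega> = k p * (Z (fst p) \<omega> - Z (snd p) \<omega>)\<^sup>2" for p \<omega>
  have k0: "0 \<le> k p" for p by (simp add: k_def)
  have f0: "0 \<le> f p \<omega>" for p \<omega> using k0 by (simp add: f_def)
  have kc: "continuous_on UNIV k" unfolding k_def by (intro continuous_intros)
  have [measurable]: "(\<lambda>q. Z (fst (fst q)) (snd q)) \<in> borel_measurable (?UU \<Otimes>\<^sub>M M)"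
    using measurable_compose[OF _ measurable_continuous_process[OF Zm Zc], of "\<lambda>q. (fst (fst q), snd q)" "?UU \<Otimes>\<^sub>M M"] by simp
  have [measurable]: "(\<lambda>q. Z (snd (fst q)) (snd q)) \<in> borel_measurable (?UU \<Otimes>\<^sub>M M)"
    using measurable_compose[OF _ measurable_continuous_process[OF Zm Zc], of "\<lambda>q. (snd (fst q), snd q)" "?UU \<Otimes>\<^sub>M M"] by simp
  have [measurable]: "k \<in> borel_measurable ?UU"
    by (intro measurable_pair_unit_measure borel_measurable_continuous_onI kc)
  have fm: "(\<lambda>q. f (fst q) (snd q)) \<in> borel_measurable (?UU \<Otimes>\<^sub>M M)"
    unfolding f_def by measurable
  from measurable_compose[OF _ fm, of "\<lambda>q. (snd q, fst q)" "M \<Otimes>\<^sub>M ?UU"]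
  have fm': "(\<lambda>q. f (snd q) (fst q)) \<in> borel_measurable (M \<Otimes>\<^sub>M ?UU)" by simp
  have pv: "path_variation (\<lambda>t. Z t \<omega>) R = (LINT p|?UU. f p \<omega>)" for \<omega>
    by (simp add: path_variation_def f_def k_def)
  show "(\<lambda>\<omega>. path_variation (\<lambda>t. Z t \<omega>) R) \<in> borel_measurable M"
    unfolding pv using fm' by (intro UU.borel_measurable_lebesgue_integral) (simp add: split_beta)
  have fpm: "(\<lambda>p. f p \<omega>) \<in> borel_measurable ?UU" for \<omega>
    unfolding f_def
    by (intro measurable_pair_unit_measure borel_measurable_continuous_onI continuous_intros kc continuous_on_compose2[OF Zc]) auto
  \<comment> \<open>An inequality suffices and needs no integrability: were the integral on the
    right infinite, the left side would be 0.\<close>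
  have le: "ennreal (path_variation (\<lambda>t. Z t \<omega>) R) \<le> (\<integral>\<^sup>+p. ennreal (f p \<omega>) \<partial>?UU)" for \<omega>
    unfolding pv using f0 fpm
    by (subst integral_eq_nn_integral) (auto simp: ennreal_enn2real_if)
  have inner: "(\<integral>\<^sup>+\<omega>. ennreal (f p \<omega>) \<partial>M) = ennreal (k p * \<bar>fst p - snd p\<bar>)" if p: "fst p \<in> {0..1} \<and> snd p \<in> {0..1}" for p
  proof -
    have incr: "(\<integral>\<^sup>+\<omega>. ennreal ((Z t \<omega> - Z s \<omega>)\<^sup>2) \<partial>M) = ennreal (t - s)" if st: "0 \<le> s" "s < t" "t \<le> 1" for s t
    proof -
      have D: "distributed M lborel (\<lambda>\<omega>. X t \<omega> - X s \<omega>) (normal_density 0 (sqrt (t - s)))"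
        by (rule standard_brownian_motionD(4)[OF bm st])
      have s0: "0 < sqrt (t - s)" using st by simp
      have "(\<integral>\<^sup>+\<omega>. ennreal ((Z t \<omega> - Z s \<omega>)\<^sup>2) \<partial>M) = (\<integral>\<^sup>+\<omega>. ennreal ((X t \<omega> - X s \<omega>)^(2*1)) \<partial>M)"
        by (rule nn_integral_cong_AE) (use ZX in eventually_elim, use st in auto)
      also have "\<dots> = ennreal (expectation (\<lambda>\<omega>. (X t \<omega> - X s \<omega>)^(2*1)))"
        by (rule nn_integral_eq_integral[OF expectation_even_moment_normal(1)[OF D s0]]) simp
      also have "expectation (\<lambda>\<omega>. (X t \<omega> - X s \<omega>)^(2*1)) = t - s"
        unfolding expectation_even_moment_normal(2)[OF D s0, of 1] using st by (simp add: fact_numeral)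
      finally show ?thesis .
    qed
    have [measurable]: "Z t \<in> borel_measurable M" for t by (rule Zm)
    have "(\<integral>\<^sup>+\<omega>. ennreal (f p \<omega>) \<partial>M) = ennreal (k p) * (\<integral>\<^sup>+\<omega>. ennreal ((Z (fst p) \<omega> - Z (snd p) \<omega>)\<^sup>2) \<partial>M)"
      unfolding f_def using k0[of p] by (simp add: ennreal_mult' nn_integral_cmult)
    also have "(\<integral>\<^sup>+\<omega>. ennreal ((Z (fst p) \<omega> - Z (snd p) \<omega>)\<^sup>2) \<partial>M) = ennreal \<bar>fst p - snd p\<bar>"
    proof (cases "fst p" "snd p" rule: linorder_cases)
      case less
      then show ?thesis using p incr[of "fst p" "snd p"] by (simp add: power2_commute)
    next
      case greater
      then show ?thesis using p incr[of "snd p" "fst p"] by simp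
    qed simp
    finally show ?thesis using k0[of p] by (simp add: ennreal_mult')
  qed
  have "(\<integral>\<^sup>+\<omega>. ennreal (path_variation (\<lambda>t. Z t \<omega>) R) \<partial>M) \<le> (\<integral>\<^sup>+\<omega>. (\<integral>\<^sup>+p. ennreal (f p \<omega>) \<partial>?UU) \<partial>M)"
    by (intro nn_integral_mono le)
  also have "\<dots> = (\<integral>\<^sup>+p. (\<integral>\<^sup>+\<omega>. ennreal (f p \<omega>) \<partial>M) \<partial>?UU)"
    by (rule P.Fubini') (use fm in \<open>simp add: split_beta\<close>)
  also have "\<dots> = (\<integral>\<^sup>+p. ennreal (k p * \<bar>fst p - snd p\<bar>) \<partial>?UU)"
    by (rule nn_integral_cong_AE) (use AE_pair_unit_measure in eventually_elim, use inner in auto)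
  also have "\<dots> = (\<integral>\<^sup>+t. (\<integral>\<^sup>+t'. ennreal (k (t, t') * \<bar>t - t'\<bar>) \<partial>unit_measure) \<partial>unit_measure)"
  proof -
    have "(\<lambda>p. ennreal (k p * \<bar>fst p - snd p\<bar>)) \<in> borel_measurable ?UU" by measurable
    then show ?thesis by (subst U.nn_integral_fst[symmetric]) auto
  qed
  also have "\<dots> \<le> (\<integral>\<^sup>+t. ennreal (1 / (2*pi\<^sup>2*R\<^sup>2)) \<partial>unit_measure)"
  proof (rule nn_integral_mono)
    fix t :: real
    have "(\<integral>\<^sup>+t'. ennreal (k (t, t') * \<bar>t - t'\<bar>) \<partial>unit_measure) \<le> (\<integral>\<^sup>+t'. ennreal (k (t, t') * \<bar>t - t'\<bar>) \<partial>lborel)"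
      unfolding unit_measure_def k_def
      by (subst nn_integral_density) (auto intro!: nn_integral_mono simp: indicator_def)
    also have "\<dots> = (\<integral>\<^sup>+u. ennreal (exp (- (2*pi\<^sup>2*R\<^sup>2*u\<^sup>2)) * \<bar>u\<bar>) \<partial>lborel)"
      by (subst nn_integral_real_affine[where c="-1" and t=t]) (auto simp: k_def)
    also have "\<dots> = ennreal (1 / (2*pi\<^sup>2*R\<^sup>2))" by (rule nn_integral_gauss_abs[OF R])
    finally show "(\<integral>\<^sup>+t'. ennreal (k (t, t') * \<bar>t - t'\<bar>) \<partial>unit_measure) \<le> ennreal (1 / (2*pi\<^sup>2*R\<^sup>2))" .
  qed
  also have "\<dots> = ennreal (1 / (2*pi\<^sup>2*R\<^sup>2))" using U.emeasure_space_1 by simp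
  finally show "(\<integral>\<^sup>+\<omega>. ennreal (path_variation (\<lambda>t. Z t \<omega>) R) \<partial>M) \<le> ennreal (1 / (2*pi\<^sup>2*R\<^sup>2))" .
qed

text \<open>First moments at dyadic scales, weighted by 4^j / (j + 1)^2, have a finite sum, so the
  weighted variations are bounded almost surely. The price (j + 1)^2 is only logarithmic in R =
  2^j.\<close>

lemma AE_path_variation_le:
  assumes bm: "standard_brownian_motion M X"
    and Zm: "\<And>t. Z t \<in> borel_measurable M" and Zc: "\<And>\<omega>. continuous_on UNIV (\<lambda>t. Z t \<omega>)"
    and ZX: "AE \<omega> in M. \<forall>t\<in>{0..1}. Z t \<omega> = X t \<omega>"
  shows "AE \<omega> in M. \<exists>C>0. \<forall>j. path_variation (\<lambda>t. Z t \<omega>) (2 ^ j) \<le> C * (real (Suc j))\<^sup>2 / 4 ^ j"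
proof -
  interpret prob_space M by (rule standard_brownian_motionD(1)[OF bm])
  define V where "V j \<omega> = path_variation (\<lambda>t. Z t \<omega>) (2 ^ j)" for j \<omega>
  define c where "c j = 4 ^ j / (real (Suc j))\<^sup>2" for j
  have c0: "0 < c j" for j by (simp add: c_def)
  have [measurable]: "V j \<in> borel_measurable M" for j
    unfolding V_def by (rule expectation_path_variation_le(1)[OF bm Zm Zc ZX]) simp
  have ET: "(\<integral>\<^sup>+\<omega>. ennreal (c j) * ennreal (V j \<omega>) \<partial>M) \<le> ennreal (1 / (2*pi\<^sup>2) * (1 / (real (Suc j))\<^sup>2))" for j
  proof -
    have "(\<integral>\<^sup>+\<omega>. ennreal (c j) * ennreal (V j \<omega>) \<partial>M) = ennreal (c j) * (\<integral>\<^sup>+\<omega>. ennreal (V j \<omega>) \<partial>M)"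
      by (rule nn_integral_cmult) measurable
    also have "\<dots> \<le> ennreal (c j) * ennreal (1 / (2*pi\<^sup>2*(2 ^ j)\<^sup>2))"
      unfolding V_def by (intro mult_left_mono expectation_path_variation_le(2)[OF bm Zm Zc ZX]) auto
    also have "\<dots> = ennreal (c j * (1 / (2*pi\<^sup>2*(2 ^ j)\<^sup>2)))"
      using c0[of j] by (intro ennreal_mult[symmetric]) auto
    also have "c j * (1 / (2*pi\<^sup>2*(2 ^ j)\<^sup>2)) = 1 / (2*pi\<^sup>2) * (1 / (real (Suc j))\<^sup>2)"
    proof -
      have "((2::real) ^ j)\<^sup>2 = 4 ^ j" by (simp add: power_mult[symmetric] mult.commute[of j]) (simp add: power_mult)
      then show ?thesis by (simp add: c_def)
    qed
    finally show ?thesis .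
  qed
  have "(\<integral>\<^sup>+\<omega>. (\<Sum>j. ennreal (c j) * ennreal (V j \<omega>)) \<partial>M) = (\<Sum>j. \<integral>\<^sup>+\<omega>. ennreal (c j) * ennreal (V j \<omega>) \<partial>M)" by (rule nn_integral_suminf) measurable
  also have "\<dots> \<le> (\<Sum>j. ennreal (1 / (2*pi\<^sup>2) * (1 / (real (Suc j))\<^sup>2)))" by (intro suminf_le ET) auto
  also have "\<dots> < \<infinity>"
  proof -
    have "summable (\<lambda>j. 1 / (2*pi\<^sup>2) * (1 / (real (Suc j))\<^sup>2))" by (intro summable_mult summable_inverse_Suc_power2)
    then show ?thesis by (subst suminf_ennreal2) auto
  qed
  finally have "(\<integral>\<^sup>+\<omega>. (\<Sum>j. ennreal (c j) * ennreal (V j \<omega>)) \<partial>M) \<noteq> \<infinity>" by simp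
  then have "AE \<omega> in M. (\<Sum>j. ennreal (c j) * ennreal (V j \<omega>)) \<noteq> \<infinity>" by (intro nn_integral_PInf_AE) measurable
  then show ?thesis
  proof eventually_elim
    case (elim \<omega>)
    define C where "C = enn2real (\<Sum>j. ennreal (c j) * ennreal (V j \<omega>)) + 1"
    have C: "(\<Sum>j. ennreal (c j) * ennreal (V j \<omega>)) \<le> ennreal C" "0 < C" using elim
      by (auto simp: C_def less_top add_nonneg_pos intro!: order_trans[OF _ ennreal_leI[of "enn2real (\<Sum>j. ennreal (c j) * ennreal (V j \<omega>))"]])
    show ?case
    proof (intro exI[of _ C] conjI C(2) allI)
      fix j
      have "ennreal (c j) * ennreal (V j \<omega>) \<le> (\<Sum>j. ennreal (c j) * ennreal (V j \<omega>))"
        using sum_le_suminf[of "\<lambda>j. ennreal (c j) * ennreal (V j \<omega>)" "{j}"] by simp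
      also note C(1)
      finally have "ennreal (c j * V j \<omega>) \<le> ennreal C" using c0[of j] by (simp add: ennreal_mult')
      then have "c j * V j \<omega> \<le> C" using C(2) by (simp add: ennreal_le_iff)
      then have "V j \<omega> \<le> C / c j" using c0[of j] by (simp add: pos_le_divide_eq mult.commute)
      then show "path_variation (\<lambda>t. Z t \<omega>) (2 ^ j) \<le> C * (real (Suc j))\<^sup>2 / 4 ^ j"
        by (simp add: V_def c_def)
    qed
  qed
qed

section \<open>The jump at the origin\<close>

lemma Basis_vec_real: "(Basis :: (real ^ 'k::finite) set) = range (\<lambda>i. axis i 1)"
  by (auto simp: Basis_vec_def)

lemma inj_axis_one: "inj (\<lambda>i. axis i (1::real) :: real ^ 'k::finite)"
  by (auto simp: inj_on_def axis_eq_axis)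

text \<open>Product formulas for \<open>lborel\<close> run over \<open>Basis\<close>; recovering the
  index from the unit vector lets each coordinate carry its own function.\<close>

definition basis_index :: "real ^ 'k::finite \<Rightarrow> 'k" where
  "basis_index = inv (\<lambda>i. axis i 1)"

lemma basis_index_axis[simp]: "basis_index (axis i (1::real) :: real ^ 'k::finite) = i"
  unfolding basis_index_def by (rule inv_f_f[OF inj_axis_one])

lemma prod_Basis_vec:
  "(\<Prod>b\<in>(Basis :: (real ^ 'k::finite) set). f (basis_index b) b) = (\<Prod>i\<in>UNIV. f i (axis i 1))"
  unfolding Basis_vec_real by (subst prod.reindex[OF inj_axis_one]) simp

lemma nn_integral_lborel_vec_prod:
  fixes f :: "'k::finite \<Rightarrow> real \<Rightarrow> ennreal"
  assumes "\<And>i. f i \<in> borel_measurable borel"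
  shows "(\<integral>\<^sup>+x. (\<Prod>i\<in>UNIV. f i (x $ i)) \<partial>(lborel :: (real ^ 'k) measure)) = (\<Prod>i\<in>UNIV. \<integral>\<^sup>+x. f i x \<partial>lborel)"
proof -
  have "(\<Prod>i\<in>UNIV. f i (x $ i)) = (\<Prod>b\<in>Basis. f (basis_index b) (x \<bullet> b))" for x :: "real ^ 'k"
    using prod_Basis_vec[of "\<lambda>i b. f i (x \<bullet> b)"] by (simp add: inner_axis)
  moreover have "(\<integral>\<^sup>+x. (\<Prod>b\<in>Basis. f (basis_index b) (x \<bullet> b)) \<partial>(lborel :: (real ^ 'k) measure)) = (\<Prod>b\<in>(Basis :: (real ^ 'k) set). \<integral>\<^sup>+x. f (basis_index b) x \<partial>lborel)"
    using assms by (intro nn_integral_lborel_prod) auto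
  ultimately show ?thesis
    using prod_Basis_vec[of "\<lambda>i b :: real ^ 'k. \<integral>\<^sup>+x. f i x \<partial>lborel"] by simp
qed

lemma integral_lborel_vec_prod:
  fixes f :: "'k::finite \<Rightarrow> real \<Rightarrow> complex"
  assumes "\<And>i. integrable lborel (f i)"
  shows "(LINT x|(lborel :: (real ^ 'k) measure). (\<Prod>i\<in>UNIV. f i (x $ i))) = (\<Prod>i\<in>UNIV. LINT x|lborel. f i x)"
proof -
  interpret P: product_sigma_finite "\<lambda>b :: real ^ 'k. lborel :: real measure" ..
  have fm[measurable]: "f i \<in> borel_measurable borel" for i using assms[of i] by auto
  have e: "(\<Prod>i\<in>UNIV. f i (x $ i)) = (\<Prod>b\<in>Basis. f (basis_index b) (x \<bullet> b))" for x :: "real ^ 'k"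
    using prod_Basis_vec[of "\<lambda>i b. f i (x \<bullet> b)"] by (simp add: inner_axis)
  have "(LINT x|(lborel :: (real ^ 'k) measure). (\<Prod>b\<in>Basis. f (basis_index b) (x \<bullet> b)))
      = (LINT g|(\<Pi>\<^sub>M b\<in>(Basis :: (real ^ 'k) set). lborel). (\<Prod>b\<in>Basis. f (basis_index b) ((\<Sum>c\<in>Basis. g c *\<^sub>R c) \<bullet> b)))"
    by (subst lborel_eq) (subst integral_distr, auto)
  also have "\<dots> = (LINT g|(\<Pi>\<^sub>M b\<in>(Basis :: (real ^ 'k) set). lborel). (\<Prod>b\<in>Basis. f (basis_index b) (g b)))"
    by (intro Bochner_Integration.integral_cong prod.cong) (auto simp: inner_sum_left inner_Basis if_distrib cong: if_cong)
  also have "\<dots> = (\<Prod>b\<in>(Basis :: (real ^ 'k) set). LINT x|lborel. f (basis_index b) x)"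
    using assms by (intro P.product_integral_prod) auto
  also have "\<dots> = (\<Prod>i\<in>UNIV. LINT x|lborel. f i x)"
    using prod_Basis_vec[of "\<lambda>i b :: real ^ 'k. LINT x|lborel. f i x"] by simp
  finally show ?thesis unfolding e .
qed

text \<open>A one-dimensional majorant with separate exponents at 0 and at infinity, integrable when
  a < 1 < r.\<close>

definition two_power :: "real \<Rightarrow> real \<Rightarrow> real \<Rightarrow> real" where
  "two_power a r x = (if \<bar>x\<bar> \<le> 1 then \<bar>x\<bar> powr (- a) else \<bar>x\<bar> powr (- r))"

lemma two_power_nonneg: "0 \<le> two_power a r x"
  by (simp add: two_power_def)

lemma measurable_two_power[measurable]: "two_power a r \<in> borel_measurable borel"
  unfolding two_power_def by measurable

lemma nn_integral_two_power_finite: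
  assumes a: "a < 1" and r: "1 < r"
  shows "(\<integral>\<^sup>+x. ennreal (two_power a r x) \<partial>lborel) < \<infinity>"
proof -
  define g where "g x = indicator {0..1} x * x powr (- a) + indicator {1..} x * x powr (- r)" for x :: real
  have gm[measurable]: "g \<in> borel_measurable borel" unfolding g_def by measurable
  have g0: "0 \<le> g x" for x by (simp add: g_def)
  have i1: "(\<integral>\<^sup>+x. ennreal (indicator {0..1} x * x powr (- a)) \<partial>lborel) < \<infinity>"
  proof -
    have "((\<lambda>x. x powr (- a)) has_integral (1 powr (- a + 1) / (- a + 1))) {0..1::real}"
      using a by (intro has_integral_powr_from_0) auto
    then have "((\<lambda>x. if x \<in> {0..1} then x powr (- a) else 0) has_integral (1 powr (- a + 1) / (- a + 1))) (UNIV :: real set)"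
      by (simp only: has_integral_restrict_UNIV)
    then have "((\<lambda>x. indicator {0..1} x * x powr (- a)) has_integral (1 powr (- a + 1) / (- a + 1))) (UNIV :: real set)"
      by (rule has_integral_eq[rotated]) (auto simp: indicator_def)
    then have "(\<integral>\<^sup>+x. ennreal (indicator {0..1} x * x powr (- a)) \<partial>lborel) = ennreal (1 powr (- a + 1) / (- a + 1))"
      by (intro nn_integral_has_integral_lborel) auto
    then show ?thesis by simp
  qed
  have i2: "(\<integral>\<^sup>+x. ennreal (indicator {1..} x * x powr (- r)) \<partial>lborel) < \<infinity>"
  proof -
    have "((\<lambda>x. x powr (- r)) has_integral (- (1 powr (- r + 1)) / (- r + 1))) {1::real..}"
      using r by (intro has_integral_powr_to_inf) auto
    then have "((\<lambda>x. if x \<in> {1..} then x powr (- r) else 0) has_integral (- (1 powr (- r + 1)) / (- r + 1))) (UNIV :: real set)"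
      by (simp only: has_integral_restrict_UNIV)
    then have "((\<lambda>x. indicator {1..} x * x powr (- r)) has_integral (- (1 powr (- r + 1)) / (- r + 1))) (UNIV :: real set)"
      by (rule has_integral_eq[rotated]) (auto simp: indicator_def)
    then have "(\<integral>\<^sup>+x. ennreal (indicator {1..} x * x powr (- r)) \<partial>lborel) = ennreal (- (1 powr (- r + 1)) / (- r + 1))"
      by (intro nn_integral_has_integral_lborel) auto
    then show ?thesis by simp
  qed
  have "(\<integral>\<^sup>+x. ennreal (g x) \<partial>lborel) = (\<integral>\<^sup>+x. ennreal (indicator {0..1} x * x powr (- a)) \<partial>lborel) + (\<integral>\<^sup>+x. ennreal (indicator {1..} x * x powr (- r)) \<partial>lborel)"
    unfolding g_def by (subst nn_integral_add[symmetric]) (auto simp: ennreal_plus)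
  then have ig: "(\<integral>\<^sup>+x. ennreal (g x) \<partial>lborel) < \<infinity>" using i1 i2 by simp
  have ig': "(\<integral>\<^sup>+x. ennreal (g (- x)) \<partial>lborel) = (\<integral>\<^sup>+x. ennreal (g x) \<partial>lborel)"
    using nn_integral_real_affine[of "\<lambda>x. ennreal (g x)" "-1" 0] by simp
  have "(\<integral>\<^sup>+x. ennreal (two_power a r x) \<partial>lborel) \<le> (\<integral>\<^sup>+x. ennreal (g x) + ennreal (g (- x)) \<partial>lborel)"
  proof (rule nn_integral_mono)
    fix x
    have "two_power a r x \<le> g x + g (- x)"
      by (auto simp: two_power_def g_def indicator_def abs_if)
    then show "ennreal (two_power a r x) \<le> ennreal (g x) + ennreal (g (- x))"
      using g0 by (simp add: ennreal_plus[symmetric] ennreal_leI del: ennreal_plus)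
  qed
  also have "\<dots> = (\<integral>\<^sup>+x. ennreal (g x) \<partial>lborel) + (\<integral>\<^sup>+x. ennreal (g (- x)) \<partial>lborel)"
    by (rule nn_integral_add) measurable
  also have "\<dots> < \<infinity>" unfolding ig' using ig by simp
  finally show ?thesis .
qed

lemma continuous_path_ft:
  assumes w: "continuous_on UNIV w"
  shows "continuous_on UNIV (\<lambda>p. path_ft w (fst p) (snd p))"
proof -
  have "compact (w ` {0..1})" by (intro compact_continuous_image continuous_on_subset[OF w]) auto
  then obtain B where B: "\<And>t. t \<in> {0..1} \<Longrightarrow> \<bar>w t\<bar> \<le> B" "0 < B"
    using compact_imp_bounded bounded_pos by (metis imageI real_norm_def)
  define L where "L = 2*pi*(1 + B)"
  have L: "0 < L" unfolding L_def using B(2) by (intro mult_pos_pos) auto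
  have lip: "norm (path_ft w (fst p) (snd p) - path_ft w (fst q) (snd q)) \<le> L * dist p q" for p q
  proof -
    have d: "\<bar>fst p - fst q\<bar> \<le> dist p q" "\<bar>snd p - snd q\<bar> \<le> dist p q"
      using dist_fst_le[of p q] dist_snd_le[of p q] by (auto simp: dist_real_def)
    have "norm (path_ft w (fst p) (snd p) - path_ft w (fst q) (snd q)) \<le> 2*pi*(\<bar>fst p - fst q\<bar> + B * \<bar>snd p - snd q\<bar>)"
      by (rule path_ft_lipschitz[OF w B(1)])
    also have "\<dots> \<le> 2*pi*(dist p q + B * dist p q)" using d B(2) by (intro mult_left_mono add_mono) auto
    also have "\<dots> = L * dist p q" by (simp add: L_def algebra_simps)
    finally show ?thesis .
  qed
  show ?thesis
  proof (rule continuous_onI)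
    fix q :: "real \<times> real" and e :: real assume e: "0 < e"
    show "\<exists>d>0. \<forall>p\<in>UNIV. dist p q < d \<longrightarrow> dist (path_ft w (fst p) (snd p)) (path_ft w (fst q) (snd q)) \<le> e"
    proof (intro exI[of _ "e / L"] conjI ballI impI)
      fix p assume "dist p q < e / L"
      then have "L * dist p q < e" using L by (simp add: pos_less_divide_eq mult.commute)
      then show "dist (path_ft w (fst p) (snd p)) (path_ft w (fst q) (snd q)) \<le> e"
        using lip[of p q] by (simp add: dist_norm)
    qed (use e L in auto)
  qed
qed

lemma continuous_path_ft_fst: "continuous_on UNIV w \<Longrightarrow> continuous_on UNIV (\<lambda>x. path_ft w x y)"
  using continuous_on_compose2[OF continuous_path_ft, of w UNIV "\<lambda>x. (x, y)"] by (simp add: continuous_intros)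

text \<open>Gauss summation of the inversion integral: a Gaussian cutoff at frequency
  \<open>s\<close> is the same as averaging the original function around \<open>t\<close> with a
  Gaussian of deviation 1 / (2 pi s). The proof is Fubini followed by the substitution u = t + z /
  (2 pi s).\<close>

lemma gauss_sum_path_ft:
  assumes w: "continuous_on UNIV w" and s: "0 < s"
  shows "(LINT x|lborel. exp (- x\<^sup>2 / (2 * s\<^sup>2)) *\<^sub>R (path_ft w x y * cis (2*pi*t * x)))
    = (LINT z|lborel. std_normal_density z *\<^sub>R (indicator {0..1} (t + z / (2*pi * s)) *\<^sub>R cis (- (2*pi*y * w (t + z / (2*pi * s))))))"
proof -
  let ?N = "density lborel (\<lambda>x. ennreal (normal_density 0 s x))"
  interpret N: prob_space ?N using prob_space_normal_density[OF s] by simp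
  interpret U: prob_space unit_measure by (rule prob_space_unit_measure)
  interpret P: pair_prob_space unit_measure ?N ..
  have [measurable]: "cis \<in> borel_measurable borel"
    by (intro borel_measurable_continuous_onI continuous_on_cis continuous_on_id)
  have wm[measurable]: "w \<in> borel_measurable borel" by (rule borel_measurable_continuous_onI[OF w])
  have Fm[measurable]: "(\<lambda>x. path_ft w x y) \<in> borel_measurable borel"
    by (rule borel_measurable_continuous_onI[OF continuous_path_ft_fst[OF w]])
  define g where "g u x = cis (- (2*pi*(x * u + y * w u))) * cis (2*pi*t * x)" for u x
  have gi: "integrable (unit_measure \<Otimes>\<^sub>M ?N) (case_prod g)"
  proof (rule P.integrable_const_bound[where B=1])
    show "case_prod g \<in> borel_measurable (unit_measure \<Otimes>\<^sub>M ?N)" unfolding g_def by measurable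
  qed (auto simp: g_def norm_mult)
  define c where "c = sqrt (2*pi) * s"
  have e: "exp (- x\<^sup>2 / (2 * s\<^sup>2)) = c * normal_density 0 s x" for x
    using s by (simp add: c_def normal_density_def real_sqrt_mult)
  have "(LINT x|lborel. exp (- x\<^sup>2 / (2 * s\<^sup>2)) *\<^sub>R (path_ft w x y * cis (2*pi*t * x)))
    = c *\<^sub>R (LINT x|?N. path_ft w x y * cis (2*pi*t * x))"
    unfolding e by (subst integral_density) (auto simp flip: scaleR_scaleR)
  also have "(LINT x|?N. path_ft w x y * cis (2*pi*t * x)) = (LINT x|?N. (LINT u|unit_measure. g u x))"
    unfolding path_ft_eq_unit_measure[OF w] g_def by simp
  also have "\<dots> = (LINT u|unit_measure. (LINT x|?N. g u x))" by (rule P.Fubini_integral[OF gi])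
  also have "\<dots> = (LINT u|unit_measure. exp (- (2*pi*(t - u) * s)\<^sup>2 / 2) *\<^sub>R cis (- (2*pi*y * w u)))"
  proof (rule Bochner_Integration.integral_cong[OF refl])
    fix u
    have D: "distributed ?N lborel (\<lambda>x. x) (normal_density 0 s)"
      unfolding distributed_def by (simp add: distr_id2)
    have "(LINT x|?N. g u x) = (LINT x|?N. cis (- (2*pi*y * w u)) * cis (2*pi*(t - u) * x))"
      unfolding g_def cis_mult by (intro Bochner_Integration.integral_cong refl arg_cong[where f=cis]) (simp add: algebra_simps)
    also have "\<dots> = cis (- (2*pi*y * w u)) * of_real (exp (- (2*pi*(t - u) * s)\<^sup>2 / 2))"
      using N.expectation_cis_normal[OF D s, of "2*pi*(t - u)"] by simp
    finally show "(LINT x|?N. g u x) = exp (- (2*pi*(t - u) * s)\<^sup>2 / 2) *\<^sub>R cis (- (2*pi*y * w u))"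
      by (simp add: scaleR_conv_of_real)
  qed
  also have "\<dots> = (LINT u|lborel. indicator {0..1} u *\<^sub>R (exp (- (2*pi*(t - u) * s)\<^sup>2 / 2) *\<^sub>R cis (- (2*pi*y * w u))))"
    unfolding unit_measure_def by (subst integral_density) auto
  also have "\<dots> = (1 / (2*pi * s)) *\<^sub>R (LINT z|lborel. indicator {0..1} (t + z / (2*pi * s)) *\<^sub>R (exp (- z\<^sup>2 / 2) *\<^sub>R cis (- (2*pi*y * w (t + z / (2*pi * s))))))"
    using s by (subst lborel_integral_real_affine[where c="1 / (2*pi * s)" and t=t]) (auto simp: mult_ac)
  also have "c *\<^sub>R \<dots> = (LINT z|lborel. (c * (1 / (2*pi * s))) *\<^sub>R indicator {0..1} (t + z / (2*pi * s)) *\<^sub>R (exp (- z\<^sup>2 / 2) *\<^sub>R cis (- (2*pi*y * w (t + z / (2*pi * s))))))"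
    by (simp only: scaleR_scaleR integral_scaleR_right[symmetric] mult.assoc)
  also have "\<dots> = (LINT z|lborel. std_normal_density z *\<^sub>R (indicator {0..1} (t + z / (2*pi * s)) *\<^sub>R cis (- (2*pi*y * w (t + z / (2*pi * s))))))"
  proof (rule Bochner_Integration.integral_cong[OF refl])
    fix z
    have "c * (1 / (2*pi * s)) = 1 / sqrt (2*pi)"
      using s real_sqrt_mult_self[of "2*pi"] by (simp add: c_def field_simps)
    then show "(c * (1 / (2*pi * s))) *\<^sub>R indicator {0..1} (t + z / (2*pi * s)) *\<^sub>R (exp (- z\<^sup>2 / 2) *\<^sub>R cis (- (2*pi*y * w (t + z / (2*pi * s)))))
      = std_normal_density z *\<^sub>R (indicator {0..1} (t + z / (2*pi * s)) *\<^sub>R cis (- (2*pi*y * w (t + z / (2*pi * s)))))"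
      by (simp add: std_normal_density_def)
  qed
  finally show ?thesis .
qed

text \<open>The function inverted here jumps at 0, so its transform cannot be integrable.\<close>

lemma not_integrable_path_ft:
  assumes w: "continuous_on UNIV w"
  shows "\<not> integrable lborel (\<lambda>x. path_ft w x y)"
proof
  assume i: "integrable lborel (\<lambda>x. path_ft w x y)"
  define G where "G t = (LINT x|lborel. path_ft w x y * cis (2*pi*t * x))" for t
  have [measurable]: "cis \<in> borel_measurable borel"
    by (intro borel_measurable_continuous_onI continuous_on_cis continuous_on_id)
  have wm[measurable]: "w \<in> borel_measurable borel" by (rule borel_measurable_continuous_onI[OF w])
  have Fm[measurable]: "(\<lambda>x. path_ft w x y) \<in> borel_measurable borel"
    by (rule borel_measurable_continuous_onI[OF continuous_path_ft_fst[OF w]])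
  have in': "integrable lborel (\<lambda>x. norm (path_ft w x y))" using i by simp
  define s where "s n = real (Suc n)" for n
  have s0: "0 < s n" for n by (simp add: s_def)
  have sinf: "filterlim s at_top sequentially"
    unfolding s_def by (rule filterlim_compose[OF filterlim_real_sequentially filterlim_Suc])
  \<comment> \<open>Integrability of the transform lets the cutoff be removed under the integral
    sign.\<close>
  have lim1: "(\<lambda>n. (LINT x|lborel. exp (- x\<^sup>2 / (2 * (s n)\<^sup>2)) *\<^sub>R (path_ft w x y * cis (2*pi*t * x)))) \<longlonglongrightarrow> G t" for t
    unfolding G_def
  proof (rule integral_dominated_convergence[OF _ _ in'])
    show "AE x in lborel. (\<lambda>n. exp (- x\<^sup>2 / (2 * (s n)\<^sup>2)) *\<^sub>R (path_ft w x y * cis (2*pi*t * x))) \<longlonglongrightarrow> path_ft w x y * cis (2*pi*t * x)"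
    proof (intro always_eventually allI)
      fix x
      have "filterlim (\<lambda>n. 2 * (s n)\<^sup>2) at_infinity sequentially"
        by (intro filterlim_at_top_imp_at_infinity filterlim_tendsto_pos_mult_at_top[OF tendsto_const]
            filterlim_pow_at_top sinf) auto
      then have "(\<lambda>n. - x\<^sup>2 / (2 * (s n)\<^sup>2)) \<longlonglongrightarrow> 0" by (intro tendsto_divide_0[OF tendsto_const])
      then have "(\<lambda>n. exp (- x\<^sup>2 / (2 * (s n)\<^sup>2))) \<longlonglongrightarrow> exp 0" by (rule tendsto_exp)
      then have "(\<lambda>n. exp (- x\<^sup>2 / (2 * (s n)\<^sup>2)) *\<^sub>R (path_ft w x y * cis (2*pi*t * x))) \<longlonglongrightarrow> exp (0::real) *\<^sub>R (path_ft w x y * cis (2*pi*t * x))"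
        by (intro tendsto_scaleR tendsto_const)
      then show "(\<lambda>n. exp (- x\<^sup>2 / (2 * (s n)\<^sup>2)) *\<^sub>R (path_ft w x y * cis (2*pi*t * x))) \<longlonglongrightarrow> path_ft w x y * cis (2*pi*t * x)" by simp
    qed
    show "AE x in lborel. norm (exp (- x\<^sup>2 / (2 * (s n)\<^sup>2)) *\<^sub>R (path_ft w x y * cis (2*pi*t * x))) \<le> norm (path_ft w x y)" for n
      by (intro always_eventually allI) (simp add: norm_mult mult_left_le_one_le)
  qed measurable
  \<comment> \<open>The function on [0, 1] extended by 0. The Gaussian averages converge to it
    wherever it is continuous, hence the inversion integral \<open>G\<close> agrees with it
    there.\<close>
  define H where "H t = indicator {0..1} t *\<^sub>R cis (- (2*pi*y * w t))" for t
  have lim2: "(\<lambda>n. (LINT z|lborel. std_normal_density z *\<^sub>R H (t + z / (2*pi * s n)))) \<longlonglongrightarrow> H t"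
    if t: "isCont H t" for t
  proof -
    have "(\<lambda>n. (LINT z|lborel. std_normal_density z *\<^sub>R H (t + z / (2*pi * s n)))) \<longlonglongrightarrow> (LINT z|lborel. std_normal_density z *\<^sub>R H t)"
    proof (rule integral_dominated_convergence[where w=std_normal_density])
      show "AE z in lborel. (\<lambda>n. std_normal_density z *\<^sub>R H (t + z / (2*pi * s n))) \<longlonglongrightarrow> std_normal_density z *\<^sub>R H t"
      proof (intro always_eventually allI tendsto_scaleR tendsto_const isCont_tendsto_compose[OF t])
        fix z
        have "filterlim (\<lambda>n. 2*pi * s n) at_infinity sequentially"
          by (intro filterlim_at_top_imp_at_infinity filterlim_tendsto_pos_mult_at_top[OF tendsto_const] sinf) auto
        then have "(\<lambda>n. z / (2*pi * s n)) \<longlonglongrightarrow> 0" by (intro tendsto_divide_0[OF tendsto_const])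
        then have "(\<lambda>n. t + z / (2*pi * s n)) \<longlonglongrightarrow> t + 0" by (intro tendsto_add tendsto_const)
        then show "(\<lambda>n. t + z / (2*pi * s n)) \<longlonglongrightarrow> t" by simp
      qed
      show "AE z in lborel. norm (std_normal_density z *\<^sub>R H (t + z / (2*pi * s n))) \<le> std_normal_density z" for n
        by (intro always_eventually allI) (auto simp: H_def indicator_def)
      show "integrable lborel std_normal_density" by simp
    qed (auto simp: H_def)
    moreover have "(LINT z|lborel. std_normal_density z *\<^sub>R H t) = H t" by simp
    ultimately show ?thesis by simp
  qed
  have GH: "G t = H t" if "isCont H t" for t
    using LIMSEQ_unique[OF lim1[of t]] lim2[OF that] gauss_sum_path_ft[OF w s0, of _ y t] unfolding H_def by simp
  have c1: "isCont H t" if "t \<in> {0<..<1}" for t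
  proof -
    have "continuous_on {0<..<1} H"
    proof (rule continuous_on_eq)
      show "continuous_on {0<..<1} (\<lambda>t. cis (- (2*pi*y * w t)))"
        by (intro continuous_intros continuous_on_cis continuous_on_subset[OF w]) auto
    qed (auto simp: H_def)
    then show ?thesis using that by (simp add: continuous_on_eq_continuous_at)
  qed
  have c2: "isCont H t" if "t < 0" for t
  proof -
    have "continuous_on {..<0} H" by (rule continuous_on_eq[OF continuous_on_const[of _ 0]]) (auto simp: H_def)
    then show ?thesis using that by (simp add: continuous_on_eq_continuous_at)
  qed
  \<comment> \<open>Dominated convergence by the assumed integrable transform makes \<open>G\<close>
    continuous at 0.\<close>
  have Gc: "(\<lambda>n. G (r n)) \<longlonglongrightarrow> G 0" if r: "r \<longlonglongrightarrow> 0" for r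
    unfolding G_def
  proof (rule integral_dominated_convergence[OF _ _ in'])
    show "AE x in lborel. (\<lambda>n. path_ft w x y * cis (2*pi*r n * x)) \<longlonglongrightarrow> path_ft w x y * cis (2*pi*0 * x)"
    proof (intro always_eventually allI tendsto_mult tendsto_const)
      fix x
      have "isCont cis (2*pi*0*x)"
        using continuous_on_cis[OF continuous_on_id, of UNIV] by (simp add: continuous_on_eq_continuous_at)
      then show "(\<lambda>n. cis (2*pi*r n * x)) \<longlonglongrightarrow> cis (2*pi*0 * x)"
        by (rule isCont_tendsto_compose) (intro tendsto_intros r)
    qed
    show "AE x in lborel. norm (path_ft w x y * cis (2*pi*r n * x)) \<le> norm (path_ft w x y)" for n
      by (simp add: norm_mult)
  qed measurable
  \<comment> \<open>Positive points that stay inside (0, 1): along them |G| = 1, along their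
    negatives G = 0, and continuity at 0 is contradicted.\<close>
  define r where "r n = 1 / real (Suc (Suc n))" for n
  have r: "r \<longlonglongrightarrow> 0" unfolding r_def by (rule LIMSEQ_Suc[OF LIMSEQ_Suc[OF lim_1_over_n]])
  have rr: "r n \<in> {0<..<1}" for n by (simp add: r_def)
  have "norm (G (r n)) = 1" for n
    using GH[OF c1[OF rr[of n]]] rr[of n] by (simp add: H_def)
  then have "(\<lambda>n. 1) \<longlonglongrightarrow> norm (G 0)" using tendsto_norm[OF Gc[OF r]] by simp
  then have "norm (G 0) = 1" by (simp add: LIMSEQ_const_iff)
  moreover have "G 0 = 0"
  proof -
    have "G (- r n) = 0" for n using GH[OF c2[of "- r n"]] rr[of n] by (simp add: H_def)
    moreover have "(\<lambda>n. G (- r n)) \<longlonglongrightarrow> G 0" by (rule Gc) (use tendsto_minus[OF r] in simp)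
    ultimately show ?thesis by (simp add: LIMSEQ_const_iff)
  qed
  ultimately show False by simp
qed

text \<open>Otherwise the transform would be integrable: it is either below the integrable function
  |x|^(-r), or so large that it is below its own power times the weight.\<close>

lemma nn_integral_path_ft_powr_infinite:
  assumes w: "continuous_on UNIV w" and p: "1 \<le> p" and b: "2 * p - 1 < b"
  shows "(\<integral>\<^sup>+x. ennreal (norm (path_ft w x y) powr (2 * p) * \<bar>x\<bar> powr b) \<partial>lborel) = \<infinity>"
proof (rule ccontr)
  assume "\<not> ?thesis"
  then have fin: "(\<integral>\<^sup>+x. ennreal (norm (path_ft w x y) powr (2 * p) * \<bar>x\<bar> powr b) \<partial>lborel) < \<infinity>"
    by (simp add: less_top)
  have Fm[measurable]: "(\<lambda>x. path_ft w x y) \<in> borel_measurable borel"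
    by (rule borel_measurable_continuous_onI[OF continuous_path_ft_fst[OF w]])
  \<comment> \<open>With r (2 p - 1) = b, the inequality |F| > |x|^(-r) gives 1 <= |F|^(2p-1) |x|^b;
    the assumption on \<open>b\<close> says exactly that r > 1.\<close>
  define r where "r = b / (2 * p - 1)"
  have p1: "0 < 2 * p - 1" using p by simp
  have r: "1 < r" using b p1 by (simp add: r_def)
  have pw: "norm (path_ft w x y) \<le> two_power 0 r x + norm (path_ft w x y) powr (2 * p) * \<bar>x\<bar> powr b" if x0: "x \<noteq> 0" for x
  proof (cases "\<bar>x\<bar> \<le> 1 \<or> norm (path_ft w x y) \<le> \<bar>x\<bar> powr (- r)")
    case True
    then have "norm (path_ft w x y) \<le> two_power 0 r x" using x0 norm_path_ft_le[of w x y] by (auto simp: two_power_def)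
    then show ?thesis by (simp add: add_increasing2)
  next
    case False
    define f where "f = norm (path_ft w x y)"
    have x: "1 < \<bar>x\<bar>" and f: "\<bar>x\<bar> powr (- r) < f" using False by (auto simp: f_def)
    have f0: "0 < f" using f by (smt (verit) powr_ge_zero)
    have "(\<bar>x\<bar> powr (- r)) powr (2 * p - 1) \<le> f powr (2 * p - 1)"
      using f p1 by (intro powr_mono2) auto
    also have "(\<bar>x\<bar> powr (- r)) powr (2 * p - 1) = \<bar>x\<bar> powr (- b)"
      using p1 by (simp add: powr_powr r_def)
    finally have "\<bar>x\<bar> powr (- b) * \<bar>x\<bar> powr b \<le> f powr (2 * p - 1) * \<bar>x\<bar> powr b" by (intro mult_right_mono) auto
    then have "1 \<le> f powr (2 * p - 1) * \<bar>x\<bar> powr b" using x by (auto simp: powr_add[symmetric] split: if_splits)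
    then have "f * 1 \<le> f * (f powr (2 * p - 1) * \<bar>x\<bar> powr b)" using f0 by (intro mult_left_mono) auto
    also have "\<dots> = f powr (2 * p) * \<bar>x\<bar> powr b"
      using powr_add[of f 1 "2 * p - 1"] f0 by simp
    finally show ?thesis using two_power_nonneg[of 0 r x] by (simp add: f_def)
  qed
  have "(\<integral>\<^sup>+x. ennreal (norm (path_ft w x y)) \<partial>lborel) \<le> (\<integral>\<^sup>+x. ennreal (two_power 0 r x) + ennreal (norm (path_ft w x y) powr (2 * p) * \<bar>x\<bar> powr b) \<partial>lborel)"
  proof (rule nn_integral_mono_AE, use AE_lborel_singleton[of "0::real"] in eventually_elim)
    fix x :: real assume "x \<noteq> 0"
    then show "ennreal (norm (path_ft w x y)) \<le> ennreal (two_power 0 r x) + ennreal (norm (path_ft w x y) powr (2 * p) * \<bar>x\<bar> powr b)"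
      using pw[of x] two_power_nonneg[of 0 r x] by (simp add: ennreal_plus[symmetric] ennreal_leI del: ennreal_plus)
  qed
  also have "\<dots> = (\<integral>\<^sup>+x. ennreal (two_power 0 r x) \<partial>lborel) + (\<integral>\<^sup>+x. ennreal (norm (path_ft w x y) powr (2 * p) * \<bar>x\<bar> powr b) \<partial>lborel)"
    by (rule nn_integral_add) measurable
  also have "\<dots> < \<infinity>" using nn_integral_two_power_finite[of 0 r] r fin by simp
  finally have "integrable lborel (\<lambda>x. path_ft w x y)" by (intro integrableI_bounded) auto
  then show False using not_integrable_path_ft[OF w] by simp
qed

section \<open>The transform of the sheet\<close>

definition sheet_ft :: "('k::finite \<Rightarrow> real \<Rightarrow> real) \<Rightarrow> (real ^ 'k) \<times> real \<Rightarrow> complex" where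
  "sheet_ft w \<zeta> = (\<Prod>i\<in>UNIV. path_ft (w i) (fst \<zeta> $ i) (snd \<zeta>))"

lemma indicator_cbox_vec:
  "indicator (cbox 0 1) t = (\<Prod>i\<in>UNIV. indicator {0..1} (t $ i) :: real)" for t :: "real ^ 'k::finite"
proof (cases "t \<in> cbox 0 1")
  case True
  then show ?thesis by (simp add: mem_box_cart)
next
  case False
  then obtain i where "t $ i \<notin> {0..1}" by (auto simp: mem_box_cart)
  then have "(\<Prod>i\<in>UNIV. indicator {0..1} (t $ i) :: real) = 0" by (intro prod_zero bexI[of _ i]) auto
  then show ?thesis using False by simp
qed

lemma fourier_transform_sheet:
  fixes w :: "'k::finite \<Rightarrow> real \<Rightarrow> real"
  assumes w: "\<And>i. continuous_on UNIV (w i)"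
  shows "fourier_transform (surface_measure (\<lambda>t. \<Sum>i\<in>UNIV. w i (t $ i))) = sheet_ft w"
proof
  fix \<zeta> :: "(real ^ 'k) \<times> real"
  obtain \<xi> y where \<zeta>: "\<zeta> = (\<xi>, y)" by (cases \<zeta>)
  define W where "W t = (\<Sum>i\<in>UNIV. w i (t $ i))" for t :: "real ^ 'k"
  have Wc: "continuous_on UNIV W"
    unfolding W_def by (intro continuous_on_sum continuous_on_compose2[OF w] continuous_intros) auto
  have gm: "(\<lambda>t. (t, W t)) \<in> borel_measurable (borel :: (real ^ 'k) measure)"
    by (intro borel_measurable_continuous_onI continuous_intros Wc)
  have em: "(\<lambda>x. exp (- 2 * of_real pi * \<i> * of_real (\<zeta> \<bullet> x))) \<in> borel_measurable borel"
    by (intro borel_measurable_continuous_onI continuous_intros)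
  define f where "f i t = indicator {0..1} t *\<^sub>R cis (- (2*pi*(\<xi> $ i * t + y * w i t)))" for i t
  have fi: "integrable lborel (f i)" for i
  proof -
    have "continuous_on UNIV (\<lambda>t. cis (- (2*pi*(\<xi> $ i * t + y * w i t))))"
      by (intro continuous_intros continuous_on_cis w)
    then have "set_integrable lborel {0..1} (\<lambda>t. cis (- (2*pi*(\<xi> $ i * t + y * w i t))))"
      by (rule set_integrable_continuous_bounded[of _ _ 0 1]) auto
    then show ?thesis by (simp add: set_integrable_def f_def[abs_def])
  qed
  have e: "indicator (cbox 0 1) t *\<^sub>R exp (- 2 * of_real pi * \<i> * of_real (\<zeta> \<bullet> (t, W t))) = (\<Prod>i\<in>UNIV. f i (t $ i))" for t
  proof -
    have "(\<Prod>i\<in>UNIV. f i (t $ i)) = (\<Prod>i\<in>UNIV. indicator {0..1} (t $ i)) *\<^sub>R (\<Prod>i\<in>UNIV. cis (- (2*pi*(\<xi> $ i * (t $ i) + y * w i (t $ i)))))"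
      unfolding f_def by (simp add: scaleR_conv_of_real prod.distrib)
    also have "(\<Prod>i\<in>UNIV. cis (- (2*pi*(\<xi> $ i * (t $ i) + y * w i (t $ i))))) = cis (\<Sum>i\<in>UNIV. - (2*pi*(\<xi> $ i * (t $ i) + y * w i (t $ i))))"
      by (simp add: cis_conv_exp exp_sum sum_distrib_left)
    also have "(\<Sum>i\<in>UNIV. - (2*pi*(\<xi> $ i * (t $ i) + y * w i (t $ i)))) = - (2*pi*(\<zeta> \<bullet> (t, W t)))"
    proof -
      have "(\<Sum>i\<in>UNIV. \<xi> $ i * (t $ i) + y * w i (t $ i)) = \<zeta> \<bullet> (t, W t)"
        by (simp add: \<zeta> W_def inner_vec_def sum.distrib sum_distrib_left)
      then show ?thesis by (simp only: sum_negf sum_distrib_left[symmetric])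
    qed
    also have "cis \<dots> = exp (- 2 * of_real pi * \<i> * of_real (\<zeta> \<bullet> (t, W t)))"
      by (simp add: cis_conv_exp mult_ac)
    finally show ?thesis by (simp add: indicator_cbox_vec)
  qed
  have "fourier_transform (surface_measure W) \<zeta>
      = (LINT t|restrict_space lborel (cbox 0 1). exp (- 2 * of_real pi * \<i> * of_real (\<zeta> \<bullet> (t, W t))))"
    unfolding fourier_transform_def surface_measure_def
  proof (rule integral_distr)
    show "(\<lambda>t. (t, W t)) \<in> restrict_space lborel (cbox 0 1) \<rightarrow>\<^sub>M borel"
      using gm by (intro measurable_restrict_space1) simp
  qed (rule em)
  also have "\<dots> = (LINT t|lborel. indicator (cbox 0 1) t *\<^sub>R exp (- 2 * of_real pi * \<i> * of_real (\<zeta> \<bullet> (t, W t))))"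
    by (rule integral_restrict_space) simp
  also have "\<dots> = (LINT t|lborel. (\<Prod>i\<in>UNIV. f i (t $ i)))" unfolding e ..
  also have "\<dots> = (\<Prod>i\<in>UNIV. LINT t|lborel. f i t)" by (rule integral_lborel_vec_prod[OF fi])
  also have "\<dots> = sheet_ft w \<zeta>"
    by (simp add: sheet_ft_def \<zeta> f_def path_ft_def set_lebesgue_integral_def)
  finally show "fourier_transform (surface_measure (\<lambda>t. \<Sum>i\<in>UNIV. w i (t $ i))) \<zeta> = sheet_ft w \<zeta>"
    unfolding W_def .
qed

lemma norm_sheet_ft_le: "norm (sheet_ft w \<zeta>) \<le> 1"
  unfolding sheet_ft_def prod_norm[symmetric] by (intro prod_le_1) (auto simp: norm_path_ft_le)

lemma continuous_sheet_ft:
  fixes w :: "'k::finite \<Rightarrow> real \<Rightarrow> real"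
  assumes w: "\<And>i. continuous_on UNIV (w i)"
  shows "continuous_on UNIV (sheet_ft w)"
proof -
  have "continuous_on UNIV (\<lambda>\<zeta> :: (real ^ 'k) \<times> real. path_ft (w i) (fst \<zeta> $ i) (snd \<zeta>))" for i
    using continuous_on_compose2[OF continuous_path_ft[OF w[of i]], of UNIV "\<lambda>\<zeta> :: (real ^ 'k) \<times> real. (fst \<zeta> $ i, snd \<zeta>)"]
    by (simp add: continuous_intros)
  then show ?thesis unfolding sheet_ft_def[abs_def] by (intro continuous_on_prod)
qed

lemma measurable_sheet_ft:
  "(\<And>i. continuous_on UNIV (w i)) \<Longrightarrow> sheet_ft w \<in> borel_measurable borel"
  by (intro borel_measurable_continuous_onI continuous_sheet_ft)

section \<open>Integrability from coordinatewise decay\<close>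

lemma AE_inner_Basis_nonzero: "AE \<zeta> in (lborel :: 'a::euclidean_space measure). \<forall>b\<in>Basis. \<zeta> \<bullet> b \<noteq> 0"
proof (rule AE_finite_allI)
  fix b :: 'a assume b: "b \<in> Basis"
  have "closed {x. x \<bullet> b = 0}" by (intro closed_Collect_eq continuous_intros)
  then have "{x. x \<bullet> b = 0} \<in> sets lborel" by simp
  moreover have "{x. x \<bullet> b = 0} \<in> null_sets lebesgue"
    using negligible_standard_hyperplane[OF b] by (simp add: negligible_iff_null_sets)
  ultimately have "{x. x \<bullet> b = 0} \<in> null_sets lborel" by (simp add: null_sets_completion_iff)
  then show "AE \<zeta> in lborel. \<zeta> \<bullet> b \<noteq> 0" by (rule AE_I'[THEN AE_mp]) auto
qed simp

text \<open>In Isabelle \<open>0 powr - a = 0\<close>, so \<open>two_power\<close> is a majorant only off the coordinate hyperplanes.\<close>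

lemma nn_integral_finite_of_decay:
  fixes g :: "'a::euclidean_space \<Rightarrow> real"
  assumes b: "- real DIM('a) < b" and \<delta>: "0 < \<delta>"
    and small: "\<And>\<zeta>. norm \<zeta> \<le> 1 \<Longrightarrow> g \<zeta> \<le> norm \<zeta> powr b"
    and large: "\<And>\<zeta>. 1 < norm \<zeta> \<Longrightarrow> g \<zeta> \<le> C * (\<Prod>u\<in>Basis. (1 + \<bar>\<zeta> \<bullet> u\<bar>) powr (- (1 + \<delta>)))"
  shows "(\<integral>\<^sup>+\<zeta>. ennreal (g \<zeta>) \<partial>lborel) < \<infinity>"
proof -
  \<comment> \<open>The singularity at the origin is shared equally among the coordinates: no
    coordinate exceeds the norm, so the norm to the power -a is at most |coordinate|^(-a) for each.
    The lower bound on \<open>b\<close> makes a < 1.\<close>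
  define a where "a = max 0 (- b) / real DIM('a)"
  have D: "0 < real DIM('a)" by simp
  have a: "0 \<le> a" "a < 1" using b D by (auto simp: a_def)
  define K where "K = max 1 C"
  define T where "T \<zeta> = (\<Prod>u\<in>Basis. two_power a (1 + \<delta>) (\<zeta> \<bullet> u))" for \<zeta> :: 'a
  have T0: "0 \<le> T \<zeta>" for \<zeta> unfolding T_def by (intro prod_nonneg) (simp add: two_power_nonneg)
  have pw: "g \<zeta> \<le> K * T \<zeta>" if nz: "\<forall>u\<in>Basis. \<zeta> \<bullet> u \<noteq> 0" for \<zeta>
  proof (cases "norm \<zeta> \<le> 1")
    case True
    have n0: "0 < norm \<zeta>" using nz SOME_Basis by force
    have "norm \<zeta> powr b \<le> norm \<zeta> powr (- a * real DIM('a))"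
      using True n0 by (intro powr_mono') (auto simp: a_def)
    also have "\<dots> = (\<Prod>u\<in>(Basis :: 'a set). norm \<zeta> powr (- a))"
    proof -
      have "(norm \<zeta> powr (- a)) ^ DIM('a) = (norm \<zeta> powr (- a)) powr real DIM('a)"
        using n0 by (intro powr_realpow[symmetric]) simp
      then show ?thesis by (simp add: powr_powr)
    qed
    also have "\<dots> \<le> T \<zeta>" unfolding T_def
    proof (intro prod_mono conjI)
      fix u :: 'a assume u: "u \<in> Basis"
      have l: "\<bar>\<zeta> \<bullet> u\<bar> \<le> norm \<zeta>" by (rule Basis_le_norm[OF u])
      have p: "0 < \<bar>\<zeta> \<bullet> u\<bar>" using nz u by simp
      have "norm \<zeta> powr (- a) \<le> \<bar>\<zeta> \<bullet> u\<bar> powr (- a)" using l p a by (intro powr_mono2') auto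
      then show "norm \<zeta> powr (- a) \<le> two_power a (1 + \<delta>) (\<zeta> \<bullet> u)" using l True by (simp add: two_power_def)
    qed simp
    finally have "g \<zeta> \<le> T \<zeta>" using small[OF True] by linarith
    also have "\<dots> \<le> K * T \<zeta>" using T0[of \<zeta>] mult_right_mono[of 1 K "T \<zeta>"] by (simp add: K_def)
    finally show ?thesis .
  next
    case False
    have P: "(\<Prod>u\<in>Basis. (1 + \<bar>\<zeta> \<bullet> u\<bar>) powr (- (1 + \<delta>))) \<le> T \<zeta>" unfolding T_def
    proof (intro prod_mono conjI)
      fix u :: 'a assume u: "u \<in> Basis"
      have p: "0 < \<bar>\<zeta> \<bullet> u\<bar>" using nz u by simp
      show "(1 + \<bar>\<zeta> \<bullet> u\<bar>) powr (- (1 + \<delta>)) \<le> two_power a (1 + \<delta>) (\<zeta> \<bullet> u)"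
      proof (cases "\<bar>\<zeta> \<bullet> u\<bar> \<le> 1")
        case True
        have "(1 + \<bar>\<zeta> \<bullet> u\<bar>) powr (- (1 + \<delta>)) \<le> 1 powr (- (1 + \<delta>))" using \<delta> by (intro powr_mono2') auto
        also have "\<dots> = 1 powr (- a)" by simp
        also have "\<dots> \<le> \<bar>\<zeta> \<bullet> u\<bar> powr (- a)" using True p a by (intro powr_mono2') auto
        finally show ?thesis using True by (simp add: two_power_def)
      next
        case False
        then show ?thesis using \<delta> p by (simp add: two_power_def powr_mono2')
      qed
    qed simp
    have P0: "0 \<le> (\<Prod>u\<in>Basis. (1 + \<bar>\<zeta> \<bullet> u\<bar>) powr (- (1 + \<delta>)))" by (intro prod_nonneg) simp
    have "g \<zeta> \<le> C * (\<Prod>u\<in>Basis. (1 + \<bar>\<zeta> \<bullet> u\<bar>) powr (- (1 + \<delta>)))" using large False by simp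
    also have "\<dots> \<le> K * (\<Prod>u\<in>Basis. (1 + \<bar>\<zeta> \<bullet> u\<bar>) powr (- (1 + \<delta>)))" using P0 by (intro mult_right_mono) (auto simp: K_def)
    also have "\<dots> \<le> K * T \<zeta>" using P by (intro mult_left_mono) (auto simp: K_def)
    finally show ?thesis .
  qed
  have "(\<integral>\<^sup>+\<zeta>. ennreal (g \<zeta>) \<partial>lborel) \<le> (\<integral>\<^sup>+\<zeta>. ennreal K * (\<Prod>u\<in>Basis. ennreal (two_power a (1 + \<delta>) (\<zeta> \<bullet> u))) \<partial>(lborel :: 'a measure))"
  proof (rule nn_integral_mono_AE)
    show "AE \<zeta> in lborel. ennreal (g \<zeta>) \<le> ennreal K * (\<Prod>u\<in>Basis. ennreal (two_power a (1 + \<delta>) (\<zeta> \<bullet> u)))"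
      using AE_inner_Basis_nonzero
    proof eventually_elim
      case (elim \<zeta>)
      then have "ennreal (g \<zeta>) \<le> ennreal (K * T \<zeta>)" by (intro ennreal_leI pw)
      also have "\<dots> = ennreal K * (\<Prod>u\<in>Basis. ennreal (two_power a (1 + \<delta>) (\<zeta> \<bullet> u)))"
        by (simp add: ennreal_mult' K_def T_def prod_ennreal two_power_nonneg prod_nonneg ennreal_mult'')
      finally show ?case .
    qed
  qed
  also have "\<dots> = ennreal K * (\<integral>\<^sup>+\<zeta>. (\<Prod>u\<in>Basis. ennreal (two_power a (1 + \<delta>) (\<zeta> \<bullet> u))) \<partial>(lborel :: 'a measure))"
    by (rule nn_integral_cmult) measurable
  also have "(\<integral>\<^sup>+\<zeta>. (\<Prod>u\<in>Basis. ennreal (two_power a (1 + \<delta>) (\<zeta> \<bullet> u))) \<partial>(lborel :: 'a measure)) = (\<Prod>u\<in>(Basis :: 'a set). (\<integral>\<^sup>+x. ennreal (two_power a (1 + \<delta>) x) \<partial>lborel))"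
    by (rule nn_integral_lborel_prod) auto
  also have "ennreal K * \<dots> < \<infinity>"
    using nn_integral_two_power_finite[of a "1 + \<delta>"] a \<delta>
    by (simp add: ennreal_mult_less_top power_less_top_ennreal)
  finally show ?thesis .
qed

definition spread :: "real \<Rightarrow> real" where "spread y = 1 + y\<^sup>2"

lemma spread_ge_1: "1 \<le> spread y" by (simp add: spread_def)

lemma spread_ge: "(1 + \<bar>y\<bar>)\<^sup>2 \<le> 2 * spread y"
  using power2_add_le[of 1 "\<bar>y\<bar>"] by (simp add: spread_def)

lemma one_plus_abs_le_spread: "1 + \<bar>y\<bar> \<le> 2 * spread y"
proof -
  have "(1 + \<bar>y\<bar>) * 1 \<le> (1 + \<bar>y\<bar>) * (1 + \<bar>y\<bar>)" by (intro mult_left_mono) auto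
  then show ?thesis using spread_ge[of y] by (simp add: power2_eq_square)
qed

text \<open>With B = \<open>spread y\<close> and A = max(|x|, B), \<open>decay\<close> to the power
  p is B^(-p) (B / A)^(2p). As B / A <= 1, the exponent 2p may be lowered to any
  \<open>\<gamma>\<close>, which trades decay in \<open>x\<close> for decay in \<open>y\<close>. The
  constant is uniform in \<open>\<gamma>\<close>, so each coordinate may choose its own
  exponent.\<close>

lemma path_ft_powr_le:
  assumes sup: "\<And>\<epsilon>. 0 < \<epsilon> \<Longrightarrow> \<exists>K>0. \<forall>x y. (norm (path_ft w x y))\<^sup>2 \<le> K * decay x y * (1 + \<bar>x\<bar> + \<bar>y\<bar>) powr \<epsilon>"
    and p: "0 < p" and \<delta>: "0 < \<delta>"
  obtains K where "0 < K"
    "\<And>\<gamma> x y. 0 \<le> \<gamma> \<Longrightarrow> \<gamma> \<le> 2 * p \<Longrightarrow>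
      norm (path_ft w x y) powr (2 * p) \<le> K * spread y powr (\<gamma> - p + \<delta>) * (1 + \<bar>x\<bar>) powr (- \<gamma> + \<delta>)"
proof -
  \<comment> \<open>The loss delta / p becomes delta after raising to the power
    \<open>p\<close>.\<close>
  obtain K where K: "0 < K" "\<And>x y. (norm (path_ft w x y))\<^sup>2 \<le> K * decay x y * (1 + \<bar>x\<bar> + \<bar>y\<bar>) powr (\<delta> / p)"
    using sup[of "\<delta> / p"] p \<delta> by auto
  define K' where "K' = K powr p * (2 powr (2 * p) * 2 powr \<delta>)"
  show ?thesis
  proof
    show "0 < K'" using K(1) by (simp add: K'_def)
    fix \<gamma> x y :: real assume \<gamma>: "0 \<le> \<gamma>" "\<gamma> \<le> 2 * p"
    define B where "B = spread y"
    define A where "A = max \<bar>x\<bar> B"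
    have B: "1 \<le> B" unfolding B_def by (rule spread_ge_1)
    have A: "1 \<le> A" "B \<le> A" "\<bar>x\<bar> \<le> A" using B by (auto simp: A_def)
    have d: "decay x y = B / A\<^sup>2" by (simp add: decay_def A_def B_def spread_def)
    have "norm (path_ft w x y) powr (2 * p) = ((norm (path_ft w x y))\<^sup>2) powr p"
    proof (cases "norm (path_ft w x y) = 0")
      case False
      then have "(norm (path_ft w x y))\<^sup>2 = norm (path_ft w x y) powr 2" by simp
      then show ?thesis by (simp only: powr_powr)
    qed (use p in simp)
    also have "\<dots> \<le> (K * decay x y * (1 + \<bar>x\<bar> + \<bar>y\<bar>) powr (\<delta> / p)) powr p"
      using p by (intro powr_mono2 K(2)) auto
    also have "\<dots> = K powr p * (decay x y powr p * (1 + \<bar>x\<bar> + \<bar>y\<bar>) powr \<delta>)"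
      using p by (simp add: powr_mult powr_powr)
    also have "\<dots> \<le> K powr p * ((2 powr (2 * p) * B powr (\<gamma> - p) * (1 + \<bar>x\<bar>) powr (- \<gamma>)) * (2 powr \<delta> * (B powr \<delta> * (1 + \<bar>x\<bar>) powr \<delta>)))"
    proof (intro mult_left_mono mult_mono)
      have "decay x y = (1 / B) * (B / A)\<^sup>2" using A B by (simp add: d power2_eq_square)
      also have "(B / A)\<^sup>2 = (B / A) powr 2" using A B by simp
      finally have "decay x y powr p = (1 / B) powr p * ((B / A) powr 2) powr p" by (simp only: powr_mult)
      also have "\<dots> = B powr (- p) * (B / A) powr (2 * p)" unfolding powr_powr using B by (simp add: powr_divide powr_minus_divide)
      also have "\<dots> \<le> B powr (- p) * (B / A) powr \<gamma>"
        using A B \<gamma> by (intro mult_left_mono powr_mono') auto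
      also have "\<dots> \<le> B powr (- p) * (2 * (B * (1 / (1 + \<bar>x\<bar>)))) powr \<gamma>"
      proof (intro mult_left_mono powr_mono2)
        have "1 + \<bar>x\<bar> \<le> 2 * A" using A by linarith
        then have "1 / A \<le> 2 / (1 + \<bar>x\<bar>)" using A by (simp add: field_simps add_pos_nonneg)
        then have "B * (1 / A) \<le> B * (2 / (1 + \<bar>x\<bar>))" using B by (intro mult_left_mono) auto
        then show "B / A \<le> 2 * (B * (1 / (1 + \<bar>x\<bar>)))" by (simp add: mult.commute)
      qed (use A B \<gamma> in auto)
      also have "\<dots> = 2 powr \<gamma> * (B powr (- p) * B powr \<gamma>) * (1 / (1 + \<bar>x\<bar>)) powr \<gamma>"
        by (simp only: powr_mult mult_ac)
      also have "B powr (- p) * B powr \<gamma> = B powr (\<gamma> - p)" by (simp add: powr_add[symmetric])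
      also have "(1 / (1 + \<bar>x\<bar>)) powr \<gamma> = (1 + \<bar>x\<bar>) powr (- \<gamma>)" by (simp add: powr_divide powr_minus_divide)
      also have "2 powr \<gamma> * B powr (\<gamma> - p) * (1 + \<bar>x\<bar>) powr (- \<gamma>) \<le> 2 powr (2 * p) * B powr (\<gamma> - p) * (1 + \<bar>x\<bar>) powr (- \<gamma>)"
        using \<gamma> by (intro mult_right_mono powr_mono) auto
      finally show "decay x y powr p \<le> 2 powr (2 * p) * B powr (\<gamma> - p) * (1 + \<bar>x\<bar>) powr (- \<gamma>)" .
      have "1 + \<bar>x\<bar> + \<bar>y\<bar> \<le> (1 + \<bar>x\<bar>) * (1 + \<bar>y\<bar>)" by (simp add: algebra_simps)
      also have "\<dots> \<le> (1 + \<bar>x\<bar>) * (2 * B)" unfolding B_def by (intro mult_left_mono one_plus_abs_le_spread) auto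
      finally have "(1 + \<bar>x\<bar> + \<bar>y\<bar>) powr \<delta> \<le> ((1 + \<bar>x\<bar>) * (2 * B)) powr \<delta>" using \<delta> by (intro powr_mono2) auto
      also have "\<dots> = 2 powr \<delta> * (B powr \<delta> * (1 + \<bar>x\<bar>) powr \<delta>)" by (simp only: powr_mult mult_ac)
      finally show "(1 + \<bar>x\<bar> + \<bar>y\<bar>) powr \<delta> \<le> 2 powr \<delta> * (B powr \<delta> * (1 + \<bar>x\<bar>) powr \<delta>)" .
    qed auto
    also have "\<dots> = K' * (B powr (\<gamma> - p) * B powr \<delta>) * ((1 + \<bar>x\<bar>) powr (- \<gamma>) * (1 + \<bar>x\<bar>) powr \<delta>)"
      by (simp only: K'_def mult_ac)
    also have "\<dots> = K' * B powr (\<gamma> - p + \<delta>) * (1 + \<bar>x\<bar>) powr (- \<gamma> + \<delta>)"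
      by (simp only: powr_add)
    finally show "norm (path_ft w x y) powr (2 * p) \<le> K' * spread y powr (\<gamma> - p + \<delta>) * (1 + \<bar>x\<bar>) powr (- \<gamma> + \<delta>)"
      by (simp only: B_def)
  qed
qed

text \<open>For b >= 0 the largest coordinate dominates the norm up to a constant. For b < 0 any
  single coordinate will do, because the norm is at least 1 and hence at least half of 1 plus that
  coordinate.\<close>

lemma norm_powr_le_coordinates:
  fixes \<zeta> :: "(real ^ 'k::finite) \<times> real"
  assumes n: "1 \<le> norm \<zeta>"
  shows "norm \<zeta> powr b \<le> (real CARD('k) + 2) powr \<bar>b\<bar> *
    ((\<Sum>i\<in>UNIV. (1 + \<bar>fst \<zeta> $ i\<bar>) powr b) + (if 0 \<le> b then (1 + \<bar>snd \<zeta>\<bar>) powr b else 0))"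
proof -
  let ?k = "real CARD('k)"
  let ?S = "\<Sum>i\<in>UNIV. (1 + \<bar>fst \<zeta> $ i\<bar>) powr b"
  have comp: "(1 + \<bar>fst \<zeta> $ i\<bar>) powr b \<le> ?S" for i
    by (rule member_le_sum[where f="\<lambda>i. (1 + \<bar>fst \<zeta> $ i\<bar>) powr b"]) auto
  show ?thesis
  proof (cases "0 \<le> b")
    case True
    define m where "m = Max (insert \<bar>snd \<zeta>\<bar> (range (\<lambda>i. \<bar>fst \<zeta> $ i\<bar>)))"
    have fin: "finite (insert \<bar>snd \<zeta>\<bar> (range (\<lambda>i. \<bar>fst \<zeta> $ i\<bar>)))" by simp
    have mi: "\<bar>fst \<zeta> $ i\<bar> \<le> m" "\<bar>snd \<zeta>\<bar> \<le> m" for i unfolding m_def by (rule Max_ge[OF fin]; simp)+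
    have m_in: "m = \<bar>snd \<zeta>\<bar> \<or> (\<exists>i. m = \<bar>fst \<zeta> $ i\<bar>)" using Max_in[OF fin] unfolding m_def[symmetric] by auto
    have m0: "0 \<le> m" using mi(2) by linarith
    have "norm \<zeta> \<le> norm (fst \<zeta>) + norm (snd \<zeta>)" by (metis norm_Pair_le prod.collapse)
    also have "norm (fst \<zeta>) \<le> (\<Sum>i\<in>UNIV. \<bar>fst \<zeta> $ i\<bar>)" by (rule norm_le_l1_cart)
    also have "(\<Sum>i\<in>UNIV. \<bar>fst \<zeta> $ i\<bar>) \<le> (\<Sum>i\<in>(UNIV::'k set). m)" by (intro sum_mono mi)
    also have "\<dots> = ?k * m" by simp
    also have "norm (snd \<zeta>) \<le> m" using mi(2) by simp
    finally have "norm \<zeta> \<le> (?k + 1) * m" by (simp add: algebra_simps)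
    also have "\<dots> \<le> (?k + 2) * (1 + m)" using m0 by (intro mult_mono) auto
    finally have "norm \<zeta> powr b \<le> ((?k + 2) * (1 + m)) powr b" using True by (intro powr_mono2) auto
    also have "\<dots> = (?k + 2) powr b * (1 + m) powr b" by (simp only: powr_mult)
    also have "\<dots> \<le> (?k + 2) powr b * (?S + (1 + \<bar>snd \<zeta>\<bar>) powr b)"
    proof (intro mult_left_mono)
      show "(1 + m) powr b \<le> ?S + (1 + \<bar>snd \<zeta>\<bar>) powr b"
        using m_in
      proof
        assume "m = \<bar>snd \<zeta>\<bar>"
        then show ?thesis by (simp add: add_increasing sum_nonneg)
      next
        assume "\<exists>i. m = \<bar>fst \<zeta> $ i\<bar>"
        then obtain i where "m = \<bar>fst \<zeta> $ i\<bar>" ..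
        then show ?thesis using comp[of i] by (simp add: add_increasing2)
      qed
    qed simp
    finally show ?thesis using True by simp
  next
    case False
    \<comment> \<open>Any index; index types are nonempty.\<close>
    obtain i :: 'k where True by auto
    have "\<bar>fst \<zeta> $ i\<bar> \<le> norm (fst \<zeta>)" by (rule component_le_norm_cart)
    also have "\<dots> \<le> norm \<zeta>" by (rule norm_fst_le[of "fst \<zeta>" "snd \<zeta>", simplified])
    finally have l: "(1 + \<bar>fst \<zeta> $ i\<bar>) / 2 \<le> norm \<zeta>" using n by simp
    have "norm \<zeta> powr b \<le> ((1 + \<bar>fst \<zeta> $ i\<bar>) / 2) powr b" using False by (intro powr_mono2' l) auto
    also have "\<dots> = 2 powr (- b) * (1 + \<bar>fst \<zeta> $ i\<bar>) powr b" by (simp add: powr_divide powr_minus_divide)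
    also have "\<dots> \<le> (?k + 2) powr (- b) * ?S"
      using False by (intro mult_mono comp powr_mono2) auto
    finally show ?thesis using False by simp
  qed
qed

text \<open>Each coordinate uses the exponent l + 2 delta, which leaves the decay l + delta. The
  weight |zeta|^b is split by coordinates: a coordinate that carries it gets the extra exponent
  \<open>b\<close>, and the weight in y is absorbed by \<open>spread\<close>. In all cases the
  exponents of \<open>spread\<close> add up to the same number. The choice l = 1 makes the product
  integrable, l = 0 makes it bounded.\<close>

lemma sheet_ft_powr_le:
  fixes w :: "'k::finite \<Rightarrow> real \<Rightarrow> real"
  assumes sup: "\<And>i \<epsilon>. 0 < \<epsilon> \<Longrightarrow> \<exists>K>0. \<forall>x y. (norm (path_ft (w i) x y))\<^sup>2 \<le> K * decay x y * (1 + \<bar>x\<bar> + \<bar>y\<bar>) powr \<epsilon>"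
    and p: "0 < p" and \<delta>: "0 < \<delta>" and l: "0 \<le> l"
    and g0: "l + 2 * \<delta> \<le> 2 * p" and g1: "0 \<le> b + l + 2 * \<delta>" "b + l + 2 * \<delta> \<le> 2 * p"
  shows "\<exists>C\<ge>0. \<forall>\<zeta> :: (real ^ 'k) \<times> real. 1 \<le> norm \<zeta> \<longrightarrow>
    norm (sheet_ft w \<zeta>) powr (2 * p) * norm \<zeta> powr b
      \<le> C * spread (snd \<zeta>) powr (b + real CARD('k) * (l + 3 * \<delta> - p)) * (\<Prod>i\<in>UNIV. (1 + \<bar>fst \<zeta> $ i\<bar>) powr (- (l + \<delta>)))"
proof -
  let ?k = "real CARD('k)"
  have "\<exists>K. \<forall>i. 0 < K i \<and> (\<forall>\<gamma> x y. 0 \<le> \<gamma> \<longrightarrow> \<gamma> \<le> 2 * p \<longrightarrow>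
      norm (path_ft (w i) x y) powr (2 * p) \<le> K i * spread y powr (\<gamma> - p + \<delta>) * (1 + \<bar>x\<bar>) powr (- \<gamma> + \<delta>))"
    by (rule choice, rule allI, rule path_ft_powr_le[OF sup p \<delta>]) blast+
  then obtain K where K0: "\<And>i. 0 < K i" and K: "\<And>i \<gamma> x y. 0 \<le> \<gamma> \<Longrightarrow> \<gamma> \<le> 2 * p \<Longrightarrow>
      norm (path_ft (w i) x y) powr (2 * p) \<le> K i * spread y powr (\<gamma> - p + \<delta>) * (1 + \<bar>x\<bar>) powr (- \<gamma> + \<delta>)" by blast
  define P where "P \<zeta> = (\<Prod>i\<in>UNIV. (1 + \<bar>fst \<zeta> $ i\<bar>) powr (- (l + \<delta>)))" for \<zeta> :: "(real ^ 'k) \<times> real"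
  define e where "e = b + ?k * (l + 3 * \<delta> - p)"
  define Q where "Q = (\<Prod>i\<in>UNIV. K i)"
  have Q0: "0 < Q" unfolding Q_def by (intro prod_pos) (simp add: K0)
  have P0: "0 \<le> P \<zeta>" for \<zeta> unfolding P_def by (intro prod_nonneg) simp
  have nf: "norm (sheet_ft w \<zeta>) powr (2 * p) = (\<Prod>i\<in>UNIV. norm (path_ft (w i) (fst \<zeta> $ i) (snd \<zeta>)) powr (2 * p))" for \<zeta>
    unfolding sheet_ft_def prod_norm[symmetric] by (rule prod_powr_distrib)
  have base: "(\<Prod>i\<in>UNIV. norm (path_ft (w i) (fst \<zeta> $ i) (snd \<zeta>)) powr (2 * p))
      \<le> Q * spread (snd \<zeta>) powr (\<Sum>i\<in>UNIV. g i - p + \<delta>) * (\<Prod>i\<in>UNIV. (1 + \<bar>fst \<zeta> $ i\<bar>) powr (- g i + \<delta>))"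
    if "\<And>i. 0 \<le> g i" "\<And>i. g i \<le> 2 * p" for g :: "'k \<Rightarrow> real" and \<zeta>
  proof -
    have "(\<Prod>i\<in>UNIV. norm (path_ft (w i) (fst \<zeta> $ i) (snd \<zeta>)) powr (2 * p))
      \<le> (\<Prod>i\<in>UNIV. K i * spread (snd \<zeta>) powr (g i - p + \<delta>) * (1 + \<bar>fst \<zeta> $ i\<bar>) powr (- g i + \<delta>))"
      using that by (intro prod_mono conjI K) auto
    also have "\<dots> = Q * (\<Prod>i\<in>UNIV. spread (snd \<zeta>) powr (g i - p + \<delta>)) * (\<Prod>i\<in>UNIV. (1 + \<bar>fst \<zeta> $ i\<bar>) powr (- g i + \<delta>))"
      by (simp add: Q_def prod.distrib)
    also have "(\<Prod>i\<in>UNIV. spread (snd \<zeta>) powr (g i - p + \<delta>)) = spread (snd \<zeta>) powr (\<Sum>i\<in>UNIV. g i - p + \<delta>)"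
      using spread_ge_1[of "snd \<zeta>"] by (intro powr_sum[symmetric]) auto
    finally show ?thesis .
  qed
  have t1: "(\<Prod>i\<in>UNIV. norm (path_ft (w i) (fst \<zeta> $ i) (snd \<zeta>)) powr (2 * p)) * (1 + \<bar>fst \<zeta> $ j\<bar>) powr b \<le> Q * spread (snd \<zeta>) powr e * P \<zeta>" for \<zeta> and j :: 'k
  proof -
    \<comment> \<open>The extra \<open>b\<close> at index \<open>j\<close> cancels the factor (1 +
      |xi_j|)^b exactly; \<open>g1\<close> keeps this exponent within [0, 2 p].\<close>
    define g where "g i = (if i = j then b else 0) + (l + 2 * \<delta>)" for i
    have "(\<Sum>i\<in>UNIV. g i - p + \<delta>) = (\<Sum>i\<in>UNIV. (if i = j then b else 0) + (l + 3 * \<delta> - p))"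
      by (intro sum.cong) (auto simp: g_def)
    then have s: "(\<Sum>i\<in>UNIV. g i - p + \<delta>) = e" by (simp add: sum.distrib e_def)
    have "(\<Prod>i\<in>UNIV. norm (path_ft (w i) (fst \<zeta> $ i) (snd \<zeta>)) powr (2 * p)) * (1 + \<bar>fst \<zeta> $ j\<bar>) powr b
      \<le> (Q * spread (snd \<zeta>) powr e * (\<Prod>i\<in>UNIV. (1 + \<bar>fst \<zeta> $ i\<bar>) powr (- g i + \<delta>))) * (1 + \<bar>fst \<zeta> $ j\<bar>) powr b"
      unfolding s[symmetric] using g0 g1 l \<delta> by (intro mult_right_mono base) (auto simp: g_def)
    also have "(\<Prod>i\<in>UNIV. (1 + \<bar>fst \<zeta> $ i\<bar>) powr (- g i + \<delta>)) = (1 + \<bar>fst \<zeta> $ j\<bar>) powr (- b) * P \<zeta>"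
    proof -
      have "(1 + \<bar>fst \<zeta> $ i\<bar>) powr (- g i + \<delta>) = (if i = j then (1 + \<bar>fst \<zeta> $ i\<bar>) powr (- b) else 1) * (1 + \<bar>fst \<zeta> $ i\<bar>) powr (- (l + \<delta>))" for i
      proof (cases "i = j")
        case True
        have "- g i + \<delta> = - b + (- (l + \<delta>))" by (simp add: g_def True)
        then show ?thesis using True by (simp only: powr_add if_True simp_thms)
      next
        case False
        have "- g i + \<delta> = - (l + \<delta>)" using False by (simp add: g_def)
        then show ?thesis using False by (simp only: if_False mult_1)
      qed
      then show ?thesis by (simp add: prod.distrib P_def)
    qed
    also have "(Q * spread (snd \<zeta>) powr e * ((1 + \<bar>fst \<zeta> $ j\<bar>) powr (- b) * P \<zeta>)) * (1 + \<bar>fst \<zeta> $ j\<bar>) powr b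
       = Q * spread (snd \<zeta>) powr e * P \<zeta> * ((1 + \<bar>fst \<zeta> $ j\<bar>) powr (- b) * (1 + \<bar>fst \<zeta> $ j\<bar>) powr b)" by (simp only: mult_ac)
    also have "(1 + \<bar>fst \<zeta> $ j\<bar>) powr (- b) * (1 + \<bar>fst \<zeta> $ j\<bar>) powr b = 1" by (simp add: powr_add[symmetric])
    finally show ?thesis by simp
  qed
  \<comment> \<open>A nonnegative power of 1 + |y| is at most a constant times the same power of
    \<open>spread\<close>, so the exponent \<open>b\<close> moves there.\<close>
  have t2: "(\<Prod>i\<in>UNIV. norm (path_ft (w i) (fst \<zeta> $ i) (snd \<zeta>)) powr (2 * p)) * (1 + \<bar>snd \<zeta>\<bar>) powr b \<le> 2 powr b * (Q * spread (snd \<zeta>) powr e * P \<zeta>)"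
    if b0: "0 \<le> b" for \<zeta>
  proof -
    have "(\<Prod>i\<in>UNIV. norm (path_ft (w i) (fst \<zeta> $ i) (snd \<zeta>)) powr (2 * p)) * (1 + \<bar>snd \<zeta>\<bar>) powr b
      \<le> (Q * spread (snd \<zeta>) powr (\<Sum>i\<in>(UNIV::'k set). (l + 2 * \<delta>) - p + \<delta>) * (\<Prod>i\<in>UNIV. (1 + \<bar>fst \<zeta> $ i\<bar>) powr (- (l + 2 * \<delta>) + \<delta>))) * (2 * spread (snd \<zeta>)) powr b"
      using g0 l \<delta> b0 Q0
      by (intro mult_mono base powr_mono2 one_plus_abs_le_spread) (auto intro!: mult_nonneg_nonneg prod_nonneg)
    also have "(\<Prod>i\<in>UNIV. (1 + \<bar>fst \<zeta> $ i\<bar>) powr (- (l + 2 * \<delta>) + \<delta>)) = P \<zeta>"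
    proof -
      have "- (l + 2 * \<delta>) + \<delta> = - (l + \<delta>)" by simp
      then show ?thesis by (simp only: P_def)
    qed
    also have "(2 * spread (snd \<zeta>)) powr b = 2 powr b * spread (snd \<zeta>) powr b" by (simp only: powr_mult)
    also have "(Q * spread (snd \<zeta>) powr (\<Sum>i\<in>(UNIV::'k set). (l + 2 * \<delta>) - p + \<delta>) * P \<zeta>) * (2 powr b * spread (snd \<zeta>) powr b)
      = 2 powr b * (Q * (spread (snd \<zeta>) powr b * spread (snd \<zeta>) powr (\<Sum>i\<in>(UNIV::'k set). (l + 2 * \<delta>) - p + \<delta>)) * P \<zeta>)" by (simp only: mult_ac)
    also have "spread (snd \<zeta>) powr b * spread (snd \<zeta>) powr (\<Sum>i\<in>(UNIV::'k set). (l + 2 * \<delta>) - p + \<delta>) = spread (snd \<zeta>) powr e"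
      unfolding powr_add[symmetric] by (simp add: e_def algebra_simps)
    finally show ?thesis .
  qed
  define C where "C = (?k + 2) powr \<bar>b\<bar> * (?k + 2 powr b) * Q"
  show ?thesis
  proof (intro exI[of _ C] conjI allI impI)
    show "0 \<le> C" using Q0 by (simp add: C_def)
    fix \<zeta> :: "(real ^ 'k) \<times> real" assume n: "1 \<le> norm \<zeta>"
    define N where "N = (\<Prod>i\<in>UNIV. norm (path_ft (w i) (fst \<zeta> $ i) (snd \<zeta>)) powr (2 * p))"
    define R where "R = Q * spread (snd \<zeta>) powr e * P \<zeta>"
    have N0: "0 \<le> N" unfolding N_def by (intro prod_nonneg) simp
    have R0: "0 \<le> R" unfolding R_def using Q0 P0[of \<zeta>] by simp
    have "N * norm \<zeta> powr b \<le> N * ((?k + 2) powr \<bar>b\<bar> *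
      ((\<Sum>i\<in>UNIV. (1 + \<bar>fst \<zeta> $ i\<bar>) powr b) + (if 0 \<le> b then (1 + \<bar>snd \<zeta>\<bar>) powr b else 0)))"
      using N0 by (intro mult_left_mono norm_powr_le_coordinates[OF n])
    also have "\<dots> = (?k + 2) powr \<bar>b\<bar> * ((\<Sum>i\<in>UNIV. N * (1 + \<bar>fst \<zeta> $ i\<bar>) powr b) + N * (if 0 \<le> b then (1 + \<bar>snd \<zeta>\<bar>) powr b else 0))"
      by (simp add: sum_distrib_left algebra_simps)
    also have "\<dots> \<le> (?k + 2) powr \<bar>b\<bar> * ((\<Sum>i\<in>(UNIV::'k set). R) + 2 powr b * R)"
    proof (intro mult_left_mono add_mono sum_mono)
      show "N * (1 + \<bar>fst \<zeta> $ i\<bar>) powr b \<le> R" for i unfolding N_def R_def by (rule t1)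
      show "N * (if 0 \<le> b then (1 + \<bar>snd \<zeta>\<bar>) powr b else 0) \<le> 2 powr b * R"
        using t2[of \<zeta>] R0 by (auto simp: N_def R_def)
    qed simp
    also have "\<dots> = C * spread (snd \<zeta>) powr e * P \<zeta>" by (simp add: C_def R_def algebra_simps)
    finally show "norm (sheet_ft w \<zeta>) powr (2 * p) * norm \<zeta> powr b
      \<le> C * spread (snd \<zeta>) powr (b + ?k * (l + 3 * \<delta> - p)) * (\<Prod>i\<in>UNIV. (1 + \<bar>fst \<zeta> $ i\<bar>) powr (- (l + \<delta>)))"
      unfolding nf N_def[symmetric] e_def[symmetric] P_def[symmetric] .
  qed
qed

section \<open>Energies of the sheet\<close>

lemma prod_Basis_pair:
  fixes \<zeta> :: "(real ^ 'k::finite) \<times> real"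
  shows "(\<Prod>u\<in>Basis. f (\<zeta> \<bullet> u)) = (\<Prod>i\<in>UNIV. f (fst \<zeta> $ i)) * f (snd \<zeta>)"
proof -
  have "(\<Prod>u\<in>Basis. f (\<zeta> \<bullet> u)) = (\<Prod>u\<in>(\<lambda>u. (u, 0)) ` (Basis :: (real ^ 'k) set). f (\<zeta> \<bullet> u)) * (\<Prod>u\<in>(\<lambda>v. (0, v)) ` (Basis :: real set). f (\<zeta> \<bullet> u))"
    unfolding Basis_prod_def by (rule prod.union_disjoint) auto
  also have "(\<Prod>u\<in>(\<lambda>u. (u, 0)) ` (Basis :: (real ^ 'k) set). f (\<zeta> \<bullet> u)) = (\<Prod>u\<in>(Basis :: (real ^ 'k) set). f (fst \<zeta> \<bullet> u))"
    by (subst prod.reindex) (auto simp: inj_on_def inner_prod_def)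
  also have "\<dots> = (\<Prod>i\<in>UNIV. f (fst \<zeta> $ i))"
    using prod_Basis_vec[of "\<lambda>i b. f (fst \<zeta> \<bullet> b)"] by (simp add: inner_axis)
  also have "(\<Prod>u\<in>(\<lambda>v. (0, v)) ` (Basis :: real set). f (\<zeta> \<bullet> u)) = f (snd \<zeta>)"
    by (simp add: inner_prod_def)
  finally show ?thesis .
qed

text \<open>The energy integral without its outer power, in the exponents p = 1 / theta and b = s /
  theta - (k + 1), in which all conditions below become linear.\<close>

definition sheet_energy :: "('k::finite \<Rightarrow> real \<Rightarrow> real) \<Rightarrow> real \<Rightarrow> real \<Rightarrow> ennreal" where
  "sheet_energy w p b = (\<integral>\<^sup>+\<zeta>. ennreal (norm (sheet_ft w \<zeta>) powr (2 * p) * norm \<zeta> powr b) \<partial>lborel)"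

text \<open>The bound b <= k (p - 1) - 1/2 - kappa makes the remaining power of
  \<open>spread\<close> integrable in y. The bound b <= 2 p - 1 - kappa lets a single coordinate
  absorb the whole weight without exceeding the exponent 2 p. The lower bound on \<open>b\<close>
  keeps that exponent nonnegative and the integrand integrable at the origin.\<close>

lemma sheet_energy_finite:
  fixes w :: "'k::finite \<Rightarrow> real \<Rightarrow> real"
  assumes sup: "\<And>i \<epsilon>. 0 < \<epsilon> \<Longrightarrow> \<exists>K>0. \<forall>x y. (norm (path_ft (w i) x y))\<^sup>2 \<le> K * decay x y * (1 + \<bar>x\<bar> + \<bar>y\<bar>) powr \<epsilon>"
    and p: "1 \<le> p" and \<kappa>: "0 < \<kappa>" "\<kappa> \<le> 1/2"
    and b: "- 1/2 - \<kappa> \<le> b" "b \<le> real CARD('k) * (p - 1) - 1/2 - \<kappa>" "b \<le> 2 * p - 1 - \<kappa>"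
  shows "sheet_energy w p b < \<infinity>"
proof -
  let ?k = "real CARD('k)"
  have k: "1 \<le> ?k" using one_le_card_finite[where ?'a='k] by (simp del: one_le_card_finite)
  \<comment> \<open>The losses are 3 delta in each of k coordinates plus delta for integrability in
    y; together they use up exactly kappa.\<close>
  define \<delta> where "\<delta> = \<kappa> / (3 * ?k + 1)"
  have k0: "0 < 3 * ?k + 1" using k by linarith
  have \<delta>0: "0 < \<delta>" using \<kappa> k0 by (simp add: \<delta>_def)
  have \<delta>k: "3 * ?k * \<delta> + \<delta> = \<kappa>"
  proof -
    have "\<delta> * (3 * ?k + 1) = \<kappa>" using k0 by (simp add: \<delta>_def)
    then show ?thesis by (simp add: algebra_simps)
  qed
  have "3 * 1 * \<delta> \<le> 3 * ?k * \<delta>" using k \<delta>0 by (intro mult_right_mono) auto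
  then have \<delta>4: "4 * \<delta> \<le> \<kappa>" using \<delta>k by linarith
  have "\<exists>C\<ge>0. \<forall>\<zeta> :: (real ^ 'k) \<times> real. 1 \<le> norm \<zeta> \<longrightarrow>
    norm (sheet_ft w \<zeta>) powr (2 * p) * norm \<zeta> powr b
      \<le> C * spread (snd \<zeta>) powr (b + ?k * (1 + 3 * \<delta> - p)) * (\<Prod>i\<in>UNIV. (1 + \<bar>fst \<zeta> $ i\<bar>) powr (- (1 + \<delta>)))"
    by (rule sheet_ft_powr_le[OF sup]) (use p \<kappa> \<delta>0 \<delta>4 b in auto)
  then obtain C where C0: "0 \<le> C" and C: "\<And>\<zeta> :: (real ^ 'k) \<times> real. 1 \<le> norm \<zeta> \<Longrightarrow>
    norm (sheet_ft w \<zeta>) powr (2 * p) * norm \<zeta> powr b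
      \<le> C * spread (snd \<zeta>) powr (b + ?k * (1 + 3 * \<delta> - p)) * (\<Prod>i\<in>UNIV. (1 + \<bar>fst \<zeta> $ i\<bar>) powr (- (1 + \<delta>)))"
    by blast
  \<comment> \<open>\<open>spread\<close> is of order (1 + |y|)^2, so an exponent of at most -(1 +
    delta) / 2 yields decay of order 1 + delta in y.\<close>
  have e: "b + ?k * (1 + 3 * \<delta> - p) \<le> - ((1 + \<delta>) / 2)"
  proof -
    have "?k * (1 + 3 * \<delta> - p) = - (?k * (p - 1)) + 3 * ?k * \<delta>" by (simp add: algebra_simps)
    moreover define v where "v = ?k * (p - 1)"
    moreover define z where "z = 3 * ?k * \<delta>"
    ultimately have "?k * (1 + 3 * \<delta> - p) = - v + z" "b \<le> v - 1/2 - \<kappa>" "z + \<delta> = \<kappa>" using b(2) \<delta>k by simp_all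
    then have "b + ?k * (1 + 3 * \<delta> - p) \<le> - 1/2 - \<delta>" by simp
    then show ?thesis using \<delta>0 by (simp add: field_simps)
  qed
  have sp: "spread y powr (b + ?k * (1 + 3 * \<delta> - p)) \<le> 2 powr ((1 + \<delta>) / 2) * (1 + \<bar>y\<bar>) powr (- (1 + \<delta>))" for y
  proof -
    have "spread y powr (b + ?k * (1 + 3 * \<delta> - p)) \<le> spread y powr (- ((1 + \<delta>) / 2))"
      by (rule powr_mono[OF e spread_ge_1])
    also have "\<dots> \<le> ((1 + \<bar>y\<bar>)\<^sup>2 / 2) powr (- ((1 + \<delta>) / 2))"
      using spread_ge[of y] \<delta>0 by (intro powr_mono2') auto
    also have "\<dots> = ((1 + \<bar>y\<bar>) powr 2) powr (- ((1 + \<delta>) / 2)) / 2 powr (- ((1 + \<delta>) / 2))"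
      by (simp add: powr_divide)
    also have "\<dots> = 2 powr ((1 + \<delta>) / 2) * (1 + \<bar>y\<bar>) powr (- (1 + \<delta>))"
    proof -
      have eq: "2 * - ((1 + \<delta>) / 2) = - (1 + \<delta>)" by (simp add: field_simps)
      show ?thesis unfolding powr_powr eq
        by (simp only: powr_minus[of 2] divide_inverse inverse_inverse_eq mult.commute)
    qed
    finally show ?thesis .
  qed
  show ?thesis unfolding sheet_energy_def
  proof (rule nn_integral_finite_of_decay[where b=b and \<delta>=\<delta> and C="C * 2 powr ((1 + \<delta>) / 2)"])
    have "real DIM((real ^ 'k) \<times> real) = ?k + 1" by simp
    then show "- real DIM((real ^ 'k) \<times> real) < b" using b(1) \<kappa> k by linarith
    show "0 < \<delta>" by (rule \<delta>0)
  next
    fix \<zeta> :: "(real ^ 'k) \<times> real"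
    have "norm (sheet_ft w \<zeta>) powr (2 * p) \<le> 1 powr (2 * p)" using p by (intro powr_mono2 norm_sheet_ft_le) auto
    then show "norm (sheet_ft w \<zeta>) powr (2 * p) * norm \<zeta> powr b \<le> norm \<zeta> powr b"
      using mult_right_mono[of "norm (sheet_ft w \<zeta>) powr (2 * p)" 1 "norm \<zeta> powr b"] by simp
  next
    fix \<zeta> :: "(real ^ 'k) \<times> real" assume n: "1 < norm \<zeta>"
    define P where "P = (\<Prod>i\<in>UNIV. (1 + \<bar>fst \<zeta> $ i\<bar>) powr (- (1 + \<delta>)))"
    have P0: "0 \<le> P" unfolding P_def by (intro prod_nonneg) simp
    have "norm (sheet_ft w \<zeta>) powr (2 * p) * norm \<zeta> powr b \<le> C * spread (snd \<zeta>) powr (b + ?k * (1 + 3 * \<delta> - p)) * P"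
      unfolding P_def using n by (intro C) simp
    also have "\<dots> \<le> C * (2 powr ((1 + \<delta>) / 2) * (1 + \<bar>snd \<zeta>\<bar>) powr (- (1 + \<delta>))) * P"
      by (intro mult_right_mono mult_left_mono sp C0 P0)
    also have "\<dots> = C * 2 powr ((1 + \<delta>) / 2) * (P * (1 + \<bar>snd \<zeta>\<bar>) powr (- (1 + \<delta>)))" by (simp only: mult_ac)
    also have "P * (1 + \<bar>snd \<zeta>\<bar>) powr (- (1 + \<delta>)) = (\<Prod>u\<in>Basis. (1 + \<bar>\<zeta> \<bullet> u\<bar>) powr (- (1 + \<delta>)))"
      unfolding P_def by (rule prod_Basis_pair[symmetric])
    finally show "norm (sheet_ft w \<zeta>) powr (2 * p) * norm \<zeta> powr b \<le> C * 2 powr ((1 + \<delta>) / 2) * (\<Prod>u\<in>Basis. (1 + \<bar>\<zeta> \<bullet> u\<bar>) powr (- (1 + \<delta>)))" .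
  qed
qed

text \<open>Away from the unit ball a radial power is distributed equally over all coordinates,
  since each 1 + |coordinate| is at most twice the norm.\<close>

lemma norm_powr_dim_le:
  fixes \<zeta> :: "'a::euclidean_space"
  assumes n: "1 \<le> norm \<zeta>" and c: "0 \<le> c"
  shows "norm \<zeta> powr (- (c * real DIM('a))) \<le> 2 powr (c * real DIM('a)) * (\<Prod>u\<in>Basis. (1 + \<bar>\<zeta> \<bullet> u\<bar>) powr (- c))"
proof -
  have "norm \<zeta> powr (- (c * real DIM('a))) = (norm \<zeta> powr (- c)) powr real DIM('a)" by (simp add: powr_powr)
  also have "\<dots> = (\<Prod>u\<in>(Basis :: 'a set). norm \<zeta> powr (- c))" using n by (subst powr_realpow) auto
  also have "\<dots> \<le> (\<Prod>u\<in>(Basis :: 'a set). 2 powr c * (1 + \<bar>\<zeta> \<bullet> u\<bar>) powr (- c))"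
  proof (intro prod_mono conjI)
    fix u :: 'a assume u: "u \<in> Basis"
    have "(1 + \<bar>\<zeta> \<bullet> u\<bar>) / 2 \<le> norm \<zeta>" using Basis_le_norm[OF u, of \<zeta>] n by simp
    then have "norm \<zeta> powr (- c) \<le> ((1 + \<bar>\<zeta> \<bullet> u\<bar>) / 2) powr (- c)" using c by (intro powr_mono2') auto
    also have "\<dots> = 2 powr c * (1 + \<bar>\<zeta> \<bullet> u\<bar>) powr (- c)" by (simp add: powr_divide powr_minus_divide)
    finally show "norm \<zeta> powr (- c) \<le> 2 powr c * (1 + \<bar>\<zeta> \<bullet> u\<bar>) powr (- c)" .
  qed simp
  also have "\<dots> = (2 powr c) ^ DIM('a) * (\<Prod>u\<in>Basis. (1 + \<bar>\<zeta> \<bullet> u\<bar>) powr (- c))" by (simp add: prod.distrib)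
  also have "(2 powr c) ^ DIM('a) = 2 powr (c * real DIM('a))" by (simp add: powr_powr[symmetric] powr_realpow)
  finally show ?thesis .
qed

lemma nn_integral_norm_powr_ball_finite:
  assumes "- real DIM('a::euclidean_space) < b"
  shows "(\<integral>\<^sup>+\<zeta>. ennreal (if norm \<zeta> \<le> 1 then norm \<zeta> powr b else 0) \<partial>(lborel :: 'a measure)) < \<infinity>"
  using assms by (rule nn_integral_finite_of_decay[where \<delta>=1 and C=0]) auto

text \<open>Outside the unit ball the weight decreases with its exponent; inside, the transform is
  at most 1 and the weight is integrable.\<close>

lemma sheet_energy_antimono:
  fixes w :: "'k::finite \<Rightarrow> real \<Rightarrow> real"
  assumes w: "\<And>i. continuous_on UNIV (w i)" and p: "0 < p"
    and b: "- real DIM((real ^ 'k) \<times> real) < b0" "b0 \<le> b" and fin: "sheet_energy w p b < \<infinity>"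
  shows "sheet_energy w p b0 < \<infinity>"
proof -
  have [measurable]: "sheet_ft w \<in> borel_measurable borel" by (rule measurable_sheet_ft[OF w])
  have "sheet_energy w p b0 \<le> (\<integral>\<^sup>+\<zeta>. ennreal (if norm \<zeta> \<le> 1 then norm \<zeta> powr b0 else 0) + ennreal (norm (sheet_ft w \<zeta>) powr (2 * p) * norm \<zeta> powr b) \<partial>lborel)"
    unfolding sheet_energy_def
  proof (rule nn_integral_mono)
    fix \<zeta> :: "(real ^ 'k) \<times> real"
    show "ennreal (norm (sheet_ft w \<zeta>) powr (2 * p) * norm \<zeta> powr b0) \<le> ennreal (if norm \<zeta> \<le> 1 then norm \<zeta> powr b0 else 0) + ennreal (norm (sheet_ft w \<zeta>) powr (2 * p) * norm \<zeta> powr b)"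
    proof (cases "norm \<zeta> \<le> 1")
      case True
      have "norm (sheet_ft w \<zeta>) powr (2 * p) \<le> 1 powr (2 * p)" using p by (intro powr_mono2 norm_sheet_ft_le) auto
      then have "norm (sheet_ft w \<zeta>) powr (2 * p) * norm \<zeta> powr b0 \<le> norm \<zeta> powr b0"
        using mult_right_mono[of "norm (sheet_ft w \<zeta>) powr (2 * p)" 1 "norm \<zeta> powr b0"] by simp
      then show ?thesis using True by (auto intro: add_increasing2 ennreal_leI)
    next
      case False
      then have "norm (sheet_ft w \<zeta>) powr (2 * p) * norm \<zeta> powr b0 \<le> norm (sheet_ft w \<zeta>) powr (2 * p) * norm \<zeta> powr b"
        using b by (intro mult_left_mono powr_mono) auto
      then show ?thesis by (auto intro: add_increasing ennreal_leI)
    qed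
  qed
  also have "\<dots> = (\<integral>\<^sup>+\<zeta>. ennreal (if norm \<zeta> \<le> 1 then norm \<zeta> powr b0 else 0) \<partial>(lborel :: ((real ^ 'k) \<times> real) measure)) + sheet_energy w p b"
    unfolding sheet_energy_def by (rule nn_integral_add) measurable
  also have "\<dots> < \<infinity>" using nn_integral_norm_powr_ball_finite[OF b(1)] fin by simp
  finally show ?thesis .
qed

section \<open>Divergence of the energies\<close>

lemma nn_integral_pair_product:
  fixes g :: "'k::finite \<Rightarrow> real \<Rightarrow> real \<Rightarrow> ennreal" and h :: "real \<Rightarrow> ennreal"
  assumes g: "\<And>i. (\<lambda>q. g i (fst q) (snd q)) \<in> borel_measurable borel" and h: "h \<in> borel_measurable borel"
  shows "(\<integral>\<^sup>+\<zeta>. h (snd \<zeta>) * (\<Prod>i\<in>UNIV. g i (fst \<zeta> $ i) (snd \<zeta>)) \<partial>(lborel :: ((real ^ 'k) \<times> real) measure))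
    = (\<integral>\<^sup>+y. h y * (\<Prod>i\<in>UNIV. \<integral>\<^sup>+x. g i x y \<partial>lborel) \<partial>lborel)"
proof -
  have gm: "(\<lambda>\<zeta> :: (real ^ 'k) \<times> real. g i (fst \<zeta> $ i) (snd \<zeta>)) \<in> borel_measurable borel" for i
  proof -
    have "(\<lambda>\<zeta> :: (real ^ 'k) \<times> real. (fst \<zeta> $ i, snd \<zeta>)) \<in> borel_measurable borel"
      by (intro borel_measurable_continuous_onI continuous_intros)
    from measurable_compose[OF this g[of i]] show ?thesis by simp
  qed
  have hm: "(\<lambda>\<zeta> :: (real ^ 'k) \<times> real. h (snd \<zeta>)) \<in> borel_measurable borel"
    by (intro measurable_compose[OF _ h] borel_measurable_continuous_onI continuous_intros)
  have gx: "(\<lambda>x. g i x y) \<in> borel_measurable borel" for i y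
  proof -
    have "(\<lambda>x. (x, y)) \<in> borel_measurable borel" by (intro borel_measurable_continuous_onI continuous_intros)
    from measurable_compose[OF this g[of i]] show ?thesis by simp
  qed
  define F where "F \<zeta> = h (snd \<zeta>) * (\<Prod>i\<in>UNIV. g i (fst \<zeta> $ i) (snd \<zeta>))" for \<zeta> :: "(real ^ 'k) \<times> real"
  have Fm: "F \<in> borel_measurable (lborel \<Otimes>\<^sub>M lborel)"
    unfolding lborel_prod F_def using gm hm by measurable
  have "(\<integral>\<^sup>+\<zeta>. F \<zeta> \<partial>lborel) = (\<integral>\<^sup>+\<zeta>. F \<zeta> \<partial>(lborel \<Otimes>\<^sub>M lborel))" by (simp add: lborel_prod)
  also have "\<dots> = (\<integral>\<^sup>+y. (\<integral>\<^sup>+x. F (x, y) \<partial>lborel) \<partial>lborel)"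
    by (rule lborel_pair.nn_integral_snd[symmetric, OF Fm])
  finally have eq: "(\<integral>\<^sup>+\<zeta>. F \<zeta> \<partial>lborel) = (\<integral>\<^sup>+y. (\<integral>\<^sup>+x. F (x, y) \<partial>lborel) \<partial>lborel)" .
  have "(\<integral>\<^sup>+x. F (x, y) \<partial>lborel) = h y * (\<Prod>i\<in>UNIV. \<integral>\<^sup>+x. g i x y \<partial>lborel)" for y
  proof -
    have "(\<integral>\<^sup>+x. F (x, y) \<partial>lborel) = h y * (\<integral>\<^sup>+x. (\<Prod>i\<in>UNIV. g i (x $ i) y) \<partial>lborel)"
      unfolding F_def fst_conv snd_conv
    proof (rule nn_integral_cmult)
      have "(\<lambda>x :: real ^ 'k. g i (x $ i) y) \<in> borel_measurable borel" for i
        by (intro measurable_compose[OF _ gx] borel_measurable_continuous_onI continuous_intros)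
      then show "(\<lambda>x :: real ^ 'k. \<Prod>i\<in>UNIV. g i (x $ i) y) \<in> borel_measurable lborel" by measurable
    qed
    also have "(\<integral>\<^sup>+x. (\<Prod>i\<in>UNIV. g i (x $ i) y) \<partial>(lborel :: (real ^ 'k) measure)) = (\<Prod>i\<in>UNIV. \<integral>\<^sup>+x. g i x y \<partial>lborel)"
      by (rule nn_integral_lborel_vec_prod[OF gx])
    finally show ?thesis .
  qed
  then show ?thesis using eq unfolding F_def by simp
qed

lemma path_ft_0: "path_ft w 0 0 = 1"
  by (simp add: path_ft_def set_lebesgue_integral_def complex_of_real_def)

text \<open>Near the origin every factor is at least 1/2, by continuity from the value 1 at
  frequency 0. On a slab where y and all xi_i but one are small the energy thus dominates a product
  of one-dimensional integrals, one of which is infinite for every y.\<close>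

lemma sheet_energy_infinite_jump:
  fixes w :: "'k::finite \<Rightarrow> real \<Rightarrow> real"
  assumes w: "\<And>i. continuous_on UNIV (w i)" and p: "1 \<le> p" and b: "2 * p - 1 < b"
  shows "sheet_energy w p b = \<infinity>"
proof -
  have b0: "0 \<le> b" using p b by linarith
  have "\<exists>d. \<forall>i. 0 < d i \<and> (\<forall>x y. \<bar>x\<bar> \<le> d i \<longrightarrow> \<bar>y\<bar> \<le> d i \<longrightarrow> 1/2 \<le> norm (path_ft (w i) x y))"
  proof (rule choice, rule allI)
    fix i
    have "isCont (\<lambda>q. path_ft (w i) (fst q) (snd q)) (0, 0)"
      using continuous_path_ft[OF w[of i]] by (simp add: continuous_on_eq_continuous_at)
    then obtain d where d: "0 < d" "\<And>q. dist q (0, 0) < d \<Longrightarrow> dist (path_ft (w i) (fst q) (snd q)) (path_ft (w i) 0 0) < 1/2"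
      unfolding continuous_at_eps_delta by (metis fst_conv snd_conv half_gt_zero zero_less_one)
    show "\<exists>d. 0 < d \<and> (\<forall>x y. \<bar>x\<bar> \<le> d \<longrightarrow> \<bar>y\<bar> \<le> d \<longrightarrow> 1/2 \<le> norm (path_ft (w i) x y))"
    proof (intro exI[of _ "d/3"] conjI allI impI)
      fix x y assume xy: "\<bar>x\<bar> \<le> d/3" "\<bar>y\<bar> \<le> d/3"
      have "dist (x, y) (0, 0) \<le> \<bar>x\<bar> + \<bar>y\<bar>" using norm_Pair_le[of x y] by (simp add: dist_norm)
      then have "dist (x, y) (0, 0) < d" using xy d(1) by linarith
      from d(2)[OF this] have "norm (path_ft (w i) x y - 1) < 1/2" by (simp add: dist_norm path_ft_0)
      moreover have "norm (1::complex) \<le> norm (path_ft (w i) x y) + norm (path_ft (w i) x y - 1)"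
        by (metis add_diff_cancel_left' norm_triangle_ineq4 diff_diff_eq2 add.commute diff_add_cancel)
      ultimately show "1/2 \<le> norm (path_ft (w i) x y)" by simp
    qed (use d in auto)
  qed
  then obtain d where d: "\<And>i. 0 < d i" "\<And>i x y. \<bar>x\<bar> \<le> d i \<Longrightarrow> \<bar>y\<bar> \<le> d i \<Longrightarrow> 1/2 \<le> norm (path_ft (w i) x y)" by blast
  define e where "e = Min (range d)"
  have e: "0 < e" "\<And>i. e \<le> d i" using d(1) by (auto simp: e_def)
  \<comment> \<open>Any coordinate may be the unbounded one.\<close>
  obtain j :: 'k where True by auto
  define g where "g i x y = (if i = j then ennreal (norm (path_ft (w i) x y) powr (2 * p) * \<bar>x\<bar> powr b)
      else ennreal ((1/2) powr (2 * p)) * indicator {- e..e} x)" for i x y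
  define h where "h y = (indicator {- e..e} y :: ennreal)" for y :: real
  have gm: "(\<lambda>q. g i (fst q) (snd q)) \<in> borel_measurable borel" for i
  proof -
    have [measurable]: "(\<lambda>q. path_ft (w i) (fst q) (snd q)) \<in> borel_measurable borel"
      by (rule borel_measurable_continuous_onI[OF continuous_path_ft[OF w]])
    have [measurable]: "(fst :: real \<times> real \<Rightarrow> real) \<in> borel_measurable borel"
      by (intro borel_measurable_continuous_onI continuous_intros)
    show ?thesis unfolding g_def by measurable
  qed
  have hm: "h \<in> borel_measurable borel" unfolding h_def by measurable
  have gi: "(\<integral>\<^sup>+x. g i x y \<partial>lborel) = (if i = j then \<infinity> else ennreal ((1/2) powr (2 * p)) * ennreal (2 * e))" for i y
  proof (cases "i = j")
    case True
    then show ?thesis using nn_integral_path_ft_powr_infinite[OF w p b] by (simp add: g_def)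
  next
    case False
    then have "(\<integral>\<^sup>+x. g i x y \<partial>lborel) = ennreal ((1/2) powr (2 * p)) * emeasure lborel {- e..e}"
      unfolding g_def by (simp add: nn_integral_cmult_indicator del: emeasure_lborel_Icc)
    then show ?thesis using False e by simp
  qed
  have pinf: "(\<Prod>i\<in>UNIV. \<integral>\<^sup>+x. g i x y \<partial>lborel) = \<infinity>" for y
    unfolding gi using e(1) by (auto simp: ennreal_prod_eq_top ennreal_mult_eq_top_iff intro!: exI[of _ j])
  have "(\<integral>\<^sup>+\<zeta>. h (snd \<zeta>) * (\<Prod>i\<in>UNIV. g i (fst \<zeta> $ i) (snd \<zeta>)) \<partial>(lborel :: ((real ^ 'k) \<times> real) measure)) = (\<integral>\<^sup>+y. \<infinity> * h y \<partial>lborel)"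
    unfolding nn_integral_pair_product[OF gm hm] pinf by (simp add: mult.commute)
  also have "\<dots> = \<infinity>" unfolding h_def using e(1) by (subst nn_integral_cmult_indicator) (auto simp: ennreal_top_mult)
  finally have inf: "(\<integral>\<^sup>+\<zeta>. h (snd \<zeta>) * (\<Prod>i\<in>UNIV. g i (fst \<zeta> $ i) (snd \<zeta>)) \<partial>(lborel :: ((real ^ 'k) \<times> real) measure)) = \<infinity>" .
  have "(\<integral>\<^sup>+\<zeta>. h (snd \<zeta>) * (\<Prod>i\<in>UNIV. g i (fst \<zeta> $ i) (snd \<zeta>)) \<partial>(lborel :: ((real ^ 'k) \<times> real) measure)) \<le> sheet_energy w p b"
    unfolding sheet_energy_def
  proof (rule nn_integral_mono)
    fix \<zeta> :: "(real ^ 'k) \<times> real"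
    define f where "f i = norm (path_ft (w i) (fst \<zeta> $ i) (snd \<zeta>)) powr (2 * p) * (if i = j then \<bar>fst \<zeta> $ i\<bar> powr b else 1)" for i
    have f0: "0 \<le> f i" for i by (simp add: f_def)
    show "h (snd \<zeta>) * (\<Prod>i\<in>UNIV. g i (fst \<zeta> $ i) (snd \<zeta>)) \<le> ennreal (norm (sheet_ft w \<zeta>) powr (2 * p) * norm \<zeta> powr b)"
    proof (cases "snd \<zeta> \<in> {- e..e}")
      case True
      have "(\<Prod>i\<in>UNIV. g i (fst \<zeta> $ i) (snd \<zeta>)) \<le> (\<Prod>i\<in>UNIV. ennreal (f i))"
      proof (rule prod_mono_ennreal)
        fix i
        show "g i (fst \<zeta> $ i) (snd \<zeta>) \<le> ennreal (f i)"
        proof (cases "i = j \<or> fst \<zeta> $ i \<notin> {- e..e}")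
          case False
          then have "1/2 \<le> norm (path_ft (w i) (fst \<zeta> $ i) (snd \<zeta>))"
            using True e(2)[of i] by (intro d(2)) auto
          then have "(1/2) powr (2 * p) \<le> f i" using False p by (simp add: f_def powr_mono2)
          then show ?thesis using False by (simp add: g_def ennreal_leI)
        qed (auto simp: g_def f_def)
      qed
      also have "\<dots> = ennreal (\<Prod>i\<in>UNIV. f i)" using f0 by (simp add: prod_ennreal)
      also have "(\<Prod>i\<in>UNIV. f i) = norm (sheet_ft w \<zeta>) powr (2 * p) * \<bar>fst \<zeta> $ j\<bar> powr b"
        unfolding f_def sheet_ft_def prod_norm[symmetric] prod_powr_distrib by (simp add: prod.distrib)
      also have "\<dots> \<le> norm (sheet_ft w \<zeta>) powr (2 * p) * norm \<zeta> powr b"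
      proof (intro mult_left_mono powr_mono2 b0)
        have "\<bar>fst \<zeta> $ j\<bar> \<le> norm (fst \<zeta>)" by (rule component_le_norm_cart)
        also have "\<dots> \<le> norm \<zeta>" by (rule norm_fst_le[of "fst \<zeta>" "snd \<zeta>", simplified])
        finally show "\<bar>fst \<zeta> $ j\<bar> \<le> norm \<zeta>" .
      qed auto
      finally show ?thesis using True by (simp add: h_def ennreal_leI)
    qed (simp add: h_def)
  qed
  then show ?thesis using inf by (simp add: top_unique)
qed

text \<open>Scaling reduces to the standard normal density, for which |x|^(-a) is integrable because
  a < 1. The constant is independent of \<open>R\<close>.\<close>

lemma nn_integral_powr_normal:
  assumes a: "0 \<le> a" "a < 1"
  obtains A where "0 < A" "\<And>R. 0 < R \<Longrightarrow> (\<integral>\<^sup>+x. ennreal (\<bar>x\<bar> powr (- a) * normal_density 0 R x) \<partial>lborel) \<le> ennreal (A * R powr (- a))"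
proof -
  define I where "I = (\<integral>\<^sup>+x. ennreal (\<bar>x\<bar> powr (- a) * std_normal_density x) \<partial>lborel)"
  have "I \<le> (\<integral>\<^sup>+x. ennreal (two_power a 2 x) + ennreal (std_normal_density x) \<partial>lborel)"
    unfolding I_def
  proof (rule nn_integral_mono)
    fix x :: real
    have "\<bar>x\<bar> powr (- a) * std_normal_density x \<le> two_power a 2 x + std_normal_density x"
    proof (cases "\<bar>x\<bar> \<le> 1")
      case True
      have "1 / sqrt (2 * pi) \<le> 1"
      proof -
        have "1 \<le> sqrt (2 * pi)" using pi_gt3 by simp
        then show ?thesis by simp
      qed
      moreover have "exp (- x\<^sup>2 / 2) \<le> 1" by simp
      ultimately have "std_normal_density x \<le> 1 * 1" unfolding std_normal_density_def by (intro mult_mono) auto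
      then have "\<bar>x\<bar> powr (- a) * std_normal_density x \<le> \<bar>x\<bar> powr (- a) * 1" by (intro mult_left_mono) auto
      then show ?thesis using True normal_density_nonneg[of 0 1 x] by (simp add: two_power_def add_increasing2)
    next
      case False
      have "\<bar>x\<bar> powr (- a) \<le> 1 powr (- a)" using False a by (intro powr_mono2') auto
      then have "\<bar>x\<bar> powr (- a) * std_normal_density x \<le> 1 * std_normal_density x" by (intro mult_right_mono) auto
      then show ?thesis using two_power_nonneg[of a 2 x] by (simp add: add_increasing)
    qed
    then show "ennreal (\<bar>x\<bar> powr (- a) * std_normal_density x) \<le> ennreal (two_power a 2 x) + ennreal (std_normal_density x)"
      using two_power_nonneg[of a 2 x] by (simp add: ennreal_plus[symmetric] ennreal_leI del: ennreal_plus)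
  qed
  also have "\<dots> = (\<integral>\<^sup>+x. ennreal (two_power a 2 x) \<partial>lborel) + (\<integral>\<^sup>+x. ennreal (std_normal_density x) \<partial>lborel)"
    by (rule nn_integral_add) measurable
  also have "\<dots> < \<infinity>"
    using nn_integral_two_power_finite[of a 2] a nn_integral_eq_integral[of lborel std_normal_density] by simp
  finally have fin: "I < \<infinity>" .
  define A where "A = enn2real I + 1"
  have IA: "I \<le> ennreal A" using fin by (simp add: A_def ennreal_plus less_top)
  show ?thesis
  proof
    show "0 < A" by (simp add: A_def add_nonneg_pos)
    fix R :: real assume R: "0 < R"
    have e: "ennreal (\<bar>R * x\<bar> powr (- a) * normal_density 0 R (R * x)) * ennreal \<bar>R\<bar> = ennreal (R powr (- a)) * ennreal (\<bar>x\<bar> powr (- a) * std_normal_density x)" for x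
    proof -
      have "R * normal_density 0 R (R * x) = std_normal_density x"
        using R by (simp add: normal_density_def real_sqrt_mult power_mult_distrib)
      moreover have "\<bar>R * x\<bar> powr (- a) = R powr (- a) * \<bar>x\<bar> powr (- a)" using R by (simp add: abs_mult powr_mult)
      ultimately have "(\<bar>R * x\<bar> powr (- a) * normal_density 0 R (R * x)) * \<bar>R\<bar> = R powr (- a) * (\<bar>x\<bar> powr (- a) * std_normal_density x)"
        using R by (simp add: mult_ac)
      then show ?thesis by (simp only: ennreal_mult'[symmetric] ennreal_mult''[symmetric] mult_nonneg_nonneg powr_ge_zero normal_density_nonneg abs_ge_zero)
    qed
    have "(\<integral>\<^sup>+x. ennreal (\<bar>x\<bar> powr (- a) * normal_density 0 R x) \<partial>lborel) = ennreal \<bar>R\<bar> * (\<integral>\<^sup>+x. ennreal (\<bar>R * x\<bar> powr (- a) * normal_density 0 R (R * x)) \<partial>lborel)"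
      using R by (subst nn_integral_real_affine[where c=R and t=0]) auto
    also have "\<dots> = (\<integral>\<^sup>+x. ennreal (\<bar>R * x\<bar> powr (- a) * normal_density 0 R (R * x)) * ennreal \<bar>R\<bar> \<partial>lborel)"
      by (subst mult.commute, rule nn_integral_multc[symmetric]) measurable
    also have "\<dots> = (\<integral>\<^sup>+x. ennreal (R powr (- a)) * ennreal (\<bar>x\<bar> powr (- a) * std_normal_density x) \<partial>lborel)" unfolding e ..
    also have "\<dots> = ennreal (R powr (- a)) * I" unfolding I_def by (rule nn_integral_cmult) measurable
    also have "\<dots> \<le> ennreal (R powr (- a)) * ennreal A" by (intro mult_left_mono IA) auto
    also have "\<dots> = ennreal (A * R powr (- a))" by (simp add: ennreal_mult'' mult.commute)
    finally show "(\<integral>\<^sup>+x. ennreal (\<bar>x\<bar> powr (- a) * normal_density 0 R x) \<partial>lborel) \<le> ennreal (A * R powr (- a))" .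
  qed
qed

text \<open>The condition on \<open>y\<close> says that the variation term is at most half of the
  main term \<open>kernel_const / R\<close>, with R = 2^j.\<close>

lemma nn_integral_path_ft_sq_normal_ge:
  assumes w: "continuous_on UNIV w" and C: "0 < C"
    and var: "path_variation w (2 ^ j) \<le> C * (real (Suc j))\<^sup>2 / 4 ^ j"
    and y: "4 * pi\<^sup>2 * C * y\<^sup>2 * (real (Suc j))\<^sup>2 \<le> kernel_const * 2 ^ j"
  shows "ennreal (kernel_const / 2 / 2 ^ j) \<le> (\<integral>\<^sup>+x. ennreal ((norm (path_ft w x y))\<^sup>2 * normal_density 0 (2 ^ j) x) \<partial>lborel)"
proof -
  define R :: real where "R = 2 ^ j"
  have R: "1 \<le> R" by (simp add: R_def)
  have R2: "(4::real) ^ j = R * R" by (simp add: R_def flip: power_mult_distrib)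
  have "2*pi\<^sup>2*y\<^sup>2 * path_variation w R \<le> 2*pi\<^sup>2*y\<^sup>2 * (C * (real (Suc j))\<^sup>2 / (R * R))"
    using var unfolding R2[symmetric] by (intro mult_left_mono) (auto simp: R_def)
  also have "\<dots> = (4 * pi\<^sup>2 * C * y\<^sup>2 * (real (Suc j))\<^sup>2) / (2 * R * R)" using R by (simp add: field_simps)
  also have "\<dots> \<le> (kernel_const * R) / (2 * R * R)" using y R by (intro divide_right_mono) (auto simp: R_def)
  also have "\<dots> = kernel_const / 2 / R" using R by simp
  finally have "kernel_const / 2 / R \<le> kernel_const / R - 2*pi\<^sup>2*y\<^sup>2 * path_variation w R" by (simp add: field_simps)
  also have "\<dots> \<le> (LINT x|density lborel (normal_density 0 R). (norm (path_ft w x y))\<^sup>2)"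
    by (rule integral_normal_path_ft_sq_ge[OF w R])
  finally have le: "kernel_const / 2 / R \<le> (LINT x|density lborel (normal_density 0 R). (norm (path_ft w x y))\<^sup>2)" .
  have [measurable]: "(\<lambda>x. path_ft w x y) \<in> borel_measurable borel"
    by (rule borel_measurable_continuous_onI[OF continuous_path_ft_fst[OF w]])
  let ?N = "density lborel (\<lambda>x. ennreal (normal_density 0 R x))"
  interpret N: prob_space ?N using prob_space_normal_density[of R 0] R by simp
  have i: "integrable ?N (\<lambda>x. (norm (path_ft w x y))\<^sup>2)"
    by (rule N.integrable_const_bound[where B=1]) (auto simp: norm_path_ft_le power_le_one)
  have "ennreal (kernel_const / 2 / R) \<le> ennreal (LINT x|?N. (norm (path_ft w x y))\<^sup>2)" by (rule ennreal_leI[OF le])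
  also have "\<dots> = (\<integral>\<^sup>+x. ennreal ((norm (path_ft w x y))\<^sup>2) \<partial>?N)" by (rule nn_integral_eq_integral[OF i, symmetric]) simp
  also have "\<dots> = (\<integral>\<^sup>+x. ennreal ((norm (path_ft w x y))\<^sup>2 * normal_density 0 R x) \<partial>lborel)"
    by (subst nn_integral_density) (auto simp: ennreal_mult'[symmetric] mult.commute)
  finally show ?thesis unfolding R_def .
qed

text \<open>Splitting according to whether \<open>a \<le> T z\<^sup>-\<^sup>g\<close>; it plays the role of Hoelder's inequality and
  covers the exponent \<open>p = 1\<close> as well.\<close>

lemma split_le:
  fixes a z T p g :: real
  assumes "0 \<le> a" "0 < z" "0 < T" "1 \<le> p"
  shows "a \<le> T * z powr (- g) + T powr (1 - p) * (a powr p * z powr (g * (p - 1)))"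
proof (cases "a \<le> T * z powr (- g)")
  case True
  then show ?thesis by (simp add: add_increasing2)
next
  case False
  define u where "u = T * z powr (- g)"
  have u: "0 < u" "u < a" using False assms by (auto simp: u_def)
  have "u powr (p - 1) \<le> a powr (p - 1)" using u assms by (intro powr_mono2) auto
  then have "u powr (1 - p) * u powr (p - 1) \<le> u powr (1 - p) * a powr (p - 1)" by (intro mult_left_mono) auto
  then have "1 \<le> u powr (1 - p) * a powr (p - 1)" using u by (simp add: powr_add[symmetric])
  then have "a * 1 \<le> a * (u powr (1 - p) * a powr (p - 1))" using u by (intro mult_left_mono) auto
  also have "\<dots> = u powr (1 - p) * a powr p"
    using u powr_add[of a 1 "p - 1"] by simp
  also have "u powr (1 - p) = T powr (1 - p) * z powr (g * (p - 1))"
    unfolding u_def by (simp only: powr_mult powr_powr) (simp add: algebra_simps)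
  finally have "a \<le> T powr (1 - p) * (a powr p * z powr (g * (p - 1)))" by (simp add: mult_ac)
  then show ?thesis using assms by (simp add: add_increasing)
qed

lemma one_plus_mult_exp_le: "(1 + z) * exp (- (z\<^sup>2 / 2)) \<le> (2::real)"
proof -
  have "0 \<le> (z - 1)\<^sup>2" by simp
  then have "2 * z \<le> z\<^sup>2 + 1" by (simp add: power2_diff)
  then have "z \<le> z\<^sup>2 + 1" using zero_le_power2[of z] by linarith
  then have "1 + z \<le> 2 * (1 + z\<^sup>2 / 2)" by simp
  also have "\<dots> \<le> 2 * exp (z\<^sup>2 / 2)" by (intro mult_left_mono exp_ge_add_one_self) simp
  finally have "(1 + z) * exp (- (z\<^sup>2 / 2)) \<le> (2 * exp (z\<^sup>2 / 2)) * exp (- (z\<^sup>2 / 2))" by (intro mult_right_mono) auto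
  also have "\<dots> = 2" by (simp add: exp_minus)
  finally show ?thesis .
qed

text \<open>With z = |xi| / R the norm is at most R (1 + z), while the densities contribute at most
  R^(-k) exp(- z^2 / 2). As c <= 1, one factor 1 + z is all that the Gaussian has to absorb.\<close>

lemma norm_powr_mult_normal_le:
  fixes \<zeta> :: "(real ^ 'k::finite) \<times> real"
  assumes R: "0 < R" and y: "\<bar>snd \<zeta>\<bar> \<le> R" and c: "0 \<le> c" "c \<le> 1"
  shows "norm \<zeta> powr c * (\<Prod>i\<in>UNIV. normal_density 0 R (fst \<zeta> $ i)) \<le> 2 * R powr (c - real CARD('k))"
proof -
  define z where "z = norm (fst \<zeta>) / R"
  have z0: "0 \<le> z" using R by (simp add: z_def)
  have nd: "normal_density 0 R x \<le> R powr (- 1) * exp (- x\<^sup>2 / (2 * R\<^sup>2))" for x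
  proof -
    have "1 \<le> sqrt (2 * pi)" using pi_gt3 by simp
    then have "R * 1 \<le> R * sqrt (2 * pi)" using R by (intro mult_left_mono) auto
    then have "1 / (R * sqrt (2 * pi)) \<le> 1 / R" using R by (intro divide_left_mono) auto
    moreover have "sqrt (2 * pi * R\<^sup>2) = R * sqrt (2 * pi)" using R by (simp add: real_sqrt_mult)
    ultimately show ?thesis using R unfolding normal_density_def
      by (intro mult_mono) (auto simp: powr_minus_divide)
  qed
  have "(\<Prod>i\<in>UNIV. normal_density 0 R (fst \<zeta> $ i)) \<le> (\<Prod>i\<in>UNIV. R powr (- 1) * exp (- (fst \<zeta> $ i)\<^sup>2 / (2 * R\<^sup>2)))"
    by (intro prod_mono conjI nd) auto
  also have "\<dots> = R powr (- real CARD('k)) * exp (- (z\<^sup>2 / 2))"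
  proof -
    have "(\<Sum>i\<in>UNIV. - (fst \<zeta> $ i)\<^sup>2 / (2 * R\<^sup>2)) = - (z\<^sup>2 / 2)"
    proof -
      have "(norm (fst \<zeta>))\<^sup>2 = (\<Sum>i\<in>UNIV. (fst \<zeta> $ i)\<^sup>2)"
        by (simp only: power2_norm_eq_inner inner_vec_def inner_real_def power2_eq_square[symmetric])
      moreover have "(\<Sum>i\<in>UNIV. - (fst \<zeta> $ i)\<^sup>2 / (2 * R\<^sup>2)) = - ((\<Sum>i\<in>UNIV. (fst \<zeta> $ i)\<^sup>2) / R\<^sup>2 / 2)"
        by (simp add: sum_divide_distrib sum_negf mult.commute)
      ultimately show ?thesis by (simp add: z_def power_divide)
    qed
    moreover have "(R powr (- 1)) ^ CARD('k) = R powr (- real CARD('k))" using R by (subst powr_power) auto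
    moreover have "(\<Prod>i\<in>UNIV. exp (- (fst \<zeta> $ i)\<^sup>2 / (2 * R\<^sup>2))) = exp (\<Sum>i\<in>UNIV. - (fst \<zeta> $ i)\<^sup>2 / (2 * R\<^sup>2))"
      by (rule exp_sum[symmetric]) simp
    ultimately show ?thesis by (simp only: prod.distrib prod_constant)
  qed
  finally have P: "(\<Prod>i\<in>UNIV. normal_density 0 R (fst \<zeta> $ i)) \<le> R powr (- real CARD('k)) * exp (- (z\<^sup>2 / 2))" .
  have "norm \<zeta> \<le> norm (fst \<zeta>) + norm (snd \<zeta>)" by (metis norm_Pair_le prod.collapse)
  also have "\<dots> \<le> R * (1 + z)" using y R by (simp add: z_def algebra_simps)
  finally have "norm \<zeta> powr c \<le> (R * (1 + z)) powr c" using c by (intro powr_mono2) auto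
  also have "\<dots> = R powr c * (1 + z) powr c" by (simp only: powr_mult)
  also have "\<dots> \<le> R powr c * (1 + z)"
    using powr_mono[of c 1 "1 + z"] c z0 by (intro mult_left_mono) auto
  finally have "norm \<zeta> powr c * (\<Prod>i\<in>UNIV. normal_density 0 R (fst \<zeta> $ i)) \<le> (R powr c * (1 + z)) * (R powr (- real CARD('k)) * exp (- (z\<^sup>2 / 2)))"
    using z0 by (intro mult_mono P) (auto intro: prod_nonneg)
  also have "\<dots> = (R powr c * R powr (- real CARD('k))) * ((1 + z) * exp (- (z\<^sup>2 / 2)))" by (simp only: mult_ac)
  also have "\<dots> \<le> (R powr c * R powr (- real CARD('k))) * 2" by (intro mult_left_mono one_plus_mult_exp_le) auto
  also have "\<dots> = 2 * R powr (c - real CARD('k))" by (simp add: powr_add[symmetric])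
  finally show ?thesis .
qed

text \<open>Both sides estimate the integral of |F|^2 over |y| <= S against Gaussian weights of
  width R in every xi_i. The left side is the mean value bound for each factor. The right side
  splits |F|^2 at the threshold T |zeta|^(-ka): below it, powers |xi_i|^(-a) are integrated against
  the weights; above it, the energy takes over. \<open>c\<close> is the surplus of the exponent k a
  (p - 1) over \<open>b\<close>.\<close>

lemma sheet_energy_scale_bound:
  fixes w :: "'k::finite \<Rightarrow> real \<Rightarrow> real"
  assumes w: "\<And>i. continuous_on UNIV (w i)" and C: "0 < C"
    and var: "\<And>i. path_variation (w i) (2 ^ j) \<le> C * (real (Suc j))\<^sup>2 / 4 ^ j"
    and p: "1 \<le> p" and fin: "sheet_energy w p b = ennreal J" "0 \<le> J"
    and a: "0 \<le> a" "a < 1" and A: "0 < A"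
      "\<And>R. 0 < R \<Longrightarrow> (\<integral>\<^sup>+x. ennreal (\<bar>x\<bar> powr (- a) * normal_density 0 R x) \<partial>lborel) \<le> ennreal (A * R powr (- a))"
    and c: "0 \<le> c" "c \<le> 1" "real CARD('k) * a * (p - 1) = b + c"
    and S: "0 < S" "S \<le> 2 ^ j" "4 * pi\<^sup>2 * C * S\<^sup>2 * (real (Suc j))\<^sup>2 \<le> kernel_const * 2 ^ j"
    and T: "0 < T"
  defines "k \<equiv> real CARD('k)" and "R \<equiv> (2::real) ^ j"
  shows "2 * S * (kernel_const / 2) powr k * R powr (- k)
    \<le> 2 * S * T * A powr k * R powr (- (k * a)) + T powr (1 - p) * 2 * R powr (c - k) * J"
proof -
  have R: "1 \<le> R" "0 < R" by (simp_all add: R_def)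
  have kc: "0 < kernel_const" by (simp add: kernel_const_def)
  define h where "h y = (indicator {- S..S} y :: ennreal)" for y :: real
  have hm[measurable]: "h \<in> borel_measurable borel" unfolding h_def by measurable
  have hint: "(\<integral>\<^sup>+y. h y * ennreal q \<partial>lborel) = ennreal (2 * S * q)" if "0 \<le> q" for q
  proof -
    have "(\<integral>\<^sup>+y. h y * ennreal q \<partial>lborel) = ennreal q * emeasure lborel {- S..S}"
      unfolding h_def by (subst mult.commute, rule nn_integral_cmult_indicator) simp
    then show ?thesis using S that by (simp add: ennreal_mult'[symmetric] mult_ac)
  qed
  have pw_real: "ennreal q ^ CARD('k) = ennreal (q powr k)" if "0 < q" for q
    using that by (simp add: ennreal_power k_def powr_realpow)
  have [measurable]: "(\<lambda>q. path_ft (w i) (fst q) (snd q)) \<in> borel_measurable borel" for i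
    by (rule borel_measurable_continuous_onI[OF continuous_path_ft[OF w]])
  have [measurable]: "(fst :: real \<times> real \<Rightarrow> real) \<in> borel_measurable borel"
    by (intro borel_measurable_continuous_onI continuous_intros)
  have [measurable]: "sheet_ft w \<in> borel_measurable borel" by (rule measurable_sheet_ft[OF w])
  define G where "G \<zeta> = (\<Prod>i\<in>UNIV. normal_density 0 R (fst \<zeta> $ i))" for \<zeta> :: "(real ^ 'k) \<times> real"
  have G0: "0 \<le> G \<zeta>" for \<zeta> unfolding G_def by (intro prod_nonneg) simp
  have sndm[measurable]: "(snd :: (real ^ 'k) \<times> real \<Rightarrow> real) \<in> borel_measurable borel"
    by (intro borel_measurable_continuous_onI continuous_intros)
  have Gm[measurable]: "G \<in> borel_measurable borel"
  proof -
    have "(\<lambda>\<zeta> :: (real ^ 'k) \<times> real. fst \<zeta> $ i) \<in> borel_measurable borel" for i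
      by (intro borel_measurable_continuous_onI continuous_intros)
    from measurable_compose[OF this borel_measurable_normal_density] show ?thesis
      unfolding G_def by (intro borel_measurable_prod)
  qed
  define L where "L = (\<integral>\<^sup>+\<zeta>. h (snd \<zeta>) * ennreal ((norm (sheet_ft w \<zeta>))\<^sup>2 * G \<zeta>) \<partial>lborel)"
  define L1 where "L1 = (\<integral>\<^sup>+\<zeta>. h (snd \<zeta>) * ennreal ((\<Prod>i\<in>UNIV. \<bar>fst \<zeta> $ i\<bar> powr (- a)) * G \<zeta>) \<partial>(lborel :: ((real ^ 'k) \<times> real) measure))"
  have lower: "ennreal (2 * S * (kernel_const / 2) powr k * R powr (- k)) \<le> L"
  proof -
    define g where "g i x y = ennreal ((norm (path_ft (w i) x y))\<^sup>2 * normal_density 0 R x)" for i x y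
    have gm: "(\<lambda>q. g i (fst q) (snd q)) \<in> borel_measurable borel" for i unfolding g_def by measurable
    have gl: "ennreal (kernel_const / 2 / R) \<le> (\<integral>\<^sup>+x. g i x y \<partial>lborel)" if y: "y \<in> {- S..S}" for i y
    proof -
      have "y\<^sup>2 \<le> S\<^sup>2" using y by (intro abs_le_square_iff[THEN iffD1]) auto
      then have "4 * pi\<^sup>2 * C * y\<^sup>2 * (real (Suc j))\<^sup>2 \<le> 4 * pi\<^sup>2 * C * S\<^sup>2 * (real (Suc j))\<^sup>2"
        using C by (intro mult_right_mono mult_left_mono) auto
      then have "4 * pi\<^sup>2 * C * y\<^sup>2 * (real (Suc j))\<^sup>2 \<le> kernel_const * 2 ^ j" using S(3) by linarith
      from nn_integral_path_ft_sq_normal_ge[OF w C var this] show ?thesis by (simp add: g_def R_def)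
    qed
    have "(\<integral>\<^sup>+y. h y * ennreal ((kernel_const / 2 / R) powr k) \<partial>lborel) \<le> (\<integral>\<^sup>+y. h y * (\<Prod>i\<in>UNIV. \<integral>\<^sup>+x. g i x y \<partial>lborel) \<partial>lborel)"
    proof (rule nn_integral_mono)
      fix y :: real
      show "h y * ennreal ((kernel_const / 2 / R) powr k) \<le> h y * (\<Prod>i\<in>UNIV. \<integral>\<^sup>+x. g i x y \<partial>lborel)"
      proof (cases "y \<in> {- S..S}")
        case True
        have "ennreal ((kernel_const / 2 / R) powr k) = (\<Prod>i\<in>(UNIV::'k set). ennreal (kernel_const / 2 / R))"
          using pw_real[of "kernel_const / 2 / R"] kc R by simp
        also have "\<dots> \<le> (\<Prod>i\<in>UNIV. \<integral>\<^sup>+x. g i x y \<partial>lborel)" by (rule prod_mono_ennreal) (rule gl[OF True])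
        finally show ?thesis by (intro mult_left_mono) auto
      qed (simp add: h_def)
    qed
    also have "\<dots> = (\<integral>\<^sup>+\<zeta>. h (snd \<zeta>) * (\<Prod>i\<in>UNIV. g i (fst \<zeta> $ i) (snd \<zeta>)) \<partial>(lborel :: ((real ^ 'k) \<times> real) measure))"
      by (rule nn_integral_pair_product[OF gm hm, symmetric])
    also have "\<dots> = L"
      unfolding L_def g_def G_def sheet_ft_def prod_norm[symmetric]
      by (simp add: prod_ennreal prod.distrib prod_power_distrib)
    finally have "ennreal (2 * S * (kernel_const / 2 / R) powr k) \<le> L" by (simp add: hint)
    moreover have "(kernel_const / 2 / R) powr k = (kernel_const / 2) powr k * R powr (- k)"
    proof -
      have "(1 / R) powr k = R powr (- k)" using R by (simp add: powr_divide powr_minus_divide)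
      moreover have "kernel_const / 2 / R = kernel_const / 2 * (1 / R)" by simp
      ultimately show ?thesis by (simp only: powr_mult)
    qed
    ultimately show ?thesis by (simp add: mult.assoc)
  qed
  have upper1: "L1 \<le> ennreal (2 * S * (A powr k * R powr (- (k * a))))"
  proof -
    define g where "g i x y = ennreal (\<bar>x\<bar> powr (- a) * normal_density 0 R x)" for i :: 'k and x and y :: real
    have gm: "(\<lambda>q. g i (fst q) (snd q)) \<in> borel_measurable borel" for i unfolding g_def by measurable
    have "L1 = (\<integral>\<^sup>+\<zeta>. h (snd \<zeta>) * (\<Prod>i\<in>UNIV. g i (fst \<zeta> $ i) (snd \<zeta>)) \<partial>(lborel :: ((real ^ 'k) \<times> real) measure))"
      unfolding L1_def g_def G_def by (simp add: prod_ennreal prod.distrib)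
    also have "\<dots> = (\<integral>\<^sup>+y. h y * (\<Prod>i\<in>UNIV. \<integral>\<^sup>+x. g i x y \<partial>lborel) \<partial>lborel)"
      by (rule nn_integral_pair_product[OF gm hm])
    also have "\<dots> \<le> (\<integral>\<^sup>+y. h y * ennreal ((A * R powr (- a)) powr k) \<partial>lborel)"
    proof (intro nn_integral_mono mult_left_mono)
      fix y :: real
      have "(\<Prod>i\<in>(UNIV::'k set). \<integral>\<^sup>+x. g i x y \<partial>lborel) \<le> (\<Prod>i\<in>(UNIV::'k set). ennreal (A * R powr (- a)))"
        unfolding g_def using R by (intro prod_mono_ennreal A(2))
      also have "\<dots> = ennreal ((A * R powr (- a)) powr k)" using pw_real[of "A * R powr (- a)"] A R by simp
      finally show "(\<Prod>i\<in>UNIV. \<integral>\<^sup>+x. g i x y \<partial>lborel) \<le> ennreal ((A * R powr (- a)) powr k)" .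
    qed simp
    also have "\<dots> = ennreal (2 * S * (A * R powr (- a)) powr k)" by (rule hint) simp
    also have "(A * R powr (- a)) powr k = A powr k * R powr (- (k * a))"
      by (simp only: powr_mult powr_powr) (simp add: mult.commute)
    finally show ?thesis .
  qed
  \<comment> \<open>No coordinate exceeds the norm, so |zeta|^(-ka) is at most the product of the
    |xi_i|^(-a); this needs nonzero coordinates, hence almost everywhere. The surplus |zeta|^c is
    paid for by the Gaussian weights.\<close>
  have split: "AE \<zeta> in (lborel :: ((real ^ 'k) \<times> real) measure). h (snd \<zeta>) * ennreal ((norm (sheet_ft w \<zeta>))\<^sup>2 * G \<zeta>)
      \<le> ennreal T * (h (snd \<zeta>) * ennreal ((\<Prod>i\<in>UNIV. \<bar>fst \<zeta> $ i\<bar> powr (- a)) * G \<zeta>))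
        + ennreal (T powr (1 - p) * 2 * R powr (c - k)) * ennreal (norm (sheet_ft w \<zeta>) powr (2 * p) * norm \<zeta> powr b)"
    using AE_inner_Basis_nonzero
  proof eventually_elim
    case (elim \<zeta>)
    show ?case
    proof (cases "snd \<zeta> \<in> {- S..S}")
      case False
      then show ?thesis by (simp add: h_def)
    next
      case True
      have nz: "fst \<zeta> $ i \<noteq> 0" for i
      proof -
        have "(axis i 1, 0) \<in> (Basis :: ((real ^ 'k) \<times> real) set)" by (auto simp: Basis_prod_def Basis_vec_real)
        then have "\<zeta> \<bullet> (axis i 1, 0) \<noteq> 0" using elim by blast
        then show ?thesis by (simp add: inner_prod_def inner_axis)
      qed
      have n0: "0 < norm \<zeta>" using nz by (metis fst_zero norm_eq_zero norm_ge_zero order_le_less zero_index)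
      define n where "n = norm (sheet_ft w \<zeta>)"
      define P where "P = (\<Prod>i\<in>UNIV. \<bar>fst \<zeta> $ i\<bar> powr (- a))"
      have P0: "0 \<le> P" unfolding P_def by (intro prod_nonneg) simp
      have np: "n powr (2 * p) = (n\<^sup>2) powr p"
      proof (cases "n = 0")
        case False
        then have "n\<^sup>2 = n powr 2" by (simp add: n_def)
        then show ?thesis by (simp only: powr_powr)
      qed (use p in simp)
      have "n\<^sup>2 \<le> T * norm \<zeta> powr (- (k * a)) + T powr (1 - p) * (n powr (2 * p) * norm \<zeta> powr (k * a * (p - 1)))"
        unfolding np using n0 T p by (intro split_le) auto
      then have "n\<^sup>2 * G \<zeta> \<le> (T * norm \<zeta> powr (- (k * a)) + T powr (1 - p) * (n powr (2 * p) * norm \<zeta> powr (k * a * (p - 1)))) * G \<zeta>"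
        by (intro mult_right_mono G0)
      also have "\<dots> = T * (norm \<zeta> powr (- (k * a)) * G \<zeta>) + T powr (1 - p) * (n powr (2 * p) * norm \<zeta> powr b) * (norm \<zeta> powr c * G \<zeta>)"
      proof -
        have "norm \<zeta> powr (k * a * (p - 1)) = norm \<zeta> powr b * norm \<zeta> powr c"
          using c(3) by (simp add: k_def powr_add)
        then show ?thesis by (simp only: distrib_left distrib_right mult_ac)
      qed
      also have "\<dots> \<le> T * (P * G \<zeta>) + T powr (1 - p) * (n powr (2 * p) * norm \<zeta> powr b) * (2 * R powr (c - k))"
      proof (intro add_mono mult_left_mono mult_right_mono G0)
        have "norm \<zeta> powr (- (k * a)) = (norm \<zeta> powr (- a)) powr k" by (simp add: powr_powr mult.commute)
        also have "\<dots> = (\<Prod>i\<in>(UNIV::'k set). norm \<zeta> powr (- a))" using n0 by (simp add: k_def powr_realpow)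
        also have "\<dots> \<le> P" unfolding P_def
        proof (intro prod_mono conjI powr_mono2')
          fix i
          have "\<bar>fst \<zeta> $ i\<bar> \<le> norm (fst \<zeta>)" by (rule component_le_norm_cart)
          also have "\<dots> \<le> norm \<zeta>" by (rule norm_fst_le[of "fst \<zeta>" "snd \<zeta>", simplified])
          finally show "\<bar>fst \<zeta> $ i\<bar> \<le> norm \<zeta>" .
        qed (use nz a in auto)
        finally show "norm \<zeta> powr (- (k * a)) \<le> P" .
        show "norm \<zeta> powr c * G \<zeta> \<le> 2 * R powr (c - k)"
          unfolding G_def k_def using True S(2) R c by (intro norm_powr_mult_normal_le) (auto simp: R_def)
      qed (use T in auto)
      also have "\<dots> = T * (P * G \<zeta>) + (T powr (1 - p) * 2 * R powr (c - k)) * (n powr (2 * p) * norm \<zeta> powr b)" by (simp add: mult_ac)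
      finally have "ennreal (n\<^sup>2 * G \<zeta>) \<le> ennreal (T * (P * G \<zeta>) + (T powr (1 - p) * 2 * R powr (c - k)) * (n powr (2 * p) * norm \<zeta> powr b))"
        by (rule ennreal_leI)
      also have "\<dots> = ennreal T * ennreal (P * G \<zeta>) + ennreal (T powr (1 - p) * 2 * R powr (c - k)) * ennreal (n powr (2 * p) * norm \<zeta> powr b)"
        using T P0 G0[of \<zeta>] by (simp add: ennreal_plus ennreal_mult)
      finally show ?thesis using True by (simp add: h_def n_def P_def)
    qed
  qed
  have Pm: "(\<lambda>\<zeta> :: (real ^ 'k) \<times> real. \<Prod>i\<in>UNIV. \<bar>fst \<zeta> $ i\<bar> powr (- a)) \<in> borel_measurable borel"
  proof (intro borel_measurable_prod)
    fix i
    have [measurable]: "(\<lambda>\<zeta> :: (real ^ 'k) \<times> real. fst \<zeta> $ i) \<in> borel_measurable borel"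
      by (intro borel_measurable_continuous_onI continuous_intros)
    show "(\<lambda>\<zeta> :: (real ^ 'k) \<times> real. \<bar>fst \<zeta> $ i\<bar> powr (- a)) \<in> borel_measurable borel" by measurable
  qed
  note [measurable] = Pm
  have "L \<le> ennreal T * L1 + ennreal (T powr (1 - p) * 2 * R powr (c - k)) * sheet_energy w p b"
  proof -
    have "L \<le> (\<integral>\<^sup>+\<zeta>. ennreal T * (h (snd \<zeta>) * ennreal ((\<Prod>i\<in>UNIV. \<bar>fst \<zeta> $ i\<bar> powr (- a)) * G \<zeta>))
        + ennreal (T powr (1 - p) * 2 * R powr (c - k)) * ennreal (norm (sheet_ft w \<zeta>) powr (2 * p) * norm \<zeta> powr b) \<partial>lborel)"
      unfolding L_def by (rule nn_integral_mono_AE[OF split])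
    also have "\<dots> = ennreal T * L1 + ennreal (T powr (1 - p) * 2 * R powr (c - k)) * sheet_energy w p b"
      unfolding L1_def sheet_energy_def
      by (subst nn_integral_add, measurable) (simp add: nn_integral_cmult)
    finally show ?thesis .
  qed
  also have "\<dots> \<le> ennreal T * ennreal (2 * S * (A powr k * R powr (- (k * a)))) + ennreal (T powr (1 - p) * 2 * R powr (c - k)) * ennreal J"
    unfolding fin(1) by (intro add_mono mult_left_mono upper1) auto
  also have "\<dots> = ennreal (T * (2 * S * (A powr k * R powr (- (k * a)))) + T powr (1 - p) * 2 * R powr (c - k) * J)"
    using T S fin(2) by (simp add: ennreal_mult'[symmetric] ennreal_plus[symmetric] del: ennreal_plus)
  finally have "ennreal (2 * S * (kernel_const / 2) powr k * R powr (- k)) \<le> ennreal (T * (2 * S * (A powr k * R powr (- (k * a)))) + T powr (1 - p) * 2 * R powr (c - k) * J)"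
    using lower by (rule order_trans[rotated])
  then have "2 * S * (kernel_const / 2) powr k * R powr (- k) \<le> T * (2 * S * (A powr k * R powr (- (k * a)))) + T powr (1 - p) * 2 * R powr (c - k) * J"
    using T S fin(2) by (subst (asm) ennreal_le_iff) (auto intro!: add_nonneg_nonneg mult_nonneg_nonneg)
  then show ?thesis by (simp only: mult_ac)
qed

text \<open>A finite energy is tested at all dyadic scales R = 2^j with S close to sqrt R, the
  largest range allowed by the mean value bound. The parameters are tuned so that the low part of
  the splitting uses half of the lower bound, and the rest reads R^(1/2 - kappa) <= M (j + 1), which
  is false for large j.\<close>

lemma sheet_energy_infinite_variation:
  fixes w :: "'k::finite \<Rightarrow> real \<Rightarrow> real"
  assumes w: "\<And>i. continuous_on UNIV (w i)"
    and var: "\<And>i. \<exists>C>0. \<forall>j. path_variation (w i) (2 ^ j) \<le> C * (real (Suc j))\<^sup>2 / 4 ^ j"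
    and p: "1 \<le> p" and b: "real CARD('k) * (p - 1) - 1/2 < b"
  shows "sheet_energy w p b = \<infinity>"
proof (rule ccontr)
  assume "\<not> ?thesis"
  then have fin: "sheet_energy w p b < \<infinity>" by (simp add: less_top)
  let ?k = "real CARD('k)"
  have k: "1 \<le> ?k" using one_le_card_finite[where ?'a='k] by (simp del: one_le_card_finite)
  \<comment> \<open>The exponent is first lowered to \<open>b0\<close>, just above the critical
    value, so that kappa lies in [1/4, 1/2): below 1/2 for the final contradiction, positive and
    small enough for the surplus \<open>c\<close> to fall in [0, 1].\<close>
  define \<rho> where "\<rho> = min (1/4) (b - (?k * (p - 1) - 1/2))"
  define \<kappa> where "\<kappa> = 1/2 - \<rho>"
  define b0 where "b0 = ?k * (p - 1) - \<kappa>"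
  have \<rho>: "0 < \<rho>" "\<rho> \<le> 1/4" "\<rho> \<le> b - (?k * (p - 1) - 1/2)"
  proof -
    show "0 < \<rho>" using b by (simp add: \<rho>_def)
    show "\<rho> \<le> 1/4" unfolding \<rho>_def by (rule min.cobounded1)
    show "\<rho> \<le> b - (?k * (p - 1) - 1/2)" unfolding \<rho>_def by (rule min.cobounded2)
  qed
  have \<kappa>: "1/4 \<le> \<kappa>" "\<kappa> < 1/2" using \<rho> by (auto simp: \<kappa>_def)
  have kp: "0 \<le> ?k * (p - 1)" using k p by simp
  have "sheet_energy w p b0 < \<infinity>"
  proof (rule sheet_energy_antimono[OF w _ _ _ fin])
    have "real DIM((real ^ 'k) \<times> real) = ?k + 1" by simp
    then show "- real DIM((real ^ 'k) \<times> real) < b0" using kp \<kappa> k unfolding b0_def by linarith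
    show "b0 \<le> b" using \<rho>(3) by (simp add: b0_def \<kappa>_def)
  qed (use p in auto)
  then obtain J where J: "sheet_energy w p b0 = ennreal J" "0 \<le> J" by (cases "sheet_energy w p b0") auto
  obtain C1 where C1: "\<And>i. 0 < C1 i" "\<And>i j. path_variation (w i) (2 ^ j) \<le> C1 i * (real (Suc j))\<^sup>2 / 4 ^ j"
    using var by metis
  define C where "C = (\<Sum>i\<in>UNIV. C1 i)"
  have C: "0 < C" unfolding C_def using C1(1) by (intro sum_pos) auto
  have varC: "path_variation (w i) (2 ^ j) \<le> C * (real (Suc j))\<^sup>2 / 4 ^ j" for i j
  proof -
    have "C1 i \<le> C" unfolding C_def using C1(1) by (intro member_le_sum) (auto intro: less_imp_le)
    then have "C1 i * (real (Suc j))\<^sup>2 / 4 ^ j \<le> C * (real (Suc j))\<^sup>2 / 4 ^ j" by (intro divide_right_mono mult_right_mono) auto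
    then show ?thesis using C1(2)[of i j] by linarith
  qed
  \<comment> \<open>Then delta (p - 1) is at most kappa / 2, so that c = kappa - delta (p - 1) is
    nonnegative.\<close>
  define \<delta> where "\<delta> = \<kappa> / (2 * p)"
  have \<delta>: "0 < \<delta>" "\<delta> \<le> \<kappa> / 2" using \<kappa> p by (auto simp: \<delta>_def field_simps)
  have \<delta>p: "\<delta> * (p - 1) \<le> \<kappa> / 2" "0 \<le> \<delta> * (p - 1)"
  proof -
    have "\<delta> * p = \<kappa> / 2" using p by (simp add: \<delta>_def)
    then show "\<delta> * (p - 1) \<le> \<kappa> / 2" using \<delta> by (simp add: right_diff_distrib)
    show "0 \<le> \<delta> * (p - 1)" using \<delta> p by simp
  qed
  \<comment> \<open>Just below the critical exponent 1, with k a = k - delta; the missing power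
    R^(-delta) is supplied by the threshold \<open>T\<close>.\<close>
  define a where "a = (?k - \<delta>) / ?k"
  have ka: "?k * a = ?k - \<delta>" using k by (simp add: a_def)
  have a: "0 \<le> a" "a < 1"
  proof -
    have "0 \<le> ?k - \<delta>" using k \<delta> \<kappa> by linarith
    then show "0 \<le> a" unfolding a_def by (rule divide_nonneg_nonneg) simp
    show "a < 1" using k \<delta> by (simp add: a_def)
  qed
  define c where "c = \<kappa> - \<delta> * (p - 1)"
  have c: "0 \<le> c" "c \<le> 1" using \<delta>p \<kappa> by (auto simp: c_def)
  have c3: "?k * a * (p - 1) = b0 + c" unfolding ka by (simp add: b0_def c_def algebra_simps)
  obtain A where A: "0 < A" "\<And>R. 0 < R \<Longrightarrow> (\<integral>\<^sup>+x. ennreal (\<bar>x\<bar> powr (- a) * normal_density 0 R x) \<partial>lborel) \<le> ennreal (A * R powr (- a))"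
    using nn_integral_powr_normal[OF a] by blast
  define q where "q = (kernel_const / 2) powr ?k"
  have kc: "0 < kernel_const" by (simp add: kernel_const_def)
  have q: "0 < q" using kc by (simp add: q_def)
  \<comment> \<open>Chosen so that the first term on the right of the scale bound is exactly half of
    the left side.\<close>
  define \<tau> where "\<tau> = q / (2 * A powr ?k)"
  have \<tau>: "0 < \<tau>" using q A by (simp add: \<tau>_def)
  \<comment> \<open>The minimum with 1 ensures S <= R, the square root the condition on y in the
    mean value bound.\<close>
  define \<sigma> where "\<sigma> = min 1 (sqrt (kernel_const / (4 * pi\<^sup>2 * C)))"
  have \<sigma>: "0 < \<sigma>" "\<sigma> \<le> 1" using kc C by (auto simp: \<sigma>_def)
  have \<sigma>2: "4 * pi\<^sup>2 * C * \<sigma>\<^sup>2 \<le> kernel_const"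
  proof -
    have D: "0 < 4 * pi\<^sup>2 * C" using C by simp
    have "\<sigma>\<^sup>2 \<le> (sqrt (kernel_const / (4 * pi\<^sup>2 * C)))\<^sup>2" using \<sigma> by (intro power_mono) (auto simp: \<sigma>_def)
    also have "\<dots> = kernel_const / (4 * pi\<^sup>2 * C)" using kc C by simp
    finally show ?thesis using D by (simp add: pos_le_divide_eq mult.commute)
  qed
  define M where "M = 2 * \<tau> powr (1 - p) * J / (q * \<sigma>)"
  have main: "2 powr (real j * (1/2 - \<kappa>)) \<le> M * real (Suc j)" for j
  proof -
    define R :: real where "R = 2 ^ j"
    define n where "n = real (Suc j)"
    \<comment> \<open>The division by n = j + 1 compensates the logarithmic loss in the variation
      bound.\<close>
    define S where "S = \<sigma> * sqrt R / n"
    define T where "T = \<tau> * R powr (- \<delta>)"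
    have R: "1 \<le> R" "0 < R" by (simp_all add: R_def)
    have n: "1 \<le> n" by (simp add: n_def)
    have S0: "0 < S" using \<sigma> R n by (simp add: S_def)
    have S1: "S \<le> 2 ^ j"
    proof -
      have "S \<le> \<sigma> * sqrt R / 1" unfolding S_def using n \<sigma> R by (intro divide_left_mono) auto
      also have "\<dots> \<le> 1 * sqrt R" using \<sigma> R by simp
      also have "\<dots> \<le> R" using R by (simp add: real_le_lsqrt power2_eq_square)
      finally show ?thesis by (simp add: R_def)
    qed
    have S2: "4 * pi\<^sup>2 * C * S\<^sup>2 * (real (Suc j))\<^sup>2 \<le> kernel_const * 2 ^ j"
    proof -
      have "S\<^sup>2 * n\<^sup>2 = \<sigma>\<^sup>2 * R" using R n by (simp add: S_def power_divide power_mult_distrib)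
      then have "4 * pi\<^sup>2 * C * S\<^sup>2 * n\<^sup>2 = (4 * pi\<^sup>2 * C * \<sigma>\<^sup>2) * R" by (simp only: mult.assoc)
      also have "\<dots> \<le> kernel_const * R" using \<sigma>2 R by (intro mult_right_mono) auto
      finally show ?thesis by (simp add: R_def n_def)
    qed
    have T: "0 < T" using \<tau> R by (simp add: T_def)
    have "2 * S * q * R powr (- ?k) \<le> 2 * S * T * A powr ?k * R powr (- (?k * a)) + T powr (1 - p) * 2 * R powr (c - ?k) * J"
      unfolding q_def R_def by (rule sheet_energy_scale_bound[OF w C varC p J a A c c3 S0 S1 S2 T])
    also have "2 * S * T * A powr ?k * R powr (- (?k * a)) = S * q * R powr (- ?k)"
    proof -
      have e: "R powr (- \<delta>) * R powr (- (?k * a)) = R powr (- ?k)" unfolding powr_add[symmetric] ka by simp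
      have "2 * S * T * A powr ?k * R powr (- (?k * a)) = 2 * S * \<tau> * A powr ?k * (R powr (- \<delta>) * R powr (- (?k * a)))"
        unfolding T_def by (simp only: mult_ac)
      also have "\<dots> = 2 * S * \<tau> * A powr ?k * R powr (- ?k)" unfolding e ..
      also have "\<dots> = S * q * R powr (- ?k)" using A by (simp add: \<tau>_def)
      finally show ?thesis .
    qed
    also have "T powr (1 - p) * 2 * R powr (c - ?k) * J = 2 * \<tau> powr (1 - p) * J * R powr \<kappa> * R powr (- ?k)"
    proof -
      have "T powr (1 - p) = \<tau> powr (1 - p) * R powr (\<delta> * (p - 1))"
        unfolding T_def by (simp only: powr_mult powr_powr) (simp add: algebra_simps)
      then have "T powr (1 - p) * 2 * R powr (c - ?k) * J = 2 * \<tau> powr (1 - p) * J * (R powr (\<delta> * (p - 1)) * R powr (c - ?k))"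
        by (simp only: mult_ac)
      also have "R powr (\<delta> * (p - 1)) * R powr (c - ?k) = R powr \<kappa> * R powr (- ?k)"
        unfolding powr_add[symmetric] c_def by simp
      finally show ?thesis by (simp only: mult_ac)
    qed
    finally have "S * q * R powr (- ?k) \<le> (2 * \<tau> powr (1 - p) * J * R powr \<kappa>) * R powr (- ?k)" by simp
    then have "S * q \<le> 2 * \<tau> powr (1 - p) * J * R powr \<kappa>" using R by (simp add: mult_le_cancel_right)
    then have "\<sigma> * sqrt R * q \<le> 2 * \<tau> powr (1 - p) * J * R powr \<kappa> * n"
      using n by (simp add: S_def field_simps)
    then have "sqrt R \<le> M * R powr \<kappa> * n" using q \<sigma> by (simp add: M_def field_simps)
    then have "sqrt R * R powr (- \<kappa>) \<le> M * R powr \<kappa> * n * R powr (- \<kappa>)" using R by (intro mult_right_mono) auto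
    also have "\<dots> = M * n * (R powr \<kappa> * R powr (- \<kappa>))" by (simp only: mult_ac)
    also have "R powr \<kappa> * R powr (- \<kappa>) = 1" using R by (simp add: powr_add[symmetric])
    also have "sqrt R * R powr (- \<kappa>) = R powr (1/2 - \<kappa>)"
      using R by (simp add: powr_half_sqrt[symmetric] powr_add[symmetric])
    also have "R powr (1/2 - \<kappa>) = 2 powr (real j * (1/2 - \<kappa>))"
      by (simp add: R_def powr_powr flip: powr_realpow)
    finally show ?thesis by (simp add: n_def)
  qed
  define u where "u = 2 powr (1/2 - \<kappa>)"
  have u: "1 < u" using \<kappa> by (simp add: u_def)
  \<comment> \<open>A geometric sequence with ratio above 1 would be bounded by a linear
    one.\<close>
  have main': "u ^ j \<le> M * real (Suc j)" for j
    using main[of j] by (simp add: u_def powr_power mult.commute)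
  have "(\<lambda>j. u * (real (Suc j) / u ^ Suc j)) \<longlonglongrightarrow> u * 0"
    using u by (intro tendsto_mult tendsto_const LIMSEQ_Suc lim_n_over_pown) simp
  then have "(\<lambda>j. real (Suc j) / u ^ j) \<longlonglongrightarrow> 0" using u by simp
  moreover have "1 \<le> M * (real (Suc j) / u ^ j)" for j using main'[of j] u by (simp add: field_simps)
  ultimately have "1 \<le> M * 0"
    by (intro LIMSEQ_le_const[OF tendsto_mult[OF tendsto_const]]) auto
  then show False by simp
qed

section \<open>The Fourier spectrum\<close>

text \<open>The interface between probability and analysis: the decay bound yields finite energies,
  continuity the divergence at the jump, and the variation bound the other divergence.\<close>

definition brownian_like_path :: "(real \<Rightarrow> real) \<Rightarrow> bool" where
  "brownian_like_path w \<longleftrightarrow> continuous_on UNIV w \<and>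
     (\<forall>\<epsilon>>0. \<exists>K>0. \<forall>x y. (norm (path_ft w x y))\<^sup>2 \<le> K * decay x y * (1 + \<bar>x\<bar> + \<bar>y\<bar>) powr \<epsilon>) \<and>
     (\<exists>C>0. \<forall>j. path_variation w (2 ^ j) \<le> C * (real (Suc j))\<^sup>2 / 4 ^ j)"

lemma AE_brownian_like_path:
  assumes bm: "standard_brownian_motion M X"
  obtains Z :: "real \<Rightarrow> 'w \<Rightarrow> real"
    where "AE \<omega> in M. brownian_like_path (\<lambda>t. Z t \<omega>) \<and> (\<forall>t\<in>{0..1}. Z t \<omega> = X t \<omega>)"
proof -
  obtain Z :: "real \<Rightarrow> 'w \<Rightarrow> real" where Z: "\<And>t. Z t \<in> borel_measurable M"
    "\<And>\<omega>. continuous_on UNIV (\<lambda>t. Z t \<omega>)" "AE \<omega> in M. \<forall>t\<in>{0..1}. Z t \<omega> = X t \<omega>"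
    using continuous_version[OF bm] by blast
  have "AE \<omega> in M. brownian_like_path (\<lambda>t. Z t \<omega>) \<and> (\<forall>t\<in>{0..1}. Z t \<omega> = X t \<omega>)"
    using AE_path_ft_bound[OF bm Z] AE_path_variation_le[OF bm Z] Z(3)
    by eventually_elim (simp add: brownian_like_path_def Z(2))
  then show ?thesis by (rule that)
qed

lemma sheet_energy_infinite:
  fixes w :: "'k::finite \<Rightarrow> real \<Rightarrow> real"
  assumes w: "\<And>i. brownian_like_path (w i)" and \<theta>: "0 < \<theta>" "\<theta> \<le> 1"
    and s: "min (real CARD('k) + \<theta> / 2) (2 + real CARD('k) * \<theta>) < s"
  shows "sheet_energy w (1 / \<theta>) (s / \<theta> - (real CARD('k) + 1)) = \<infinity>"
proof -
  let ?k = "real CARD('k)"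
  have wc: "\<And>i. continuous_on UNIV (w i)" and wv: "\<And>i. \<exists>C>0. \<forall>j. path_variation (w i) (2 ^ j) \<le> C * (real (Suc j))\<^sup>2 / 4 ^ j"
    using w by (auto simp: brownian_like_path_def)
  have p: "1 \<le> 1 / \<theta>" using \<theta> by simp
  from s consider "?k + \<theta> / 2 < s" | "2 + ?k * \<theta> < s" by (auto simp: min_def split: if_splits)
  then show ?thesis
  proof cases
    case 1
    then have "(?k + \<theta> / 2) / \<theta> < s / \<theta>" using \<theta> by (intro divide_strict_right_mono) auto
    then have "?k * (1 / \<theta> - 1) - 1/2 < s / \<theta> - (?k + 1)" using \<theta> by (simp add: add_divide_distrib right_diff_distrib)
    then show ?thesis by (rule sheet_energy_infinite_variation[OF wc wv p])
  next
    case 2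
    then have "(2 + ?k * \<theta>) / \<theta> < s / \<theta>" using \<theta> by (intro divide_strict_right_mono) auto
    then have "2 * (1 / \<theta>) - 1 < s / \<theta> - (?k + 1)" using \<theta> by (simp add: add_divide_distrib)
    then show ?thesis by (rule sheet_energy_infinite_jump[OF wc p])
  qed
qed

lemma fourier_energy_finite_iff:
  fixes w :: "'k::finite \<Rightarrow> real \<Rightarrow> real"
  assumes "fourier_transform \<mu> = sheet_ft w" and "0 < \<theta>"
  shows "fourier_energy s \<theta> \<mu> < \<infinity> \<longleftrightarrow> sheet_energy w (1 / \<theta>) (s / \<theta> - (real CARD('k) + 1)) < \<infinity>"
proof -
  have "(\<integral>\<^sup>+ \<xi>. ennreal (norm (fourier_transform \<mu> \<xi>) powr (2 / \<theta>) * norm \<xi> powr (s / \<theta> - DIM((real ^ 'k) \<times> real))) \<partial>lborel)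
    = sheet_energy w (1 / \<theta>) (s / \<theta> - (real CARD('k) + 1))"
    unfolding sheet_energy_def assms(1) by (simp add: add.commute)
  then show ?thesis
    using assms(2) by (auto simp: fourier_energy_def ennreal_pow_def less_top)
qed

lemma ennreal_le_of_approx:
  assumes "\<And>\<kappa>. 0 < \<kappa> \<Longrightarrow> \<kappa> \<le> 1/2 \<Longrightarrow> ennreal (m - \<kappa>) \<le> S"
  shows "ennreal m \<le> S"
proof (cases S)
  case (real r)
  have "m \<le> r"
  proof (rule ccontr)
    assume "\<not> m \<le> r"
    define \<kappa> where "\<kappa> = min (1/2) ((m - r) / 2)"
    have "0 < \<kappa>" "\<kappa> \<le> 1/2" "\<kappa> < m - r" using \<open>\<not> m \<le> r\<close> by (auto simp: \<kappa>_def min_def)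
    then show False using assms[of \<kappa>] real by (simp add: ennreal_le_iff)
  qed
  then show ?thesis using real by (simp add: ennreal_leI)
qed simp

lemma fourier_spectrum_sheet_pos:
  fixes w :: "'k::finite \<Rightarrow> real \<Rightarrow> real" and \<mu> :: "((real ^ 'k) \<times> real) measure"
  assumes w: "\<And>i. brownian_like_path (w i)" and ft: "fourier_transform \<mu> = sheet_ft w" and \<theta>: "0 < \<theta>" "\<theta> \<le> 1"
  shows "fourier_spectrum \<mu> \<theta> = ennreal (min (real CARD('k) + \<theta> / 2) (2 + real CARD('k) * \<theta>))"
proof (rule antisym)
  let ?k = "real CARD('k)"
  define m where "m = min (?k + \<theta> / 2) (2 + ?k * \<theta>)"
  have k: "1 \<le> ?k" using one_le_card_finite[where ?'a='k] by (simp del: one_le_card_finite)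
  have k\<theta>: "0 \<le> ?k * \<theta>" using \<theta> by simp
  have "1 \<le> ?k + \<theta> / 2" "1 \<le> 2 + ?k * \<theta>" using k k\<theta> \<theta> by linarith+
  then have m1: "1 \<le> m" by (simp only: m_def min.bounded_iff)
  show "fourier_spectrum \<mu> \<theta> \<le> ennreal m"
    unfolding fourier_spectrum_def
  proof (rule SUP_least)
    fix s assume "s \<in> {s. s > 0 \<and> fourier_energy s \<theta> \<mu> < \<infinity>}"
    then have "sheet_energy w (1 / \<theta>) (s / \<theta> - (?k + 1)) < \<infinity>"
      using fourier_energy_finite_iff[OF ft \<theta>(1)] by simp
    then have "\<not> m < s" using sheet_energy_infinite[of w \<theta> s, OF w \<theta>] by (auto simp: m_def)
    then show "ennreal s \<le> ennreal m" by (intro ennreal_leI) simp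
  qed
  show "ennreal m \<le> fourier_spectrum \<mu> \<theta>"
  proof (rule ennreal_le_of_approx)
    fix \<kappa> :: real assume \<kappa>: "0 < \<kappa>" "\<kappa> \<le> 1/2"
    \<comment> \<open>The reduction is scaled by theta so that the exponent s / theta loses exactly
      kappa.\<close>
    define s where "s = m - \<kappa> * \<theta>"
    have \<kappa>\<theta>: "\<kappa> * \<theta> \<le> \<kappa> * 1" using \<kappa> \<theta> by (intro mult_left_mono) auto
    then have s0: "0 < s" using m1 \<kappa> unfolding s_def by linarith
    have sm: "s / \<theta> = m / \<theta> - \<kappa>" using \<theta> by (simp add: s_def diff_divide_distrib)
    have a1: "?k * (1 / \<theta> - 1) - 1/2 = (?k + \<theta> / 2) / \<theta> - (?k + 1)" using \<theta> by (simp add: add_divide_distrib right_diff_distrib)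
    have a2: "2 * (1 / \<theta>) - 1 = (2 + ?k * \<theta>) / \<theta> - (?k + 1)" using \<theta> by (simp add: add_divide_distrib)
    have m_le: "m / \<theta> \<le> (?k + \<theta> / 2) / \<theta>" "m / \<theta> \<le> (2 + ?k * \<theta>) / \<theta>"
      using \<theta> by (auto simp: m_def intro!: divide_right_mono)
    have p: "1 \<le> 1 / \<theta>" using \<theta> by simp
    have "sheet_energy w (1 / \<theta>) (s / \<theta> - (?k + 1)) < \<infinity>"
    proof (rule sheet_energy_finite[OF _ p \<kappa>])
      show "\<And>i \<epsilon>. 0 < \<epsilon> \<Longrightarrow> \<exists>K>0. \<forall>x y. (norm (path_ft (w i) x y))\<^sup>2 \<le> K * decay x y * (1 + \<bar>x\<bar> + \<bar>y\<bar>) powr \<epsilon>"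
        using w by (auto simp: brownian_like_path_def)
      show "s / \<theta> - (?k + 1) \<le> ?k * (1 / \<theta> - 1) - 1/2 - \<kappa>" unfolding sm a1 using m_le(1) by simp
      show "s / \<theta> - (?k + 1) \<le> 2 * (1 / \<theta>) - 1 - \<kappa>" unfolding sm a2 using m_le(2) by simp
      have "0 \<le> ?k * (1 / \<theta> - 1)" using p k by (intro mult_nonneg_nonneg) auto
      then have "?k + 1/2 \<le> (?k + \<theta> / 2) / \<theta>" using a1 by simp
      moreover have "?k + 1/2 \<le> (2 + ?k * \<theta>) / \<theta>"
      proof -
        have "?k + 1 \<le> (2 + ?k * \<theta>) / \<theta> " using a2 p by simp
        then show ?thesis by simp
      qed
      ultimately have "?k + 1/2 \<le> m / \<theta>" by (auto simp: m_def min_def)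
      then show "- 1/2 - \<kappa> \<le> s / \<theta> - (?k + 1)" unfolding sm by simp
    qed
    then have "fourier_energy s \<theta> \<mu> < \<infinity>" using fourier_energy_finite_iff[OF ft \<theta>(1)] by simp
    then have "ennreal s \<le> fourier_spectrum \<mu> \<theta>"
      unfolding fourier_spectrum_def using s0 by (intro SUP_upper) auto
    moreover have "ennreal (m - \<kappa>) \<le> ennreal s" using \<kappa>\<theta> by (intro ennreal_leI) (simp add: s_def)
    ultimately show "ennreal (m - \<kappa>) \<le> fourier_spectrum \<mu> \<theta>" by (rule order_trans[rotated])
  qed
qed

text \<open>A finite supremum with exponent s means polynomial decay of the transform, which makes
  the energies with any smaller exponent s' finite for every theta. As theta tends to 0 the
  divergence threshold tends to min(k, 2), so s cannot exceed it. Below it,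
  \<open>sheet_ft_powr_le\<close> with l = 0 and p = 1 bounds the supremum.\<close>

lemma fourier_spectrum_sheet_0:
  fixes w :: "'k::finite \<Rightarrow> real \<Rightarrow> real" and \<mu> :: "((real ^ 'k) \<times> real) measure"
  assumes w: "\<And>i. brownian_like_path (w i)" and ft: "fourier_transform \<mu> = sheet_ft w"
  shows "fourier_spectrum \<mu> 0 = ennreal (min (real CARD('k)) 2)"
proof (rule antisym)
  let ?k = "real CARD('k)"
  define m where "m = min ?k 2"
  have k: "1 \<le> ?k" using one_le_card_finite[where ?'a='k] by (simp del: one_le_card_finite)
  have m1: "1 \<le> m" "m \<le> ?k" "m \<le> 2" using k by (auto simp: m_def)
  show "fourier_spectrum \<mu> 0 \<le> ennreal m"
    unfolding fourier_spectrum_def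
  proof (rule SUP_least)
    fix s assume "s \<in> {s. s > 0 \<and> fourier_energy s 0 \<mu> < \<infinity>}"
    then have s: "0 < s" and fin: "(SUP \<zeta>. ennreal ((norm (sheet_ft w \<zeta>))\<^sup>2 * norm \<zeta> powr s)) < \<infinity>"
      by (auto simp: fourier_energy_def ft)
    then obtain C where C: "(SUP \<zeta>. ennreal ((norm (sheet_ft w \<zeta>))\<^sup>2 * norm \<zeta> powr s)) = ennreal C" "0 \<le> C"
      by (cases "SUP \<zeta>. ennreal ((norm (sheet_ft w \<zeta>))\<^sup>2 * norm \<zeta> powr s)") auto
    have bd: "(norm (sheet_ft w \<zeta>))\<^sup>2 * norm \<zeta> powr s \<le> C" for \<zeta>
    proof -
      have "ennreal ((norm (sheet_ft w \<zeta>))\<^sup>2 * norm \<zeta> powr s) \<le> ennreal C"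
        unfolding C(1)[symmetric] by (rule SUP_upper) simp
      then show ?thesis using C(2) by (simp add: ennreal_le_iff)
    qed
    have "s \<le> m"
    proof (rule ccontr)
      assume "\<not> s \<le> m"
      then have sm: "m < s" by simp
      define s' where "s' = (s + m) / 2"
      have s': "m < s'" "s' < s" "0 < s'" using sm m1 by (auto simp: s'_def)
      \<comment> \<open>So small that k theta is below s' - m; then min(k + theta/2, 2 + k theta) <=
        m + k theta is still below s', and the energy diverges.\<close>
      define \<theta> where "\<theta> = min 1 ((s' - m) / (2 * ?k))"
      have \<theta>: "0 < \<theta>" "\<theta> \<le> 1" using s' k by (auto simp: \<theta>_def)
      have "\<theta> \<le> (s' - m) / (2 * ?k)" unfolding \<theta>_def by (rule min.cobounded2)
      then have "?k * \<theta> \<le> ?k * ((s' - m) / (2 * ?k))" using k by (intro mult_left_mono) auto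
      also have "\<dots> = (s' - m) / 2" using k by simp
      finally have k\<theta>: "?k * \<theta> < s' - m" using s' by simp
      have "1 * \<theta> \<le> ?k * \<theta>" using k \<theta> by (intro mult_right_mono) auto
      then have "\<theta> / 2 \<le> ?k * \<theta>" by (rule order_trans[rotated]) (use \<theta> in simp)
      then have "min (?k + \<theta> / 2) (2 + ?k * \<theta>) \<le> m + ?k * \<theta>" by (auto simp: m_def min_def)
      then have "min (?k + \<theta> / 2) (2 + ?k * \<theta>) < s'" using k\<theta> by simp
      then have inf: "sheet_energy w (1 / \<theta>) (s' / \<theta> - (?k + 1)) = \<infinity>"
        by (rule sheet_energy_infinite[of w \<theta> s', OF w \<theta>])
      define D where "D = real DIM((real ^ 'k) \<times> real)"
      have D: "D = ?k + 1" by (simp add: D_def)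
      \<comment> \<open>The gap (s - s') / theta is divided by the dimension \<open>D\<close>: it is
        the spare decay per coordinate that makes the energy converge.\<close>
      define \<delta> where "\<delta> = (s - s') / \<theta> / D"
      have \<delta>: "0 < \<delta>" using s' \<theta> k by (simp add: \<delta>_def D)
      have ex: "s' / \<theta> - (?k + 1) = s / \<theta> + (- ((1 + \<delta>) * D))"
      proof -
        have "\<delta> * D = (s - s') / \<theta>" using k by (simp add: \<delta>_def D)
        then have "(1 + \<delta>) * D = (?k + 1) + (s / \<theta> - s' / \<theta>)" by (simp add: distrib_right D diff_divide_distrib)
        then show ?thesis by simp
      qed
      have "sheet_energy w (1 / \<theta>) (s' / \<theta> - (?k + 1)) < \<infinity>"
        unfolding sheet_energy_def
      proof (rule nn_integral_finite_of_decay[OF _ \<delta>, where C="C powr (1 / \<theta>) * 2 powr ((1 + \<delta>) * D)" and b="s' / \<theta> - (?k + 1)"])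
        show "- real DIM((real ^ 'k) \<times> real) < s' / \<theta> - (?k + 1)" using s' \<theta> by simp
      next
        fix \<zeta> :: "(real ^ 'k) \<times> real"
        have "norm (sheet_ft w \<zeta>) powr (2 * (1 / \<theta>)) \<le> 1 powr (2 * (1 / \<theta>))" using \<theta> by (intro powr_mono2 norm_sheet_ft_le) auto
        then show "norm (sheet_ft w \<zeta>) powr (2 * (1 / \<theta>)) * norm \<zeta> powr (s' / \<theta> - (?k + 1)) \<le> norm \<zeta> powr (s' / \<theta> - (?k + 1))"
          using mult_right_mono[of "norm (sheet_ft w \<zeta>) powr (2 * (1 / \<theta>))" 1 "norm \<zeta> powr (s' / \<theta> - (?k + 1))"] by simp
      next
        fix \<zeta> :: "(real ^ 'k) \<times> real" assume n: "1 < norm \<zeta>"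
        define z where "z = norm (sheet_ft w \<zeta>)"
        have z2: "z powr (2 * (1 / \<theta>)) = (z\<^sup>2) powr (1 / \<theta>)"
        proof (cases "z = 0")
          case False
          then have "z\<^sup>2 = z powr 2" by (simp add: z_def)
          then show ?thesis by (simp only: powr_powr)
        qed simp
        have "z powr (2 * (1 / \<theta>)) * norm \<zeta> powr (s' / \<theta> - (?k + 1)) = (z\<^sup>2) powr (1 / \<theta>) * ((norm \<zeta> powr s) powr (1 / \<theta>) * norm \<zeta> powr (- ((1 + \<delta>) * D)))"
          unfolding ex z2 powr_powr powr_add by simp
        also have "\<dots> = (z\<^sup>2 * norm \<zeta> powr s) powr (1 / \<theta>) * norm \<zeta> powr (- ((1 + \<delta>) * D))" by (simp only: powr_mult mult.assoc)
        also have "\<dots> \<le> C powr (1 / \<theta>) * (2 powr ((1 + \<delta>) * D) * (\<Prod>u\<in>Basis. (1 + \<bar>\<zeta> \<bullet> u\<bar>) powr (- (1 + \<delta>))))"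
        proof (intro mult_mono powr_mono2)
          show "norm \<zeta> powr (- ((1 + \<delta>) * D)) \<le> 2 powr ((1 + \<delta>) * D) * (\<Prod>u\<in>Basis. (1 + \<bar>\<zeta> \<bullet> u\<bar>) powr (- (1 + \<delta>)))"
            unfolding D_def using n \<delta> by (intro norm_powr_dim_le) auto
          show "z\<^sup>2 * norm \<zeta> powr s \<le> C" unfolding z_def by (rule bd)
        qed (use \<theta> in auto)
        finally show "norm (sheet_ft w \<zeta>) powr (2 * (1 / \<theta>)) * norm \<zeta> powr (s' / \<theta> - (?k + 1))
          \<le> C powr (1 / \<theta>) * 2 powr ((1 + \<delta>) * D) * (\<Prod>u\<in>Basis. (1 + \<bar>\<zeta> \<bullet> u\<bar>) powr (- (1 + \<delta>)))"
          unfolding z_def by (simp only: mult.assoc)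
      qed
      then show False using inf by simp
    qed
    then show "ennreal s \<le> ennreal m" by (rule ennreal_leI)
  qed
  show "ennreal m \<le> fourier_spectrum \<mu> 0"
  proof (rule ennreal_le_of_approx)
    fix \<kappa> :: real assume \<kappa>: "0 < \<kappa>" "\<kappa> \<le> 1/2"
    define s where "s = m - \<kappa>"
    have s0: "0 < s" using m1 \<kappa> by (simp add: s_def)
    \<comment> \<open>With 3 k delta = kappa the exponent of \<open>spread\<close> becomes m - k,
      which is at most 0.\<close>
    define \<delta> where "\<delta> = \<kappa> / (3 * ?k)"
    have \<delta>: "0 < \<delta>" "3 * ?k * \<delta> = \<kappa>" using \<kappa> k by (auto simp: \<delta>_def)
    have "3 * 1 * \<delta> \<le> 3 * ?k * \<delta>" using k \<delta> by (intro mult_right_mono) auto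
    then have \<delta>3: "3 * \<delta> \<le> \<kappa>" using \<delta> by simp
    have "\<exists>C\<ge>0. \<forall>\<zeta> :: (real ^ 'k) \<times> real. 1 \<le> norm \<zeta> \<longrightarrow>
      norm (sheet_ft w \<zeta>) powr (2 * 1) * norm \<zeta> powr s
        \<le> C * spread (snd \<zeta>) powr (s + ?k * (0 + 3 * \<delta> - 1)) * (\<Prod>i\<in>UNIV. (1 + \<bar>fst \<zeta> $ i\<bar>) powr (- (0 + \<delta>)))"
    proof (rule sheet_ft_powr_le)
      show "\<And>i \<epsilon>. 0 < \<epsilon> \<Longrightarrow> \<exists>K>0. \<forall>x y. (norm (path_ft (w i) x y))\<^sup>2 \<le> K * decay x y * (1 + \<bar>x\<bar> + \<bar>y\<bar>) powr \<epsilon>"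
        using w by (auto simp: brownian_like_path_def)
    qed (use \<delta> \<delta>3 \<kappa> s0 m1 in \<open>auto simp: s_def\<close>)
    then obtain C where C: "0 \<le> C" "\<And>\<zeta> :: (real ^ 'k) \<times> real. 1 \<le> norm \<zeta> \<Longrightarrow>
      norm (sheet_ft w \<zeta>) powr (2 * 1) * norm \<zeta> powr s
        \<le> C * spread (snd \<zeta>) powr (s + ?k * (0 + 3 * \<delta> - 1)) * (\<Prod>i\<in>UNIV. (1 + \<bar>fst \<zeta> $ i\<bar>) powr (- (0 + \<delta>)))" by blast
    have bd: "(norm (sheet_ft w \<zeta>))\<^sup>2 * norm \<zeta> powr s \<le> max 1 C" for \<zeta> :: "(real ^ 'k) \<times> real"
    proof (cases "1 \<le> norm \<zeta>")
      case False
      have "(norm (sheet_ft w \<zeta>))\<^sup>2 * norm \<zeta> powr s \<le> 1 * 1"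
        using False s0 by (intro mult_mono power_le_one norm_sheet_ft_le powr_le1) auto
      then show ?thesis by simp
    next
      case True
      have e0: "s + ?k * (0 + 3 * \<delta> - 1) \<le> 0"
      proof -
        have "?k * (0 + 3 * \<delta> - 1) = 3 * ?k * \<delta> - ?k" by (simp add: algebra_simps)
        then show ?thesis using \<delta>(2) m1 by (simp add: s_def)
      qed
      have "norm (sheet_ft w \<zeta>) powr (2 * 1) = (norm (sheet_ft w \<zeta>))\<^sup>2" by simp
      then have "(norm (sheet_ft w \<zeta>))\<^sup>2 * norm \<zeta> powr s \<le> C * spread (snd \<zeta>) powr (s + ?k * (0 + 3 * \<delta> - 1)) * (\<Prod>i\<in>UNIV. (1 + \<bar>fst \<zeta> $ i\<bar>) powr (- (0 + \<delta>)))"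
        using C(2)[OF True] by (simp only:)
      also have "\<dots> \<le> C * 1 * 1"
      proof (intro mult_mono mult_nonneg_nonneg C(1) prod_le_1 conjI)
        show "spread (snd \<zeta>) powr (s + ?k * (0 + 3 * \<delta> - 1)) \<le> 1"
          using powr_mono[OF e0 spread_ge_1[of "snd \<zeta>"]] spread_ge_1[of "snd \<zeta>"] by simp
        show "(1 + \<bar>fst \<zeta> $ i\<bar>) powr (- (0 + \<delta>)) \<le> 1" for i
          using powr_mono[of "- (0 + \<delta>)" 0 "1 + \<bar>fst \<zeta> $ i\<bar>"] \<delta> by (simp split: if_splits)
      qed (auto intro: prod_nonneg)
      finally show ?thesis by simp
    qed
    have "fourier_energy s 0 \<mu> \<le> ennreal (max 1 C)"
      unfolding fourier_energy_def ft using bd by (simp, intro SUP_least ennreal_leI)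
    then have "fourier_energy s 0 \<mu> < \<infinity>" by (rule le_less_trans) simp
    then show "ennreal (m - \<kappa>) \<le> fourier_spectrum \<mu> 0"
      unfolding fourier_spectrum_def s_def[symmetric] using s0 by (intro SUP_upper) auto
  qed
qed

lemma phase_transition_min:
  fixes k :: real
  assumes k: "2 < k" and f: "\<And>\<theta>. \<theta> \<in> {0..1} \<Longrightarrow> f \<theta> = min (k + \<theta> / 2) (2 + k * \<theta>)"
  shows "phase_transition_at f ((k - 2) / (k - 1 / 2))"
proof -
  define t where "t = (k - 2) / (k - 1 / 2)"
  define e where "e = min t (1 - t)"
  have kp: "0 < k - 1/2" using k by simp
  have t: "0 < t" "t < 1" using k by (auto simp: t_def)
  have teq: "t * (k - 1/2) = k - 2" using kp by (simp add: t_def)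
  have e: "0 < e" "e \<le> t" "e \<le> 1 - t" using t by (auto simp: e_def)
  have left: "f \<theta> = k * \<theta> + 2" if "\<theta> \<in> {t - e..t}" for \<theta>
  proof -
    have "\<theta> * (k - 1/2) \<le> t * (k - 1/2)" using that kp by (intro mult_right_mono) auto
    then have "2 + k * \<theta> \<le> k + \<theta> / 2" unfolding teq by (simp add: algebra_simps)
    then show ?thesis using f[of \<theta>] that e t by (simp add: min_def)
  qed
  have right: "f \<theta> = 1/2 * \<theta> + k" if "\<theta> \<in> {t..t + e}" for \<theta>
  proof -
    have "t * (k - 1/2) \<le> \<theta> * (k - 1/2)" using that kp by (intro mult_right_mono) auto
    then have "k + \<theta> / 2 \<le> 2 + k * \<theta>" unfolding teq by (simp add: algebra_simps)
    then show ?thesis using f[of \<theta>] that e t by (simp add: min_def)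
  qed
  have "{t - e..t + e} \<subseteq> {0..1}" using e by auto
  moreover have "affine_with_slope_on {t - e..t} k f"
    unfolding affine_with_slope_on_def using left by blast
  moreover have "affine_with_slope_on {t..t + e} (1/2) f"
    unfolding affine_with_slope_on_def using right by blast
  moreover have "k \<noteq> 1/2" using k by simp
  ultimately show ?thesis
    unfolding phase_transition_at_def t_def[symmetric] using e(1) by blast
qed

theorem theorem2p1:
  fixes M :: "'w measure" and X :: "'k::finite \<Rightarrow> real \<Rightarrow> 'w \<Rightarrow> real"
  assumes "prob_space M"
    and "\<And>i. standard_brownian_motion M (X i)"
    and "indep_processes M X UNIV"
  shows "AE \<omega> in M.
    (let k = real CARD('k); \<mu> = surface_measure (additive_sheet X \<omega>);
         f = (\<lambda>\<theta>. enn2real (fourier_spectrum \<mu> \<theta>)) in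
      (\<forall>\<theta>\<in>{0..1}. fourier_spectrum \<mu> \<theta> = ennreal (min (k + \<theta> / 2) (2 + k * \<theta>))) \<and>
      (k > 2 \<longrightarrow> phase_transition_at f ((k - 2) / (k - 1 / 2))) \<and>
      (k = 1 \<or> k = 2 \<longrightarrow> (\<exists>a. affine_with_slope_on {0..1} a f)))"
proof -
  have "\<exists>Z :: real \<Rightarrow> 'w \<Rightarrow> real. AE \<omega> in M. brownian_like_path (\<lambda>t. Z t \<omega>) \<and> (\<forall>t\<in>{0..1}. Z t \<omega> = X i t \<omega>)" for i
    by (rule AE_brownian_like_path[OF assms(2)[of i]]) (rule exI)
  then have "\<forall>i. \<exists>Z :: real \<Rightarrow> 'w \<Rightarrow> real. AE \<omega> in M. brownian_like_path (\<lambda>t. Z t \<omega>) \<and> (\<forall>t\<in>{0..1}. Z t \<omega> = X i t \<omega>)" ..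
  from choice[OF this] obtain Z :: "'k \<Rightarrow> real \<Rightarrow> 'w \<Rightarrow> real"
    where Z: "\<And>i. AE \<omega> in M. brownian_like_path (\<lambda>t. Z i t \<omega>) \<and> (\<forall>t\<in>{0..1}. Z i t \<omega> = X i t \<omega>)" by blast
  \<comment> \<open>Finitely many almost sure events are intersected here, before theta is
    introduced; the rest is deterministic.\<close>
  have "AE \<omega> in M. \<forall>i\<in>UNIV. brownian_like_path (\<lambda>t. Z i t \<omega>) \<and> (\<forall>t\<in>{0..1}. Z i t \<omega> = X i t \<omega>)"
    by (rule AE_finite_allI[OF finite]) (rule Z)
  then show ?thesis
  proof eventually_elim
    case (elim \<omega>)
    define k where "k = real CARD('k)"
    define w where "w i t = Z i t \<omega>" for i t
    define \<mu> where "\<mu> = surface_measure (additive_sheet X \<omega>)"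
    define f where "f \<theta> = enn2real (fourier_spectrum \<mu> \<theta>)" for \<theta>
    have w: "brownian_like_path (w i)" for i using elim by (simp add: w_def[abs_def])
    \<comment> \<open>The surface measure only sees times in the unit cube, where the continuous
      versions agree with the given processes.\<close>
    have "\<mu> = surface_measure (\<lambda>t. \<Sum>i\<in>UNIV. w i (t $ i))"
      unfolding \<mu>_def surface_measure_def
    proof (rule distr_cong)
      fix t :: "real ^ 'k" assume "t \<in> space (restrict_space lborel (cbox 0 1))"
      then have "t $ i \<in> {0..1}" for i by (simp add: space_restrict_space mem_box_cart)
      then show "(t, additive_sheet X \<omega> t) = (t, \<Sum>i\<in>UNIV. w i (t $ i))"
        using elim by (simp add: additive_sheet_def w_def)
    qed auto
    then have ft: "fourier_transform \<mu> = sheet_ft w"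
      using fourier_transform_sheet[of w] w by (simp add: brownian_like_path_def)
    have k: "1 \<le> k" unfolding k_def using one_le_card_finite[where ?'a='k] by (simp del: one_le_card_finite)
    have main: "fourier_spectrum \<mu> \<theta> = ennreal (min (k + \<theta> / 2) (2 + k * \<theta>))" if "\<theta> \<in> {0..1}" for \<theta>
    proof (cases "\<theta> = 0")
      case True
      then show ?thesis using fourier_spectrum_sheet_0[OF w ft] by (simp add: k_def)
    next
      case False
      then show ?thesis unfolding k_def using that by (intro fourier_spectrum_sheet_pos[OF w ft]) auto
    qed
    have f: "f \<theta> = min (k + \<theta> / 2) (2 + k * \<theta>)" if "\<theta> \<in> {0..1}" for \<theta>
      using main[OF that] that k by (simp add: f_def)
    have "\<exists>a. affine_with_slope_on {0..1} a f" if "k = 1 \<or> k = 2"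
    proof -
      have "f \<theta> = 1/2 * \<theta> + k" if "\<theta> \<in> {0..1}" for \<theta>
        using f[OF that] that \<open>k = 1 \<or> k = 2\<close> by (auto simp: min_def)
      then show ?thesis unfolding affine_with_slope_on_def by blast
    qed
    then show ?case
      using main phase_transition_min[of k f, OF _ f]
      unfolding Let_def k_def[symmetric] \<mu>_def[symmetric] f_def[symmetric, abs_def] by blast
  qed
qed

end
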